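(* Let $k$ be an algebraically closed field of characteristic $2$. Let $X\subset\mathbb{P}^{14}_k$, with homogeneous coordinates $\{x_{i,j}\}_{0\leq i<j\leq 5}$, be the closed subscheme defined by the $15$ quadratic equations $$x_{i,j}x_{k,l}-x_{i,k}x_{j,l}+x_{i,l}x_{j,k}=0\qquad(0\leq i<j<k<l\leq 5)$$ and the five linear equations $$x_{0,3}-x_{1,4}=0,\quad x_{0,4}-x_{2,5}=0,\quad x_{1,3}+x_{0,5}=0,\quad x_{0,1}+x_{2,4}=0,\quad x_{0,2}+x_{3,5}=0.$$ Then $X$ is not $F$-split.
   Context: The quadratic equations define the Plücker-embedded Grassmannian $\mathrm{Gr}(6,2)\subset\mathbb{P}^{14}$, and the paper records that the linear section $X$ is a prime Fano threefold of genus $8$ (i.e. a smooth projective threefold with $-K_X$ ample, $\mathrm{Pic}\,X$ generated by $\omega_X$, and $(-K_X)^3=14$) whenever the characteristic is not $11$. A scheme $X$ over $k$ is $F$-split if the homomorphism $\mathcal{O}_X\to F_*\mathcal{O}_X$ induced by the absolute Frobenius $F$ splits as a homomorphism of $\mathcal{O}_X$-modules. *)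

theory Defs
  imports
    "HOL-Algebra.Algebra"
    "HOL-Algebra.Algebraic_Closure_Type"
    "HOL-Analysis.Abstract_Topology"
    "HOL-Library.Poly_Mapping"
begin

section \<open>Ringed spaces and F-splittings\<close>

text \<open>
  A space with a (pre)sheaf of rings: the underlying topological space, the ring of sections
  over each open set, and the restriction map from \<open>U\<close> to \<open>V\<close> for \<open>V \<subseteq> U\<close>.
  Only the values at open sets matter.
\<close>

record ('p, 's) ringed_space =
  space_top :: "'p topology"
  sections :: "'p set \<Rightarrow> 's ring"
  restr :: "'p set \<Rightarrow> 'p set \<Rightarrow> 's \<Rightarrow> 's"

definition module_hom :: "('a, 'c) ring_scheme \<Rightarrow> ('a, 'b, 'd) module_scheme \<Rightarrow>
    ('a, 'e, 'f) module_scheme \<Rightarrow> ('b \<Rightarrow> 'e) set" where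
  "module_hom R M N = {h \<in> carrier M \<rightarrow> carrier N.
     (\<forall>x\<in>carrier M. \<forall>y\<in>carrier M. h (x \<oplus>\<^bsub>M\<^esub> y) = h x \<oplus>\<^bsub>N\<^esub> h y) \<and>
     (\<forall>a\<in>carrier R. \<forall>x\<in>carrier M. h (a \<odot>\<^bsub>M\<^esub> x) = a \<odot>\<^bsub>N\<^esub> h x)}"

definition self_module :: "'a ring \<Rightarrow> ('a, 'a) module" where
  "self_module R =
     \<lparr>carrier = carrier R, monoid.mult = monoid.mult R, one = one R, ring.zero = ring.zero R,
      ring.add = ring.add R, module.smult = (\<lambda>a x. a \<otimes>\<^bsub>R\<^esub> x)\<rparr>"

text \<open>
  The absolute Frobenius \<open>F\<close> of a scheme of characteristic \<open>p\<close> is the identity on the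
  underlying space and the \<open>p\<close>-th power map on sections.  So the sections of \<open>F\<^sub>* \<O>\<close>
  over \<open>U\<close> are those of \<open>\<O>\<close>, with \<open>\<O>(U)\<close> acting through \<open>p\<close>-th powers.
\<close>

definition frobenius_module :: "nat \<Rightarrow> 'a ring \<Rightarrow> ('a, 'a) module" where
  "frobenius_module p R =
     \<lparr>carrier = carrier R, monoid.mult = monoid.mult R, one = one R, ring.zero = ring.zero R,
      ring.add = ring.add R, module.smult = (\<lambda>a x. (a [^]\<^bsub>R\<^esub> p) \<otimes>\<^bsub>R\<^esub> x)\<rparr>"

text \<open>
  Homomorphisms of sheaves of modules over the structure sheaf of \<open>S\<close>.  In both arguments the
  restriction maps are those of the structure sheaf, which is the case for \<open>\<O>\<close> and
  \<open>F\<^sub>* \<O>\<close>.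
\<close>

definition sheaf_module_hom :: "('p, 's) ringed_space \<Rightarrow> ('p set \<Rightarrow> ('s, 's) module) \<Rightarrow>
    ('p set \<Rightarrow> ('s, 's) module) \<Rightarrow> ('p set \<Rightarrow> 's \<Rightarrow> 's) \<Rightarrow> bool" where
  "sheaf_module_hom S M N \<phi> \<longleftrightarrow>
     (\<forall>U. openin (space_top S) U \<longrightarrow> \<phi> U \<in> module_hom (sections S U) (M U) (N U)) \<and>
     (\<forall>U V. openin (space_top S) U \<longrightarrow> openin (space_top S) V \<longrightarrow> V \<subseteq> U \<longrightarrow>
        (\<forall>s\<in>carrier (M U). \<phi> V (restr S U V s) = restr S U V (\<phi> U s)))"

text \<open>To be used for schemes of prime characteristic \<open>p\<close>.\<close>

definition F_split :: "nat \<Rightarrow> ('p, 's) ringed_space \<Rightarrow> bool" where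
  "F_split p S \<longleftrightarrow>
     (\<exists>\<phi>. sheaf_module_hom S (\<lambda>U. frobenius_module p (sections S U))
              (\<lambda>U. self_module (sections S U)) \<phi> \<and>
          (\<forall>U. openin (space_top S) U \<longrightarrow>
             (\<forall>s\<in>carrier (sections S U). \<phi> U (s [^]\<^bsub>sections S U\<^esub> p) = s)))"

section \<open>Proj of a graded ring\<close>

text \<open>
  A graded commutative ring is given by a ring \<open>R\<close> and the family \<open>G\<close> of its graded pieces.
\<close>

definition homogeneous_elems :: "(nat \<Rightarrow> 'a set) \<Rightarrow> 'a set" where
  "homogeneous_elems G = (\<Union>d. G d)"

definition irrelevant_ideal :: "'a ring \<Rightarrow> (nat \<Rightarrow> 'a set) \<Rightarrow> 'a set" where
  "irrelevant_ideal R G = Idl\<^bsub>R\<^esub> (\<Union>d\<in>{0<..}. G d)"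

definition homogeneous_ideal :: "'a ring \<Rightarrow> (nat \<Rightarrow> 'a set) \<Rightarrow> 'a set \<Rightarrow> bool" where
  "homogeneous_ideal R G I \<longleftrightarrow> ideal I R \<and> I = Idl\<^bsub>R\<^esub> (I \<inter> homogeneous_elems G)"

definition Proj_points :: "'a ring \<Rightarrow> (nat \<Rightarrow> 'a set) \<Rightarrow> 'a set set" where
  "Proj_points R G =
     {P. primeideal P R \<and> homogeneous_ideal R G P \<and> \<not> irrelevant_ideal R G \<subseteq> P}"

definition basic_open :: "'a ring \<Rightarrow> (nat \<Rightarrow> 'a set) \<Rightarrow> 'a \<Rightarrow> 'a set set" where
  "basic_open R G f = {P \<in> Proj_points R G. f \<notin> P}"

text \<open>
  The Zariski topology: complements of the sets \<open>V(J)\<close>, \<open>J\<close> a homogeneous ideal, are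
  the unions of the sets \<open>D\<^sub>+(f)\<close> with \<open>f \<in> J\<close> homogeneous.
\<close>

definition Proj_topology :: "'a ring \<Rightarrow> (nat \<Rightarrow> 'a set) \<Rightarrow> 'a set topology" where
  "Proj_topology R G = topology_generated_by (basic_open R G ` homogeneous_elems G)"

text \<open>
  The fraction \<open>a/s\<close> in the degree-zero part of the localization of \<open>R\<close> at the homogeneous
  elements outside \<open>P\<close>, as the class of all fractions \<open>b/t\<close> with \<open>b\<close> and \<open>t\<close> of equal
  degree that are equal to it.
\<close>

definition hfrac :: "'a ring \<Rightarrow> (nat \<Rightarrow> 'a set) \<Rightarrow> 'a set \<Rightarrow> 'a \<Rightarrow> 'a \<Rightarrow> ('a \<times> 'a) set" where
  "hfrac R G P a s =
     {(b, t). (\<exists>d. b \<in> G d \<and> t \<in> G d) \<and> t \<notin> P \<and>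
        (\<exists>u \<in> homogeneous_elems G - P.
           u \<otimes>\<^bsub>R\<^esub> (a \<otimes>\<^bsub>R\<^esub> t \<ominus>\<^bsub>R\<^esub> b \<otimes>\<^bsub>R\<^esub> s) = \<zero>\<^bsub>R\<^esub>)}"

text \<open>
  The ring of these fractions.  The unions in the operations are unions of equal classes.
\<close>

definition Proj_stalk :: "'a ring \<Rightarrow> (nat \<Rightarrow> 'a set) \<Rightarrow> 'a set \<Rightarrow> ('a \<times> 'a) set ring" where
  "Proj_stalk R G P =
     \<lparr>carrier = {hfrac R G P a s | a s d. a \<in> G d \<and> s \<in> G d \<and> s \<notin> P},
      monoid.mult = (\<lambda>A B. \<Union>(a, s)\<in>A. \<Union>(b, t)\<in>B. hfrac R G P (a \<otimes>\<^bsub>R\<^esub> b) (s \<otimes>\<^bsub>R\<^esub> t)),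
      one = hfrac R G P \<one>\<^bsub>R\<^esub> \<one>\<^bsub>R\<^esub>,
      ring.zero = hfrac R G P \<zero>\<^bsub>R\<^esub> \<one>\<^bsub>R\<^esub>,
      ring.add = (\<lambda>A B. \<Union>(a, s)\<in>A. \<Union>(b, t)\<in>B.
               hfrac R G P (a \<otimes>\<^bsub>R\<^esub> t \<oplus>\<^bsub>R\<^esub> b \<otimes>\<^bsub>R\<^esub> s) (s \<otimes>\<^bsub>R\<^esub> t))\<rparr>"

text \<open>
  Sections over \<open>U\<close> are the functions on \<open>U\<close> with values in the stalks that are locally
  given by a single fraction; outside \<open>U\<close> they are \<open>undefined\<close>.
\<close>

definition Proj_sections ::
    "'a ring \<Rightarrow> (nat \<Rightarrow> 'a set) \<Rightarrow> 'a set set \<Rightarrow> ('a set \<Rightarrow> ('a \<times> 'a) set) ring" where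
  "Proj_sections R G U =
     \<lparr>carrier = {\<sigma> \<in> (\<Pi>\<^sub>E P\<in>U. carrier (Proj_stalk R G P)).
        \<forall>P\<in>U. \<exists>V. openin (Proj_topology R G) V \<and> P \<in> V \<and> V \<subseteq> U \<and>
          (\<exists>d. \<exists>a\<in>G d. \<exists>s\<in>G d. \<forall>Q\<in>V. s \<notin> Q \<and> \<sigma> Q = hfrac R G Q a s)},
      monoid.mult = (\<lambda>\<sigma> \<tau>. \<lambda>P\<in>U. \<sigma> P \<otimes>\<^bsub>Proj_stalk R G P\<^esub> \<tau> P),
      one = (\<lambda>P\<in>U. \<one>\<^bsub>Proj_stalk R G P\<^esub>),
      ring.zero = (\<lambda>P\<in>U. \<zero>\<^bsub>Proj_stalk R G P\<^esub>),
      ring.add = (\<lambda>\<sigma> \<tau>. \<lambda>P\<in>U. \<sigma> P \<oplus>\<^bsub>Proj_stalk R G P\<^esub> \<tau> P)\<rparr>"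

definition Proj :: "'a ring \<Rightarrow> (nat \<Rightarrow> 'a set) \<Rightarrow>
    ('a set, 'a set \<Rightarrow> ('a \<times> 'a) set) ringed_space" where
  "Proj R G = \<lparr>space_top = Proj_topology R G, sections = Proj_sections R G,
     restr = (\<lambda>U V \<sigma>. restrict \<sigma> V)\<rparr>"

section \<open>Closed subschemes of projective space\<close>

text \<open>
  Polynomials in variables indexed by \<open>'v\<close> are finitely supported functions on monomials,
  the latter being finitely supported exponent functions.
\<close>

type_synonym ('v, 'k) mpoly = "('v \<Rightarrow>\<^sub>0 nat) \<Rightarrow>\<^sub>0 'k"

definition Var :: "'v \<Rightarrow> ('v, 'k::comm_ring_1) mpoly" where
  "Var v = Poly_Mapping.single (Poly_Mapping.single v 1) 1"

definition homogeneous_polys :: "nat \<Rightarrow> ('v, 'k::comm_ring_1) mpoly set" where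
  "homogeneous_polys d =
     {f. \<forall>m\<in>Poly_Mapping.keys f. (\<Sum>v\<in>Poly_Mapping.keys m. Poly_Mapping.lookup m v) = d}"

abbreviation mpoly_ring :: "('v, 'k::comm_ring_1) mpoly ring" where
  "mpoly_ring \<equiv> ring_of_type_algebra"

text \<open>
  The closed subscheme, of the projective space with homogeneous coordinates indexed by \<open>'v\<close>,
  that is defined by a set \<open>E\<close> of homogeneous polynomials: \<open>Proj\<close> of the polynomial ring
  modulo the ideal generated by \<open>E\<close>, with the induced grading.
\<close>

definition closed_subscheme :: "('v, 'k::comm_ring_1) mpoly set \<Rightarrow>
    (('v, 'k) mpoly set set, ('v, 'k) mpoly set set \<Rightarrow>
      (('v, 'k) mpoly set \<times> ('v, 'k) mpoly set) set) ringed_space" where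
  "closed_subscheme E =
     (let I = Idl\<^bsub>mpoly_ring\<^esub> E
      in Proj (mpoly_ring Quot I) (\<lambda>d. (\<lambda>f. I +>\<^bsub>mpoly_ring\<^esub> f) ` homogeneous_polys d))"

typedef pluecker_index = "{(i, j). i < j \<and> j \<le> 5} :: (nat \<times> nat) set"
  by (rule exI[of _ "(0, 1)"]) simp

text \<open>Meaningful for \<open>i < j \<le> 5\<close> only.\<close>

definition pcoord :: "nat \<Rightarrow> nat \<Rightarrow> (pluecker_index, 'k::comm_ring_1) mpoly" where
  "pcoord i j = Var (Abs_pluecker_index (i, j))"

end

theory Submission
  imports Defs
begin

text \<open>
  In characteristic \<open>2\<close> a splitting \<open>\<phi> : F\<^sub>* \<O> \<rightarrow> \<O>\<close> extends to a square-root-linear map from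
  sections of \<open>\<O>(2)\<close> to sections of \<open>\<O>(1)\<close> with \<open>\<phi>(u\<^sup>2 m) = u \<phi>(m)\<close> and \<open>\<phi>(u\<^sup>2) = u\<close> for linear
  forms \<open>u\<close>.  Hence every relation \<open>\<Sum> u\<^sub>j\<^sup>2 m\<^sub>j = 0\<close> in the homogeneous coordinate ring, with linear
  \<open>u\<^sub>j\<close> and quadratic \<open>m\<^sub>j\<close>, gives \<open>\<Sum> u\<^sub>j \<phi>(m\<^sub>j) = 0\<close>.  No knowledge of \<open>H\<^sup>0(X, \<O>(1))\<close> is needed:
  on a rational curve of degree \<open>n\<close> in \<open>X\<close> the section \<open>\<phi>(m)\<close> is a polynomial of degree at most \<open>n\<close> in
  the parameter, and these polynomials agree where two curves meet.  On two lines, two twisted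
  cubics and a rational quartic defined over the field with two elements, the resulting linear
  equations for the coefficients of the polynomials are inconsistent.
\<close>

section \<open>Proj of a graded ring: fractions, sections and values at k-points\<close>

section \<open>Homogeneous fractions\<close>

text \<open>The obstacle is that a section of O(1) over X is only known to be locally a fraction;
  identifying it with a linear form would require projective normality. On a rational curve of
  degree n it becomes a section of O(n) on the projective line, so each quadratic monomial m
  contributes just n + 1 unknown coefficients per curve. All relations and curves are defined over
  F_2. Treating the traces of distinct monomials as independent unknowns therefore gives linear
  equations with coefficients in F_2, and inconsistency is certified by a set of equations that add
  up to 1 = 0. Three kinds of equations enter: coefficients of restricted relations, equality of
  values where two curves meet, and the normalisation \<phi>(u^2) = u. The last one is
  indispensable, because \<phi> = 0 satisfies all the others. The 1 comes from a term w^2 c^2 in a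
  relation: it contributes w c, a known polynomial on the quartic.\<close>

lemma Union_pairs_const:
  assumes "(a0, s0) \<in> A" "(b0, t0) \<in> B"
    and "\<And>a s b t. (a, s) \<in> A \<Longrightarrow> (b, t) \<in> B \<Longrightarrow> f a s b t = c"
  shows "(\<Union>(a, s)\<in>A. \<Union>(b, t)\<in>B. f a s b t) = c"
  using assms by fast

locale graded_cring = cring R for R :: "'a ring" (structure) +
  fixes G :: "nat \<Rightarrow> 'a set"
  assumes G_closed: "G d \<subseteq> carrier R"
    and G_one: "\<one> \<in> G 0"
    and G_add: "\<lbrakk>a \<in> G d; b \<in> G d\<rbrakk> \<Longrightarrow> a \<oplus> b \<in> G d"
    and G_mult: "\<lbrakk>a \<in> G d; b \<in> G e\<rbrakk> \<Longrightarrow> a \<otimes> b \<in> G (d + e)"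
begin

abbreviation "H \<equiv> homogeneous_elems G"

lemma H_intro: "a \<in> G d \<Longrightarrow> a \<in> H"
  by (auto simp: homogeneous_elems_def)

lemma G_carrier: "a \<in> G d \<Longrightarrow> a \<in> carrier R"
  using G_closed by blast

lemma H_carrier: "a \<in> H \<Longrightarrow> a \<in> carrier R"
  using G_closed by (auto simp: homogeneous_elems_def)

lemma H_mult: "\<lbrakk>a \<in> H; b \<in> H\<rbrakk> \<Longrightarrow> a \<otimes> b \<in> H"
  using G_mult by (fastforce simp: homogeneous_elems_def)

lemma H_one: "\<one> \<in> H"
  using G_one by (rule H_intro)

lemma G_pow: "a \<in> G d \<Longrightarrow> a [^] n \<in> G (n * d)" for n :: nat
proof (induction n)
  case (Suc n)
  then show ?case using G_mult[of "a [^] n" "n * d" a d] by (simp add: add.commute)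
qed (simp add: G_one)

lemma point_prime: "P \<in> Proj_points R G \<Longrightarrow> primeideal P R"
  by (simp add: Proj_points_def)

lemma point_mult: "\<lbrakk>P \<in> Proj_points R G; a \<in> carrier R; b \<in> carrier R\<rbrakk> \<Longrightarrow>
    a \<otimes> b \<in> P \<longleftrightarrow> a \<in> P \<or> b \<in> P"
  by (meson point_prime primeideal.I_prime primeideal.axioms(1) ideal.I_r_closed ideal.I_l_closed)

lemma point_one: "P \<in> Proj_points R G \<Longrightarrow> \<one> \<notin> P"
  by (metis point_prime primeideal.I_notcarr primeideal.axioms(1) ideal.one_imp_carrier)

lemma point_pow: "\<lbrakk>P \<in> Proj_points R G; a \<in> carrier R; a \<notin> P\<rbrakk> \<Longrightarrow> a [^] n \<notin> P" for n :: nat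
  by (induction n) (auto simp: point_mult point_one)

lemma hfrac_self:
  assumes "P \<in> Proj_points R G" "a \<in> G d" "s \<in> G d" "s \<notin> P"
  shows "(a, s) \<in> hfrac R G P a s"
proof -
  have "\<one> \<otimes> (a \<otimes> s \<ominus> a \<otimes> s) = \<zero>"
    using assms G_carrier by (simp add: r_neg a_minus_def)
  then show ?thesis
    using assms H_one point_one[OF assms(1)] unfolding hfrac_def by blast
qed

text \<open>Transitivity of equality of fractions: if \<open>u\<close> annihilates at - bs and
  \<open>v\<close> annihilates ar - cs, then \<open>u \<otimes> v \<otimes> s\<close> annihilates br
  - ct. The factor \<open>s\<close> clears the denominator of the middle fraction and lies outside
  the prime \<open>P\<close>.\<close>

lemma hfrac_subset:
  assumes P: "P \<in> Proj_points R G"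
    and a: "a \<in> G d" "s \<in> G d" "s \<notin> P" and b: "b \<in> G e" "t \<in> G e" "t \<notin> P"
    and u: "u \<in> H" "u \<notin> P" "u \<otimes> (a \<otimes> t \<ominus> b \<otimes> s) = \<zero>"
  shows "hfrac R G P a s \<subseteq> hfrac R G P b t"
proof clarify
  fix c r assume "(c, r) \<in> hfrac R G P a s"
  then obtain f v where c: "c \<in> G f" "r \<in> G f" "r \<notin> P"
    and v: "v \<in> H" "v \<notin> P" "v \<otimes> (a \<otimes> r \<ominus> c \<otimes> s) = \<zero>"
    by (auto simp: hfrac_def)
  note carr = a(1,2)[THEN G_carrier] b(1,2)[THEN G_carrier] c(1,2)[THEN G_carrier] u(1)[THEN
      H_carrier]
    v(1)[THEN H_carrier]
  have "u \<otimes> v \<otimes> s \<otimes> (b \<otimes> r \<ominus> c \<otimes> t)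
     = (t \<otimes> u) \<otimes> (v \<otimes> (a \<otimes> r \<ominus> c \<otimes> s)) \<ominus> (r \<otimes> v) \<otimes> (u \<otimes> (a \<otimes> t \<ominus> b \<otimes> s))"
    using carr by algebra
  also have "\<dots> = \<zero>" using carr unfolding u(3) v(3) by (simp add: a_minus_def)
  finally have "u \<otimes> v \<otimes> s \<otimes> (b \<otimes> r \<ominus> c \<otimes> t) = \<zero>" .
  moreover have "u \<otimes> v \<otimes> s \<in> H - P"
    using u v a carr P by (simp add: H_mult H_intro point_mult)
  ultimately show "(c, r) \<in> hfrac R G P b t"
    using c unfolding hfrac_def by blast
qed

lemma hfrac_eqI:
  assumes P: "P \<in> Proj_points R G"
    and a: "a \<in> G d" "s \<in> G d" "s \<notin> P" and b: "b \<in> G e" "t \<in> G e" "t \<notin> P"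
    and u: "u \<in> H" "u \<notin> P" "u \<otimes> (a \<otimes> t \<ominus> b \<otimes> s) = \<zero>"
  shows "hfrac R G P a s = hfrac R G P b t"
proof
  show "hfrac R G P a s \<subseteq> hfrac R G P b t" by (rule hfrac_subset[OF assms])
  note carr = a(1,2)[THEN G_carrier] b(1,2)[THEN G_carrier] u(1)[THEN H_carrier]
  have "u \<otimes> (b \<otimes> s \<ominus> a \<otimes> t) = \<ominus> (u \<otimes> (a \<otimes> t \<ominus> b \<otimes> s))"
    using carr by algebra
  then have "u \<otimes> (b \<otimes> s \<ominus> a \<otimes> t) = \<zero>" by (simp add: u)
  then show "hfrac R G P b t \<subseteq> hfrac R G P a s"
    using hfrac_subset[OF P b a u(1,2)] by simp
qed

lemma hfrac_cross:
  assumes "P \<in> Proj_points R G"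
    and "a \<in> G d" "s \<in> G d" "s \<notin> P" and "b \<in> G e" "t \<in> G e" "t \<notin> P"
    and "a \<otimes> t = b \<otimes> s"
  shows "hfrac R G P a s = hfrac R G P b t"
  by (rule hfrac_eqI[OF assms(1-7) H_one]) 
    (use assms G_carrier in \<open>auto simp: point_one a_minus_def r_neg\<close>)

text \<open>The union that defines the product runs over all pairs of representatives, so it is a
  single class once the result is independent of them. The product of the two annihilators witnesses
  this independence, and \<open>hfrac_self\<close> keeps the union from being empty.\<close>

lemma hfrac_mult:
  assumes P: "P \<in> Proj_points R G"
    and a: "a \<in> G d" "s \<in> G d" "s \<notin> P" and b: "b \<in> G e" "t \<in> G e" "t \<notin> P"
  shows "hfrac R G P a s \<otimes>\<^bsub>Proj_stalk R G P\<^esub> hfrac R G P b t = hfrac R G P (a \<otimes> b) (s \<otimes> t)"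
proof -
  have "hfrac R G P (a' \<otimes> b') (s' \<otimes> t') = hfrac R G P (a \<otimes> b) (s \<otimes> t)"
    if 1: "(a', s') \<in> hfrac R G P a s" and 2: "(b', t') \<in> hfrac R G P b t" for a' s' b' t'
  proof -
    obtain d' u where a': "a' \<in> G d'" "s' \<in> G d'" "s' \<notin> P"
      and u: "u \<in> H" "u \<notin> P" "u \<otimes> (a \<otimes> s' \<ominus> a' \<otimes> s) = \<zero>"
      using 1 by (auto simp: hfrac_def)
    obtain e' v where b': "b' \<in> G e'" "t' \<in> G e'" "t' \<notin> P"
      and v: "v \<in> H" "v \<notin> P" "v \<otimes> (b \<otimes> t' \<ominus> b' \<otimes> t) = \<zero>"
      using 2 by (auto simp: hfrac_def)
    note carr = a(1,2)[THEN G_carrier] b(1,2)[THEN G_carrier] a'(1,2)[THEN G_carrier] b'(1,2)[THEN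
        G_carrier]
       u(1)[THEN H_carrier] v(1)[THEN H_carrier]
    have "(u \<otimes> v) \<otimes> ((a \<otimes> b) \<otimes> (s' \<otimes> t') \<ominus> (a' \<otimes> b') \<otimes> (s \<otimes> t))
      = (v \<otimes> b \<otimes> t') \<otimes> (u \<otimes> (a \<otimes> s' \<ominus> a' \<otimes> s)) \<oplus>
        (u \<otimes> a' \<otimes> s) \<otimes> (v \<otimes> (b \<otimes> t' \<ominus> b' \<otimes> t))"
      using carr by algebra
    also have "\<dots> = \<zero>" using carr unfolding u(3) v(3) by simp
    finally have *: "(u \<otimes> v) \<otimes> ((a \<otimes> b) \<otimes> (s' \<otimes> t') \<ominus> (a' \<otimes> b') \<otimes> (s \<otimes> t)) = \<zero>" .
    show ?thesis
      by (rule hfrac_eqI[symmetric, OF P _ _ _ _ _ _ _ _ *, of "d + e" "d' + e'"])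
        (use a b a' b' u v carr P in \<open>auto simp: G_mult point_mult H_mult\<close>)
  qed
  then show ?thesis
    unfolding Proj_stalk_def ring.simps monoid.simps
    by (rule Union_pairs_const[OF hfrac_self[OF P a] hfrac_self[OF P b]])
qed

lemma hfrac_add:
  assumes P: "P \<in> Proj_points R G"
    and a: "a \<in> G d" "s \<in> G d" "s \<notin> P" and b: "b \<in> G e" "t \<in> G e" "t \<notin> P"
  shows "hfrac R G P a s \<oplus>\<^bsub>Proj_stalk R G P\<^esub> hfrac R G P b t
    = hfrac R G P (a \<otimes> t \<oplus> b \<otimes> s) (s \<otimes> t)"
proof -
  have "hfrac R G P (a' \<otimes> t' \<oplus> b' \<otimes> s') (s' \<otimes> t') = hfrac R G P (a \<otimes> t \<oplus> b \<otimes> s) (s \<otimes> t)"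
    if 1: "(a', s') \<in> hfrac R G P a s" and 2: "(b', t') \<in> hfrac R G P b t" for a' s' b' t'
  proof -
    obtain d' u where a': "a' \<in> G d'" "s' \<in> G d'" "s' \<notin> P"
      and u: "u \<in> H" "u \<notin> P" "u \<otimes> (a \<otimes> s' \<ominus> a' \<otimes> s) = \<zero>"
      using 1 by (auto simp: hfrac_def)
    obtain e' v where b': "b' \<in> G e'" "t' \<in> G e'" "t' \<notin> P"
      and v: "v \<in> H" "v \<notin> P" "v \<otimes> (b \<otimes> t' \<ominus> b' \<otimes> t) = \<zero>"
      using 2 by (auto simp: hfrac_def)
    note carr = a(1,2)[THEN G_carrier] b(1,2)[THEN G_carrier] a'(1,2)[THEN G_carrier] b'(1,2)[THEN
        G_carrier]
       u(1)[THEN H_carrier] v(1)[THEN H_carrier]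
    have "(u \<otimes> v) \<otimes> ((a \<otimes> t \<oplus> b \<otimes> s) \<otimes> (s' \<otimes> t') \<ominus> (a' \<otimes> t' \<oplus> b' \<otimes> s') \<otimes> (s \<otimes> t))
      = (v \<otimes> t \<otimes> t') \<otimes> (u \<otimes> (a \<otimes> s' \<ominus> a' \<otimes> s)) \<oplus>
        (u \<otimes> s \<otimes> s') \<otimes> (v \<otimes> (b \<otimes> t' \<ominus> b' \<otimes> t))"
      using carr by algebra
    also have "\<dots> = \<zero>" using carr unfolding u(3) v(3) by simp
    finally have *: "(u \<otimes> v) \<otimes> ((a \<otimes> t \<oplus> b \<otimes> s) \<otimes> (s' \<otimes> t') \<ominus>
      (a' \<otimes> t' \<oplus> b' \<otimes> s') \<otimes> (s \<otimes> t)) = \<zero>" .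
    have "b \<otimes> s \<in> G (d + e)" "b' \<otimes> s' \<in> G (d' + e')"
      using G_mult a b a' b' by (metis add.commute)+
    then show ?thesis
      by (intro hfrac_eqI[symmetric, OF P _ _ _ _ _ _ _ _ *, of "d + e" "d' + e'"])
        (use a b a' b' u v carr P in \<open>auto simp: G_mult G_add point_mult H_mult\<close>)
  qed
  then show ?thesis
    unfolding Proj_stalk_def ring.simps monoid.simps
    by (rule Union_pairs_const[OF hfrac_self[OF P a] hfrac_self[OF P b]])
qed

end

section \<open>Sections and geometric points of Proj\<close>

context graded_cring begin

abbreviation "D f \<equiv> basic_open R G f"

text \<open>The fraction a/s read as a section over \<open>U\<close>; this is sensible when
  \<open>s\<close> vanishes nowhere on \<open>U\<close>.\<close>

definition fsec :: "'a set set \<Rightarrow> 'a \<Rightarrow> 'a \<Rightarrow> 'a set \<Rightarrow> ('a \<times> 'a) set" where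
  "fsec U a s = (\<lambda>P\<in>U. hfrac R G P a s)"

lemma D_open: "f \<in> H \<Longrightarrow> openin (Proj_topology R G) (D f)"
  by (simp add: Proj_topology_def openin_topology_generated_by_iff generate_topology_on.Basis)

lemma D_mult: "\<lbrakk>f \<in> carrier R; g \<in> carrier R\<rbrakk> \<Longrightarrow> D (f \<otimes> g) = D f \<inter> D g"
  by (auto simp: basic_open_def point_mult)

text \<open>The sets \<open>D f\<close> generate the topology as a subbase, but
  \<open>D_mult\<close> makes them closed under intersection, hence a base. A local representation
  of a section can thus be confined to one \<open>D f\<close>.\<close>

lemma open_nhd:
  assumes "openin (Proj_topology R G) V" "P \<in> V"
  shows "\<exists>f\<in>H. P \<in> D f \<and> D f \<subseteq> V"
proof -
  have "generate_topology_on (D ` H) V"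
    using assms by (simp add: Proj_topology_def openin_topology_generated_by_iff)
  then show ?thesis using assms(2)
  proof (induction arbitrary: P)
    case (Int U V)
    then obtain f g where "f \<in> H" "P \<in> D f" "D f \<subseteq> U" "g \<in> H" "P \<in> D g" "D g \<subseteq> V"
      by (metis IntD1 IntD2)
    then show ?case
      by (intro bexI[of _ "f \<otimes> g"]) (auto simp: D_mult H_carrier H_mult)
  next
    case (UN K)
    then show ?case by (meson Union_iff Union_upper subset_trans)
  qed auto
qed

lemma open_points: "openin (Proj_topology R G) V \<Longrightarrow> V \<subseteq> Proj_points R G"
  using open_nhd by (fastforce simp: basic_open_def)

lemma Proj_simps [simp]:
  "space_top (Proj R G) = Proj_topology R G" "sections (Proj R G) = Proj_sections R G"
  "restr (Proj R G) U V g = restrict g V"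
  by (simp_all add: Proj_def)

context
  fixes U assumes U: "openin (Proj_topology R G) U"
begin

lemma U_point: "P \<in> U \<Longrightarrow> P \<in> Proj_points R G"
  using open_points[OF U] by blast

lemma fsec_carrier:
  assumes a: "a \<in> G d" "s \<in> G d" and s: "\<forall>P\<in>U. s \<notin> P"
  shows "fsec U a s \<in> carrier (Proj_sections R G U)"
proof -
  have "fsec U a s \<in> (\<Pi>\<^sub>E P\<in>U. carrier (Proj_stalk R G P))"
    using a s by (auto simp: fsec_def Proj_stalk_def)
  moreover have "\<forall>P\<in>U. \<exists>V. openin (Proj_topology R G) V \<and> P \<in> V \<and> V \<subseteq> U \<and>
      (\<exists>d. \<exists>a'\<in>G d. \<exists>s'\<in>G d. \<forall>Q\<in>V. s' \<notin> Q \<and> fsec U a s Q = hfrac R G Q a' s')"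
    using a s U by (intro ballI exI[of _ U]) (auto simp: fsec_def)
  ultimately show ?thesis by (simp add: Proj_sections_def)
qed

lemma fsec_cong:
  assumes "a \<in> G d" "s \<in> G d" "\<forall>P\<in>U. s \<notin> P" "b \<in> G e" "t \<in> G e" "\<forall>P\<in>U. t \<notin> P"
    and "a \<otimes> t = b \<otimes> s"
  shows "fsec U a s = fsec U b t"
  unfolding fsec_def using assms by (intro restrict_ext hfrac_cross[of _ _ d _ _ e]) (auto simp:
      U_point)

lemma fsec_mult:
  assumes "a \<in> G d" "s \<in> G d" "\<forall>P\<in>U. s \<notin> P" "b \<in> G e" "t \<in> G e" "\<forall>P\<in>U. t \<notin> P"
  shows "fsec U a s \<otimes>\<^bsub>Proj_sections R G U\<^esub> fsec U b t = fsec U (a \<otimes> b) (s \<otimes> t)"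
  using assms by (auto simp: Proj_sections_def fsec_def hfrac_mult U_point cong: restrict_cong)

lemma fsec_add:
  assumes a: "a \<in> G d" "s \<in> G d" "\<forall>P\<in>U. s \<notin> P" "b \<in> G d"
  shows "fsec U a s \<oplus>\<^bsub>Proj_sections R G U\<^esub> fsec U b s = fsec U (a \<oplus> b) s"
proof -
  have "fsec U a s \<oplus>\<^bsub>Proj_sections R G U\<^esub> fsec U b s = fsec U (a \<otimes> s \<oplus> b \<otimes> s) (s \<otimes> s)"
    using assms by (auto simp: Proj_sections_def fsec_def hfrac_add U_point cong: restrict_cong)
  also have "\<dots> = fsec U (a \<oplus> b) s"
  proof (rule fsec_cong[of _ "d + d" _ _ d])
    show "(a \<otimes> s \<oplus> b \<otimes> s) \<otimes> s = (a \<oplus> b) \<otimes> (s \<otimes> s)"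
      using assms by (simp add: G_carrier l_distr m_assoc)
    show "\<forall>P\<in>U. s \<otimes> s \<notin> P" using assms by (auto simp: point_mult U_point G_carrier)
  qed (use assms in \<open>auto simp: G_add G_mult\<close>)
  finally show ?thesis .
qed

lemma fsec_pow:
  fixes n :: nat
  assumes "a \<in> G d" "s \<in> G d" "\<forall>P\<in>U. s \<notin> P"
  shows "fsec U a s [^]\<^bsub>Proj_sections R G U\<^esub> n = fsec U (a [^] n) (s [^] n)"
proof (induction n)
  case 0
  show ?case by (simp add: nat_pow_def Proj_sections_def fsec_def Proj_stalk_def cong: restrict_cong)
next
  case (Suc n)
  have "fsec U a s [^]\<^bsub>Proj_sections R G U\<^esub> Suc n
     = fsec U (a [^] n) (s [^] n) \<otimes>\<^bsub>Proj_sections R G U\<^esub> fsec U a s"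
    using Suc by (simp add: nat_pow_def)
  also have "\<dots> = fsec U (a [^] Suc n) (s [^] Suc n)"
    using assms by (subst fsec_mult[of _ "n * d" _ _ d]) 
      (auto simp: G_pow point_pow U_point G_carrier)
  finally show ?case .
qed

end

text \<open>A \<open>k\<close>-valued point of the affine cone over \<open>X\<close>, as a homomorphism \<open>ev\<close> from \<open>R\<close>.\<close>

definition eval_point :: "'a set \<Rightarrow> ('a \<Rightarrow> 'k::field) \<Rightarrow> bool" where
  "eval_point P ev \<longleftrightarrow> P \<in> Proj_points R G \<and> ev \<one> = 1 \<and>
     (\<forall>a\<in>carrier R. \<forall>b\<in>carrier R. ev (a \<otimes> b) = ev a * ev b \<and> ev (a \<oplus> b) = ev a + ev b) \<and>
     (\<forall>u\<in>H. u \<in> P \<longleftrightarrow> ev u = 0)"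

text \<open>The value of a germ in the residue field of the k-point, read off an arbitrary
  representative; \<open>val_hfrac\<close> shows that the choice is harmless.\<close>

definition val :: "('a \<Rightarrow> 'k::field) \<Rightarrow> ('a \<times> 'a) set \<Rightarrow> 'k" where
  "val ev A = (case SOME z. z \<in> A of (b, t) \<Rightarrow> ev b / ev t)"

context
  fixes P and ev :: "'a \<Rightarrow> 'k::field" assumes ev: "eval_point P ev"
begin

lemma ev_point: "P \<in> Proj_points R G"
  using ev by (simp add: eval_point_def)

lemma ev_mult: "\<lbrakk>a \<in> carrier R; b \<in> carrier R\<rbrakk> \<Longrightarrow> ev (a \<otimes> b) = ev a * ev b"
  using ev by (simp add: eval_point_def)

lemma ev_add: "\<lbrakk>a \<in> carrier R; b \<in> carrier R\<rbrakk> \<Longrightarrow> ev (a \<oplus> b) = ev a + ev b"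
  using ev by (simp add: eval_point_def)

lemma ev_zero: "ev \<zero> = 0"
  by (metis add_cancel_left_right ev_add l_zero zero_closed)

lemma ev_minus: "\<lbrakk>a \<in> carrier R; b \<in> carrier R\<rbrakk> \<Longrightarrow> ev (a \<ominus> b) = ev a - ev b"
  using ev_add[of "a \<ominus> b" b] by (simp add: a_minus_def a_assoc l_neg)

lemma ev_eq_0_iff: "u \<in> H \<Longrightarrow> ev u = 0 \<longleftrightarrow> u \<in> P"
  using ev by (simp add: eval_point_def)

lemma val_hfrac:
  assumes a: "a \<in> G d" "s \<in> G d" "s \<notin> P"
  shows "val ev (hfrac R G P a s) = ev a / ev s"
proof -
  define z where "z = (SOME z. z \<in> hfrac R G P a s)"
  obtain b t where bt: "z = (b, t)" by fastforce
  have "(b, t) \<in> hfrac R G P a s"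
    using someI[of "\<lambda>z. z \<in> hfrac R G P a s"] hfrac_self[OF ev_point a] z_def bt by metis
  then obtain e u where b: "b \<in> G e" "t \<in> G e" "t \<notin> P" and u: "u \<in> H" "u \<notin> P"
      "u \<otimes> (a \<otimes> t \<ominus> b \<otimes> s) = \<zero>"
    by (auto simp: hfrac_def)
  \<comment> \<open>Equality of fractions holds only up to the annihilator \<open>u\<close>. Since
    \<open>u\<close> lies outside \<open>P\<close>, its value is nonzero and cancels in the
    field.\<close>
  have "ev u * (ev a * ev t - ev b * ev s) = 0"
    using arg_cong[OF u(3), of ev] a b u(1) G_carrier H_carrier
    by (simp add: ev_mult ev_minus ev_zero)
  moreover have "ev u \<noteq> 0" "ev s \<noteq> 0" "ev t \<noteq> 0"
    using u a b by (auto simp: ev_eq_0_iff H_intro)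
  ultimately show ?thesis
    unfolding val_def z_def[symmetric] bt by (simp add: field_simps)
qed

lemma stalk_elem:
  assumes "A \<in> carrier (Proj_stalk R G P)"
  obtains a s d where "A = hfrac R G P a s" "a \<in> G d" "s \<in> G d" "s \<notin> P"
  using assms by (auto simp: Proj_stalk_def)

text \<open>Together with \<open>val_add\<close>, this makes \<open>val ev\<close> the evaluation
  homomorphism from the local ring to k, which turns the module identities for \<phi> into
  identities between scalars.\<close>

lemma val_mult:
  assumes "A \<in> carrier (Proj_stalk R G P)" "B \<in> carrier (Proj_stalk R G P)"
  shows "val ev (A \<otimes>\<^bsub>Proj_stalk R G P\<^esub> B) = val ev A * val ev B"
proof -
  obtain a s d where 1: "A = hfrac R G P a s" "a \<in> G d" "s \<in> G d" "s \<notin> P"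
    using stalk_elem[OF assms(1)] .
  obtain b t e where 2: "B = hfrac R G P b t" "b \<in> G e" "t \<in> G e" "t \<notin> P"
    using stalk_elem[OF assms(2)] .
  have "val ev (A \<otimes>\<^bsub>Proj_stalk R G P\<^esub> B) = ev (a \<otimes> b) / ev (s \<otimes> t)"
    unfolding 1(1) 2(1) hfrac_mult[OF ev_point 1(2-) 2(2-)]
    by (rule val_hfrac[of _ "d + e"]) (use 1 2 in \<open>auto simp: G_mult point_mult ev_point G_carrier\<close>)
  then show ?thesis
    using 1 2 by (simp add: val_hfrac[of _ d] val_hfrac[of _ e] ev_mult G_carrier)
qed

lemma val_add:
  assumes "A \<in> carrier (Proj_stalk R G P)" "B \<in> carrier (Proj_stalk R G P)"
  shows "val ev (A \<oplus>\<^bsub>Proj_stalk R G P\<^esub> B) = val ev A + val ev B"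
proof -
  obtain a s d where 1: "A = hfrac R G P a s" "a \<in> G d" "s \<in> G d" "s \<notin> P"
    using stalk_elem[OF assms(1)] .
  obtain b t e where 2: "B = hfrac R G P b t" "b \<in> G e" "t \<in> G e" "t \<notin> P"
    using stalk_elem[OF assms(2)] .
  have "b \<otimes> s \<in> G (d + e)" using 1 2 G_mult by (metis add.commute)
  then have "val ev (A \<oplus>\<^bsub>Proj_stalk R G P\<^esub> B) = ev (a \<otimes> t \<oplus> b \<otimes> s) / ev (s \<otimes> t)"
    unfolding 1(1) 2(1) hfrac_add[OF ev_point 1(2-) 2(2-)]
    by (intro val_hfrac[of _ "d + e"])
      (use 1 2 in \<open>auto simp: G_mult G_add point_mult ev_point G_carrier\<close>)
  moreover have "ev s \<noteq> 0" "ev t \<noteq> 0"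
    using 1 2 by (auto simp: ev_eq_0_iff H_intro)
  ultimately show ?thesis
    using 1 2 by (simp add: val_hfrac[of _ d] val_hfrac[of _ e] ev_mult ev_add G_carrier field_simps)
qed

end
end

section \<open>The action of a splitting on forms of degree p\<close>

section \<open>Extending a splitting to line bundles\<close>

locale split_Proj = graded_cring R G for R :: "'a ring" (structure) and G +
  fixes p :: nat and \<phi>
  assumes hom: "sheaf_module_hom (Proj R G) (\<lambda>U. frobenius_module p (sections (Proj R G) U))
              (\<lambda>U. self_module (sections (Proj R G) U)) \<phi>"
    and splits: "\<lbrakk>openin (space_top (Proj R G)) U; s \<in> carrier (sections (Proj R G) U)\<rbrakk> \<Longrightarrow>
       \<phi> U (s [^]\<^bsub>sections (Proj R G) U\<^esub> p) = s"
begin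

context
  fixes U assumes U: "openin (Proj_topology R G) U"
begin

lemma phi_module_hom: "\<phi> U \<in> module_hom (Proj_sections R G U)
    (frobenius_module p (Proj_sections R G U)) (self_module (Proj_sections R G U))"
  using hom U by (simp add: sheaf_module_hom_def)

lemma phi_closed: "x \<in> carrier (Proj_sections R G U) \<Longrightarrow> \<phi> U x \<in> carrier (Proj_sections R G U)"
  using phi_module_hom by (auto simp: module_hom_def frobenius_module_def self_module_def)

lemma phi_add: "\<lbrakk>x \<in> carrier (Proj_sections R G U); y \<in> carrier (Proj_sections R G U)\<rbrakk> \<Longrightarrow>
    \<phi> U (x \<oplus>\<^bsub>Proj_sections R G U\<^esub> y) = \<phi> U x \<oplus>\<^bsub>Proj_sections R G U\<^esub> \<phi> U y"
  using phi_module_hom by (auto simp: module_hom_def frobenius_module_def self_module_def)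

lemma phi_smult: "\<lbrakk>x \<in> carrier (Proj_sections R G U); y \<in> carrier (Proj_sections R G U)\<rbrakk> \<Longrightarrow>
    \<phi> U ((x [^]\<^bsub>Proj_sections R G U\<^esub> p) \<otimes>\<^bsub>Proj_sections R G U\<^esub> y)
      = x \<otimes>\<^bsub>Proj_sections R G U\<^esub> \<phi> U y"
  using phi_module_hom by (auto simp: module_hom_def frobenius_module_def self_module_def)

lemma phi_restr: "\<lbrakk>openin (Proj_topology R G) V; V \<subseteq> U; x \<in> carrier (Proj_sections R G U)\<rbrakk> \<Longrightarrow>
    \<phi> V (restrict x V) = restrict (\<phi> U x) V"
  using hom U by (auto simp: sheaf_module_hom_def frobenius_module_def)

lemma phi_stalk:
  "\<lbrakk>x \<in> carrier (Proj_sections R G U); P \<in> U\<rbrakk> \<Longrightarrow> \<phi> U x P \<in> carrier (Proj_stalk R G P)"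
  using phi_closed by (auto simp: Proj_sections_def)

end

definition split_val :: "'a set \<Rightarrow> ('a \<Rightarrow> 'k::field) \<Rightarrow> 'a set set \<Rightarrow> 'a \<Rightarrow> 'a \<Rightarrow> 'k" where
  "split_val P ev U a s = val ev (\<phi> U (fsec U a s) P)"

context
  fixes P and ev :: "'a \<Rightarrow> 'k::field" and U
  assumes ev: "eval_point P ev" and U: "openin (Proj_topology R G) U" and PU: "P \<in> U"
begin

lemma split_val_restr:
  assumes "openin (Proj_topology R G) V" "V \<subseteq> U" "P \<in> V" "a \<in> G d" "s \<in> G d" "\<forall>Q\<in>U. s \<notin> Q"
  shows "split_val P ev V a s = split_val P ev U a s"
proof -
  have "fsec V a s = restrict (fsec U a s) V"
    using assms(2) by (auto simp: fsec_def Int_absorb1)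
  then show ?thesis
    using phi_restr[OF U assms(1,2) fsec_carrier[OF U assms(4-6)]] assms(3) by (simp add:
        split_val_def)
qed

lemma split_val_cong:
  assumes "a \<in> G d" "s \<in> G d" "\<forall>Q\<in>U. s \<notin> Q" "b \<in> G e" "t \<in> G e" "\<forall>Q\<in>U. t \<notin> Q"
    and "a \<otimes> t = b \<otimes> s"
  shows "split_val P ev U a s = split_val P ev U b t"
  using fsec_cong[OF U assms] by (simp add: split_val_def)

lemma split_val_add:
  assumes "a \<in> G d" "s \<in> G d" "\<forall>Q\<in>U. s \<notin> Q" "b \<in> G d"
  shows "split_val P ev U (a \<oplus> b) s = split_val P ev U a s + split_val P ev U b s"
proof -
  note fc = fsec_carrier[OF U assms(1,2,3)] fsec_carrier[OF U assms(4,2,3)]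
  have "\<phi> U (fsec U (a \<oplus> b) s) P = \<phi> U (fsec U a s) P \<oplus>\<^bsub>Proj_stalk R G P\<^esub> \<phi> U (fsec U b s) P"
    unfolding fsec_add[OF U assms, symmetric] phi_add[OF U fc] using PU by (simp add:
        Proj_sections_def)
  then show ?thesis
    by (simp add: split_val_def val_add[OF ev] phi_stalk[OF U _ PU] fc)
qed

text \<open>Linearity over the Frobenius after evaluation: the p-th power of c/t leaves \<phi> as
  c/t itself.\<close>

lemma split_val_smult:
  assumes c: "c \<in> G d" "t \<in> G d" "\<forall>Q\<in>U. t \<notin> Q" and a: "a \<in> G e" "s \<in> G e" "\<forall>Q\<in>U. s \<notin> Q"
  shows "split_val P ev U (c [^] p \<otimes> a) (t [^] p \<otimes> s) = ev c / ev t * split_val P ev U a s"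
proof -
  note fc = fsec_carrier[OF U c] fsec_carrier[OF U a]
  have tp: "\<forall>Q\<in>U. t [^] p \<notin> Q"
    using c by (auto simp: point_pow U_point[OF U] G_carrier)
  have "\<phi> U (fsec U (c [^] p \<otimes> a) (t [^] p \<otimes> s)) P
      = hfrac R G P c t \<otimes>\<^bsub>Proj_stalk R G P\<^esub> \<phi> U (fsec U a s) P"
    unfolding fsec_mult[OF U G_pow[OF c(1)] G_pow[OF c(2)] tp a, symmetric]
      fsec_pow[OF U c, symmetric] phi_smult[OF U fc] 
    using PU by (simp add: Proj_sections_def fsec_def)
  moreover have "hfrac R G P c t \<in> carrier (Proj_stalk R G P)"
    using c PU by (auto simp: Proj_stalk_def)
  ultimately show ?thesis
    using val_hfrac[OF ev c(1,2)] c(3) PU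
    by (simp add: split_val_def val_mult[OF ev] phi_stalk[OF U _ PU] fc)
qed

lemma split_val_pow:
  assumes c: "c \<in> G d" "t \<in> G d" "\<forall>Q\<in>U. t \<notin> Q"
  shows "split_val P ev U (c [^] p) (t [^] p) = ev c / ev t"
proof -
  have "\<phi> U (fsec U (c [^] p) (t [^] p)) = fsec U c t"
    using splits[of U "fsec U c t"] U fsec_carrier[OF U c] by (simp add: fsec_pow[OF U c])
  then show ?thesis
    using val_hfrac[OF ev c(1,2)] c(3) PU by (simp add: split_val_def fsec_def)
qed

end

text \<open>The splitting extends to sections of line bundles: \<open>ftrace v m\<close> is the value of the section
  \<open>v \<cdot> \<phi>(m / v\<^sup>p)\<close> of \<open>\<O>(1)\<close>, which does not depend on the linear form \<open>v\<close>.\<close>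

definition ftrace :: "'a \<Rightarrow> 'a \<Rightarrow> 'a set \<Rightarrow> ('a \<Rightarrow> 'k::field) \<Rightarrow> 'k" where
  "ftrace v m P ev = ev v * split_val P ev (D v) m (v [^] p)"

lemma D_pow: "\<lbrakk>v \<in> G d; Q \<in> D v\<rbrakk> \<Longrightarrow> v [^] n \<notin> Q" for n :: nat
  by (auto simp: basic_open_def point_pow G_carrier)

context
  fixes P and ev :: "'a \<Rightarrow> 'k::field" assumes ev: "eval_point P ev"
begin

lemma mem_D: "v \<in> G d \<Longrightarrow> P \<in> D v \<longleftrightarrow> ev v \<noteq> 0"
  using ev_eq_0_iff[OF ev H_intro] ev_point[OF ev] by (auto simp: basic_open_def)

text \<open>On the overlap of the two charts m / v^p = (w/v)^p m / w^p, so \<phi> releases the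
  factor w/v. This is exactly the transition function of O(1).\<close>

lemma ftrace_indep:
  assumes v: "v \<in> G 1" "ev v \<noteq> 0" and w: "w \<in> G 1" "ev w \<noteq> 0" and m: "m \<in> G p"
  shows "ftrace v m P ev = ftrace w m P ev"
proof -
  define U where "U = D v \<inter> D w"
  have U: "openin (Proj_topology R G) U" and PU: "P \<in> U"
    using v w by (auto simp: U_def D_open H_intro mem_D)
  have vp: "v [^] p \<in> G p" "\<forall>Q\<in>U. v [^] p \<notin> Q" and wp: "w [^] p \<in> G p" "\<forall>Q\<in>U. w [^] p \<notin> Q"
    using G_pow[OF v(1), of p] G_pow[OF w(1), of p] v w by (auto simp: U_def D_pow)
  have "split_val P ev U m (v [^] p) = split_val P ev U (w [^] p \<otimes> m) (v [^] p \<otimes> w [^] p)"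
  proof (rule split_val_cong[OF ev U PU, of _ p _ _ "p + p"])
    show "m \<otimes> (v [^] p \<otimes> w [^] p) = w [^] p \<otimes> m \<otimes> v [^] p"
      using vp wp m G_carrier by (simp add: m_ac)
    show "\<forall>Q\<in>U. v [^] p \<otimes> w [^] p \<notin> Q"
      using vp wp by (auto simp: point_mult U_point[OF U] G_carrier)
  qed (use m vp wp in \<open>auto simp: G_mult\<close>)
  also have "\<dots> = ev w / ev v * split_val P ev U m (w [^] p)"
    using v w wp m by (intro split_val_smult[OF ev U PU, of _ 1 _ _ p]) (auto simp: U_def
        basic_open_def)
  finally have "ev v * split_val P ev U m (v [^] p) = ev w * split_val P ev U m (w [^] p)"
    using v(2) by simp
  moreover have "split_val P ev U m (v [^] p) = split_val P ev (D v) m (v [^] p)"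
    using G_pow[OF v(1), of p] m v U PU mem_D
    by (intro split_val_restr[OF ev, where d = p]) (auto simp: D_open H_intro D_pow U_def)
  moreover have "split_val P ev U m (w [^] p) = split_val P ev (D w) m (w [^] p)"
    using G_pow[OF w(1), of p] m w U PU mem_D
    by (intro split_val_restr[OF ev, where d = p]) (auto simp: D_open H_intro D_pow U_def)
  ultimately show ?thesis by (simp add: ftrace_def)
qed

lemma ftrace_pow:
  assumes "v \<in> G 1" "ev v \<noteq> 0" "w \<in> G 1"
  shows "ftrace v (w [^] p) P ev = ev w"
  using assms split_val_pow[OF ev D_open[OF H_intro[OF assms(1)]], of w 1 v]
  by (simp add: ftrace_def mem_D) (simp add: basic_open_def)

text \<open>The terms u^p m of a relation have degree 2p, and \<phi> induces a map from forms of
  that degree to sections of O(2). \<open>T\<close> is its value at \<open>P\<close>, computed in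
  the chart \<open>D v\<close> as v^2 \<phi>(a / v^(2p)). It connects additivity, which is available
  in degree 2p, with the traces of the factors \<open>m\<close>.\<close>

lemma ftrace_linear:
  assumes v: "v \<in> G 1" "ev v \<noteq> 0"
  obtains T where "\<And>a b. \<lbrakk>a \<in> G (p + p); b \<in> G (p + p)\<rbrakk> \<Longrightarrow> T (a \<oplus> b) = T a + T b"
    and "\<And>u m. \<lbrakk>u \<in> G 1; m \<in> G p\<rbrakk> \<Longrightarrow> T (u [^] p \<otimes> m) = ev u * ftrace v m P ev"
proof
  define T where "T a = ev v ^ 2 * split_val P ev (D v) a (v [^] p \<otimes> v [^] p)" for a
  note U = D_open[OF H_intro[OF v(1)]]
  have PU: "P \<in> D v" using v by (simp add: mem_D)
  have vp: "v [^] p \<in> G p" "\<forall>Q\<in>D v. v [^] p \<notin> Q"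
    using G_pow[OF v(1), of p] v by (auto simp: D_pow)
  then have vpp: "v [^] p \<otimes> v [^] p \<in> G (p + p)" "\<forall>Q\<in>D v. v [^] p \<otimes> v [^] p \<notin> Q"
    by (auto simp: G_mult point_mult U_point[OF U] G_carrier)
  show "T (a \<oplus> b) = T a + T b" if "a \<in> G (p + p)" "b \<in> G (p + p)" for a b
    using split_val_add[OF ev U PU that(1) vpp that(2)] by (simp add: T_def distrib_left)
  show "T (u [^] p \<otimes> m) = ev u * ftrace v m P ev" if "u \<in> G 1" "m \<in> G p" for u m
    using split_val_smult[OF ev U PU that(1) v(1) _ that(2) vp] v(2)
    by (simp add: T_def ftrace_def basic_open_def power2_eq_square)
qed

lemma ftrace_regular:
  assumes v: "v \<in> G 1" "ev v \<noteq> 0" and m: "m \<in> G p"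
  obtains A B d where "A \<in> G (Suc d)" "B \<in> G d" "ev B \<noteq> 0"
    "\<And>Q ev'. \<lbrakk>eval_point Q (ev' :: 'a \<Rightarrow> 'k); ev' B \<noteq> 0\<rbrakk> \<Longrightarrow>
        ev' v \<noteq> 0 \<and> ftrace v m Q ev' = ev' A / ev' B"
proof -
  note U = D_open[OF H_intro[OF v(1)]]
  have PU: "P \<in> D v" using v by (simp add: mem_D)
  have vp: "v [^] p \<in> G p" "\<forall>Q\<in>D v. v [^] p \<notin> Q"
    using G_pow[OF v(1), of p] v by (auto simp: D_pow)
  have "\<phi> (D v) (fsec (D v) m (v [^] p)) \<in> carrier (Proj_sections R G (D v))"
    by (rule phi_closed[OF U fsec_carrier[OF U m vp]])
  then obtain V d a s where V: "openin (Proj_topology R G) V" "P \<in> V" "V \<subseteq> D v"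
    and a: "a \<in> G d" "s \<in> G d" and rep: "\<forall>Q\<in>V. s \<notin> Q \<and>
         \<phi> (D v) (fsec (D v) m (v [^] p)) Q = hfrac R G Q a s"
    unfolding Proj_sections_def using PU by (simp, blast)
  from open_nhd[OF V(1,2)] obtain f e where f: "f \<in> G e" "P \<in> D f" "D f \<subseteq> V"
    by (auto simp: homogeneous_elems_def)
  note carr = v(1)[THEN G_carrier] f(1)[THEN G_carrier] a[THEN G_carrier]
  show ?thesis
  \<comment> \<open>The local fraction a/s represents \<phi>(m / v^p) only on \<open>D f\<close>.
    Putting \<open>f\<close> into both forms makes nonvanishing of the denominator force a point
    into \<open>D f\<close>; the factor \<open>v\<close> in the numerator accounts for the degree
    one of O(1).\<close>
  proof (rule that[of "v \<otimes> a \<otimes> f" "d + e" "s \<otimes> f"])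
    show "v \<otimes> a \<otimes> f \<in> G (Suc (d + e))"
      using G_mult[OF G_mult[OF v(1) a(1)] f(1)] by simp
    show "s \<otimes> f \<in> G (d + e)" using a f by (simp add: G_mult)
    have "ev s \<noteq> 0" using rep V(2) a(2) ev_eq_0_iff[OF ev H_intro] by blast
    then show "ev (s \<otimes> f) \<noteq> 0"
      using f mem_D[OF f(1)] by (simp add: ev_mult[OF ev] carr)
    fix Q and ev' :: "'a \<Rightarrow> 'k" assume ev': "eval_point Q ev'" and ne: "ev' (s \<otimes> f) \<noteq> 0"
    then have "ev' f \<noteq> 0" "ev' s \<noteq> 0" by (auto simp: ev_mult[OF ev'] carr)
    then have "Q \<in> D f"
      using ev_eq_0_iff[OF ev' H_intro] ev_point[OF ev'] f(1) by (auto simp: basic_open_def)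
    then have "Q \<in> V" "Q \<in> D v" using f V by auto
    then show "ev' v \<noteq> 0 \<and> ftrace v m Q ev' = ev' (v \<otimes> a \<otimes> f) / ev' (s \<otimes> f)"
      using ev_eq_0_iff[OF ev' H_intro[OF v(1)]] rep \<open>ev' f \<noteq> 0\<close> val_hfrac[OF ev' a]
      by (simp add: ftrace_def split_val_def ev_mult[OF ev'] carr basic_open_def)
  qed
qed

end
end

section \<open>Homogeneous polynomial equations and their k-points\<close>

section \<open>Evaluation of polynomials\<close>

definition mono_eval :: "('v \<Rightarrow> 'r) \<Rightarrow> ('v \<Rightarrow>\<^sub>0 nat) \<Rightarrow> 'r::comm_ring_1" where
  "mono_eval x m = (\<Prod>v\<in>Poly_Mapping.keys m. x v ^ Poly_Mapping.lookup m v)"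

definition mdeg :: "('v \<Rightarrow>\<^sub>0 nat) \<Rightarrow> nat" where
  "mdeg m = (\<Sum>v\<in>Poly_Mapping.keys m. Poly_Mapping.lookup m v)"

text \<open>The coefficient map \<open>h\<close> lets one development serve both evaluation at a
  vector over k (identity) and restriction to a parametrised curve (constants in k[t]).\<close>

definition peval :: "('k \<Rightarrow> 'r) \<Rightarrow> ('v \<Rightarrow> 'r) \<Rightarrow> ('v, 'k::comm_ring_1) mpoly \<Rightarrow> 'r::comm_ring_1" where
  "peval h x f = (\<Sum>m\<in>Poly_Mapping.keys f. h (Poly_Mapping.lookup f m) * mono_eval x m)"

lemma mono_eval_superset:
  assumes "finite A" "Poly_Mapping.keys m \<subseteq> A"
  shows "mono_eval x m = (\<Prod>v\<in>A. x v ^ Poly_Mapping.lookup m v)"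
  unfolding mono_eval_def using assms
  by (intro prod.mono_neutral_left) (auto simp: in_keys_iff)

lemma mdeg_superset:
  assumes "finite A" "Poly_Mapping.keys m \<subseteq> A"
  shows "mdeg m = (\<Sum>v\<in>A. Poly_Mapping.lookup m v)"
  unfolding mdeg_def using assms
  by (intro sum.mono_neutral_left) (auto simp: in_keys_iff)

lemma mono_eval_add: "mono_eval x (m + n) = mono_eval x m * mono_eval x n"
  using keys_add[of m n]
  by (simp add: mono_eval_superset[of "Poly_Mapping.keys m \<union> Poly_Mapping.keys n"]
      lookup_add power_add prod.distrib)

lemma mdeg_add: "mdeg (m + n) = mdeg m + mdeg n"
  using keys_add[of m n]
  by (simp add: mdeg_superset[of "Poly_Mapping.keys m \<union> Poly_Mapping.keys n"]
      lookup_add sum.distrib)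

lemma mono_eval_0 [simp]: "mono_eval x 0 = 1" and mdeg_0 [simp]: "mdeg 0 = 0"
  by (simp_all add: mono_eval_def mdeg_def)

lemma mono_eval_hom:
  fixes x :: "'v \<Rightarrow> 'r::comm_ring_1" and g :: "'r \<Rightarrow> 's::comm_ring_1"
  assumes "g 1 = 1" "\<And>a b. g (a * b) = g a * g b"
  shows "g (mono_eval x m) = mono_eval (\<lambda>v. g (x v)) m"
proof -
  have "g (a ^ n) = g a ^ n" for a n by (induction n) (simp_all add: assms)
  moreover have "g (prod y A) = (\<Prod>v\<in>A. g (y v))" if "finite A" for y and A :: "'v set"
    using that by induction (simp_all add: assms)
  ultimately show ?thesis by (simp add: mono_eval_def)
qed

lemma homogeneous_polys_iff:
  "f \<in> homogeneous_polys d \<longleftrightarrow> (\<forall>m\<in>Poly_Mapping.keys f. mdeg m = d)"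
  by (simp add: homogeneous_polys_def mdeg_def)

lemma hp_zero: "0 \<in> homogeneous_polys d"
  by (simp add: homogeneous_polys_iff)

lemma hp_add: "\<lbrakk>f \<in> homogeneous_polys d; g \<in> homogeneous_polys d\<rbrakk> \<Longrightarrow> f + g \<in> homogeneous_polys d"
  using keys_add[of f g] by (auto simp: homogeneous_polys_iff)

lemma hp_minus: "f \<in> homogeneous_polys d \<Longrightarrow> - f \<in> homogeneous_polys d"
  by (auto simp: homogeneous_polys_iff)

lemma hp_diff: "\<lbrakk>f \<in> homogeneous_polys d; g \<in> homogeneous_polys d\<rbrakk> \<Longrightarrow> f - g \<in> homogeneous_polys d"
  using hp_add[of f d "- g"] hp_minus[of g d] by simp

lemma hp_sum: "(\<And>j. j \<in> J \<Longrightarrow> f j \<in> homogeneous_polys d) \<Longrightarrow> sum f J \<in> homogeneous_polys d"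
  by (induction J rule: infinite_finite_induct) (auto simp: hp_zero hp_add)

lemma hp_mult: "\<lbrakk>f \<in> homogeneous_polys d; g \<in> homogeneous_polys e\<rbrakk> \<Longrightarrow>
    f * g \<in> homogeneous_polys (d + e)"
  using keys_mult[of f g] by (fastforce simp: homogeneous_polys_iff mdeg_add)

lemma hp_one: "1 \<in> homogeneous_polys 0"
  by (simp add: homogeneous_polys_iff)

lemma hp_power: "f \<in> homogeneous_polys d \<Longrightarrow> f ^ n \<in> homogeneous_polys (n * d)"
  by (induction n) (auto simp: hp_one hp_mult)

lemma hp_Var: "Var v \<in> homogeneous_polys 1"
  by (simp add: homogeneous_polys_iff Var_def mdeg_def)

lemma hp_single: "Poly_Mapping.single m c \<in> homogeneous_polys (mdeg m)"
  by (simp add: homogeneous_polys_iff)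

lemma mpoly_sum_monomials:
  "f = (\<Sum>m\<in>Poly_Mapping.keys f. Poly_Mapping.single m (Poly_Mapping.lookup f m))"
  by (rule poly_mapping_eqI)
    (simp add: lookup_sum lookup_single when_def in_keys_iff)

context
  fixes h :: "'k::comm_ring_1 \<Rightarrow> 'r::comm_ring_1"
  assumes h: "h 0 = 0" "h 1 = 1" "\<And>a b. h (a + b) = h a + h b" "\<And>a b. h (a * b) = h a * h b"
begin

lemma peval_superset:
  assumes "finite A" "Poly_Mapping.keys f \<subseteq> A"
  shows "peval h x f = (\<Sum>m\<in>A. h (Poly_Mapping.lookup f m) * mono_eval x m)"
  unfolding peval_def using assms
  by (intro sum.mono_neutral_left) (auto simp: in_keys_iff h)

lemma peval_zero: "peval h x 0 = 0"
  by (simp add: peval_def)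

lemma peval_add: "peval h x (f + g) = peval h x f + peval h x g"
  using keys_add[of f g]
  by (simp add: peval_superset[of "Poly_Mapping.keys f \<union> Poly_Mapping.keys g"]
      lookup_add h sum.distrib distrib_right)

lemma peval_sum: "peval h x (sum f J) = (\<Sum>j\<in>J. peval h x (f j))"
  by (induction J rule: infinite_finite_induct) (simp_all add: peval_zero peval_add)

lemma peval_minus: "peval h x (- f) = - peval h x f"
  using peval_add[of x f "- f"] by (simp add: peval_zero add_eq_0_iff)

lemma peval_diff: "peval h x (f - g) = peval h x f - peval h x g"
  using peval_add[of x f "- g"] by (simp add: peval_minus)

lemma peval_single: "peval h x (Poly_Mapping.single m c) = h c * mono_eval x m"
  by (simp add: peval_def h)

lemma peval_mult: "peval h x (f * g) = peval h x f * peval h x g"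
proof -
  have "f * g = (\<Sum>m\<in>Poly_Mapping.keys f. \<Sum>n\<in>Poly_Mapping.keys g.
      Poly_Mapping.single (m + n) (Poly_Mapping.lookup f m * Poly_Mapping.lookup g n))"
    by (subst mpoly_sum_monomials[of f], subst mpoly_sum_monomials[of g])
      (simp add: sum_product mult_single)
  also have "peval h x \<dots> = peval h x f * peval h x g"
    unfolding peval_sum peval_single by (simp add: peval_def sum_product h mono_eval_add mult_ac)
  finally show ?thesis .
qed

lemma peval_one: "peval h x 1 = 1"
  using peval_single[of x 0 1] by (simp add: h)

lemma peval_power: "peval h x (f ^ n) = peval h x f ^ n"
  by (induction n) (simp_all add: peval_one peval_mult)

lemma peval_Var: "peval h x (Var v) = x v"
  by (simp add: Var_def peval_single h mono_eval_def)

end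

lemma peval_hom:
  fixes x :: "'v \<Rightarrow> 'r::comm_ring_1" and g :: "'r \<Rightarrow> 's::comm_ring_1"
  assumes "g 0 = 0" "g 1 = 1" "\<And>a b. g (a + b) = g a + g b" "\<And>a b. g (a * b) = g a * g b"
  shows "g (peval h x f) = peval (\<lambda>c. g (h c)) (\<lambda>v. g (x v)) f"
proof -
  have "g (sum y A) = (\<Sum>v\<in>A. g (y v))" for y and A :: "('v \<Rightarrow>\<^sub>0 nat) set"
    by (induction A rule: infinite_finite_induct) (simp_all add: assms)
  then show ?thesis by (simp add: peval_def assms mono_eval_hom)
qed

abbreviation eval_at :: "('v \<Rightarrow> 'k::comm_ring_1) \<Rightarrow> ('v, 'k) mpoly \<Rightarrow> 'k" where
  "eval_at \<equiv> peval (\<lambda>c. c)"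

abbreviation eval_poly :: "('v \<Rightarrow> 'k poly) \<Rightarrow> ('v, 'k::comm_ring_1) mpoly \<Rightarrow> 'k poly" where
  "eval_poly \<equiv> peval (\<lambda>c. [:c:])"

lemmas eval_at_simps = peval_zero[of "\<lambda>c. c"] peval_one[of "\<lambda>c. c"] peval_add[of "\<lambda>c. c"]
  peval_minus[of "\<lambda>c. c"] peval_diff[of "\<lambda>c. c"] peval_mult[of "\<lambda>c. c"] peval_power[of "\<lambda>c. c"]
  peval_Var[of "\<lambda>c. c"] peval_sum[of "\<lambda>c. c"]

lemma poly_eval_poly: "poly (eval_poly x f) t = eval_at (\<lambda>v. poly (x v) t) f"
  using peval_hom[of "\<lambda>q. poly q t" "\<lambda>c. [:c:]"] by simp

text \<open>Along the line t x the degree of a form becomes the exponent of t. Restriction to the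
  line therefore separates the homogeneous components, which evaluation at \<open>x\<close> alone
  would mix.\<close>

lemma eval_poly_line:
  fixes x :: "'v \<Rightarrow> 'k::comm_ring_1"
  assumes "f \<in> homogeneous_polys d"
  shows "eval_poly (\<lambda>v. [:0, x v:]) f = monom (eval_at x f) d"
proof -
  have *: "mono_eval (\<lambda>v. [:0, x v:]) m = monom (mono_eval x m) (mdeg m)" for m
  proof -
    have "(\<Prod>v\<in>A. [:0, x v:] ^ e v) = monom (\<Prod>v\<in>A. x v ^ e v) (\<Sum>v\<in>A. e v)" if "finite A" 
      for A and e :: "'v \<Rightarrow> nat"
      using that
    proof induction
      case (insert v A)
      have "[:0, x v:] = monom (x v) 1" by (simp add: monom_altdef)
      with insert show ?case by (simp add: monom_power mult_monom)
    qed simp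
    then show ?thesis by (simp add: mono_eval_def mdeg_def)
  qed
  have "eval_poly (\<lambda>v. [:0, x v:]) f
     = (\<Sum>m\<in>Poly_Mapping.keys f. monom (Poly_Mapping.lookup f m * mono_eval x m) d)"
    using assms by (auto simp: peval_def * homogeneous_polys_iff smult_monom intro!: sum.cong)
  moreover have "(\<Sum>m\<in>A. monom (y m) d) = monom (sum y A) d" for y and A :: "('v \<Rightarrow>\<^sub>0 nat) set"
    by (induction A rule: infinite_finite_induct) (simp_all add: add_monom)
  ultimately show ?thesis by (simp add: peval_def)
qed

section \<open>The closed points of a projective scheme\<close>

lemma ring_of_type_algebra_simps [simp]:
  "carrier (ring_of_type_algebra :: 'a::comm_ring_1 ring) = UNIV"
  "x \<otimes>\<^bsub>(ring_of_type_algebra :: 'a ring)\<^esub> y = x * y"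
  "x \<oplus>\<^bsub>(ring_of_type_algebra :: 'a ring)\<^esub> y = x + y"
  "\<one>\<^bsub>(ring_of_type_algebra :: 'a ring)\<^esub> = 1"
  "\<zero>\<^bsub>(ring_of_type_algebra :: 'a ring)\<^esub> = 0"
  by (simp_all add: ring_of_type_algebra_def)

locale homogeneous_equations =
  fixes E :: "('v, 'k::field) mpoly set"
  assumes E_homogeneous: "E \<subseteq> (\<Union>d. homogeneous_polys d)"
begin

definition I :: "('v, 'k) mpoly set" where "I = Idl\<^bsub>mpoly_ring\<^esub> E"

definition residue_class :: "('v, 'k) mpoly \<Rightarrow> ('v, 'k) mpoly set" where
  "residue_class f = I +>\<^bsub>mpoly_ring\<^esub> f"

abbreviation "coord_ring \<equiv> mpoly_ring Quot I :: ('v, 'k) mpoly set ring"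

abbreviation "coord_grading \<equiv> \<lambda>d. residue_class ` homogeneous_polys d"

lemma mpoly_cring: "cring (mpoly_ring :: ('v, 'k) mpoly ring)"
  by (rule cring_from_type_algebra)

lemma I_ideal: "ideal I mpoly_ring"
  unfolding I_def by (rule ring.genideal_ideal[OF cring.axioms(1)[OF mpoly_cring]]) simp

lemma I_add: "\<lbrakk>f \<in> I; g \<in> I\<rbrakk> \<Longrightarrow> f + g \<in> I"
  using additive_subgroup.a_closed[OF ideal.axioms(1)[OF I_ideal]] by simp

lemma I_zero: "0 \<in> I"
  using additive_subgroup.zero_closed[OF ideal.axioms(1)[OF I_ideal]] by simp

lemma I_mult: "g \<in> I \<Longrightarrow> f * g \<in> I"
  using ideal.I_l_closed[OF I_ideal] by simp

lemma I_minus: "g \<in> I \<Longrightarrow> - g \<in> I"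
  using I_mult[of g "-1"] by simp

lemma I_self: "f \<in> E \<Longrightarrow> f \<in> I"
  unfolding I_def using ring.genideal_self[OF cring.axioms(1)[OF mpoly_cring], of E] by auto

lemma residue_class_eq_image: "residue_class f = (\<lambda>g. g + f) ` I"
  by (auto simp: residue_class_def a_r_coset_def r_coset_def)

lemma residue_class_eq_iff: "residue_class f = residue_class g \<longleftrightarrow> f - g \<in> I"
proof
  assume "residue_class f = residue_class g"
  moreover have "f \<in> residue_class f" using I_zero by (force simp: residue_class_eq_image)
  ultimately show "f - g \<in> I" by (auto simp: residue_class_eq_image)
next
  assume fg: "f - g \<in> I"
  have "h + f \<in> (\<lambda>k. k + g) ` I" if "h \<in> I" for h
    using I_add[OF that fg] by (intro image_eqI[of _ _ "h + (f - g)"]) simp_all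
  moreover have "h + g \<in> (\<lambda>k. k + f) ` I" if "h \<in> I" for h
    using I_add[OF that I_minus[OF fg]] by (intro image_eqI[of _ _ "h + - (f - g)"]) simp_all
  ultimately show "residue_class f = residue_class g"
    unfolding residue_class_eq_image by blast
qed

lemma coord_ring_cring: "cring coord_ring"
  by (rule ideal.quotient_is_cring[OF I_ideal mpoly_cring])

lemma coord_ring_carrier: "carrier coord_ring = range residue_class"
  by (auto simp: FactRing_def A_RCOSETS_def' residue_class_def)

lemma residue_class_mult: "residue_class f \<otimes>\<^bsub>coord_ring\<^esub> residue_class g = residue_class (f * g)"
  using ideal.rcoset_mult_add[OF I_ideal, of f g] by (simp add: FactRing_def residue_class_def)

lemma residue_class_add: "residue_class f \<oplus>\<^bsub>coord_ring\<^esub> residue_class g = residue_class (f + g)"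
  using ring_hom_add[OF ideal.rcos_ring_hom[OF I_ideal], of f g] by (simp add: residue_class_def)

lemma residue_class_one: "\<one>\<^bsub>coord_ring\<^esub> = residue_class 1"
  by (simp add: FactRing_def residue_class_def)

lemma residue_class_zero: "\<zero>\<^bsub>coord_ring\<^esub> = residue_class 0"
  using I_zero by (auto simp: FactRing_def residue_class_eq_image)

lemma residue_class_pow: "residue_class f [^]\<^bsub>coord_ring\<^esub> n = residue_class (f ^ n)" for n :: nat
  by (induction n) (simp_all add: nat_pow_def residue_class_one residue_class_mult mult.commute)

lemma graded: "graded_cring coord_ring coord_grading"
proof (intro graded_cring.intro graded_cring_axioms.intro coord_ring_cring)
  show "coord_grading d \<subseteq> carrier coord_ring" for d by (auto simp: coord_ring_carrier)
  show "\<one>\<^bsub>coord_ring\<^esub> \<in> coord_grading 0" by (simp add: residue_class_one hp_one)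
  show "a \<oplus>\<^bsub>coord_ring\<^esub> b \<in> coord_grading d" if "a \<in> coord_grading d" "b \<in> coord_grading d" for a b d
    using that by (auto simp: residue_class_add hp_add)
  show "a \<otimes>\<^bsub>coord_ring\<^esub> b \<in> coord_grading (d + e)" if "a \<in> coord_grading d" "b \<in> coord_grading e"
      for a b d e
    using that by (auto simp: residue_class_mult hp_mult)
qed

text \<open>The k-points of the affine cone without its vertex; the k-points of the projective
  scheme are its orbits under scaling.\<close>

definition cone :: "('v \<Rightarrow> 'k) set" where
  "cone = {x. (\<exists>v. x v \<noteq> 0) \<and> (\<forall>f\<in>E. eval_at x f = 0)}"

definition ev :: "('v \<Rightarrow> 'k) \<Rightarrow> ('v, 'k) mpoly set \<Rightarrow> 'k" where
  "ev x C = eval_at x (SOME f. C = residue_class f)"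

definition line_ev :: "('v \<Rightarrow> 'k) \<Rightarrow> ('v, 'k) mpoly set \<Rightarrow> 'k poly" where
  "line_ev x C = eval_poly (\<lambda>v. [:0, x v:]) (SOME f. C = residue_class f)"

text \<open>The homogeneous prime ideal of the point consists of the functions that vanish on the line
  spanned by \<open>x\<close>.\<close>

definition pt :: "('v \<Rightarrow> 'k) \<Rightarrow> ('v, 'k) mpoly set set" where
  "pt x = {C \<in> carrier coord_ring. line_ev x C \<in> {0}}"

context
  fixes x assumes x: "x \<in> cone"
begin

text \<open>Homogeneity extends vanishing at \<open>x\<close> to the whole line: each generator
  restricts to f(x) t^d = 0, and the kernel of the restriction is an ideal.\<close>

lemma I_line: "f \<in> I \<Longrightarrow> eval_poly (\<lambda>v. [:0, x v:]) f = 0"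
proof -
  let ?K = "{f. eval_poly (\<lambda>v. [:0, x v:]) f = 0}"
  let ?B = "ring_of_type_algebra :: 'k poly ring"
  have B: "ring ?B" by (rule ring_from_type_algebra)
  have zero: "ideal {0} ?B"
    using ring.zeroideal[OF B] by simp
  have "ring_hom_ring mpoly_ring ?B (eval_poly (\<lambda>v. [:0, x v:]))"
    by (intro ring_hom_ringI cring.axioms(1)[OF mpoly_cring] B)
      (simp_all add: peval_mult peval_add peval_one)
  from ring_hom_ring.ideal_vimage[OF this zero] have "ideal ?K mpoly_ring" by simp
  moreover have "E \<subseteq> ?K"
  proof
    fix f assume "f \<in> E"
    moreover from this obtain d where "f \<in> homogeneous_polys d" using E_homogeneous by blast
    ultimately show "f \<in> ?K" using x by (simp add: eval_poly_line cone_def)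
  qed
  ultimately have "I \<subseteq> ?K"
    unfolding I_def by (intro ring.genideal_minimal[OF cring.axioms(1)[OF mpoly_cring]])
  then show "f \<in> I \<Longrightarrow> ?thesis" by blast
qed

lemma I_eval: "f \<in> I \<Longrightarrow> eval_at x f = 0"
  using poly_eval_poly[of "\<lambda>v. [:0, x v:]" f 1] I_line[of f] by simp

lemma line_ev_residue_class: "line_ev x (residue_class f) = eval_poly (\<lambda>v. [:0, x v:]) f"
proof -
  have "residue_class f = residue_class (SOME g. residue_class f = residue_class g)" by (rule
      someI[of _ f]) simp
  then show ?thesis
    using I_line[of "f - (SOME g. residue_class f = residue_class g)"] by (simp add:
        residue_class_eq_iff line_ev_def peval_diff)
qed

lemma ev_residue_class: "ev x (residue_class f) = eval_at x f"
proof -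
  have "residue_class f = residue_class (SOME g. residue_class f = residue_class g)" by (rule
      someI[of _ f]) simp
  then show ?thesis
    using I_eval[of "f - (SOME g. residue_class f = residue_class g)"] by (simp add:
        residue_class_eq_iff ev_def peval_diff)
qed

lemma pt_residue_class_iff: "residue_class f \<in> pt x \<longleftrightarrow> eval_poly (\<lambda>v. [:0, x v:]) f = 0"
  by (auto simp: pt_def line_ev_residue_class coord_ring_carrier)

lemma pt_residue_class_homogeneous: "f \<in> homogeneous_polys d \<Longrightarrow> residue_class f \<in> pt x \<longleftrightarrow> eval_at x f
    = 0"
  by (simp add: pt_residue_class_iff eval_poly_line)

text \<open>It is the preimage of the zero ideal of the domain k[t]. The kernel of evaluation at
  \<open>x\<close> itself would also be prime, but not homogeneous.\<close>

lemma pt_prime: "primeideal (pt x) coord_ring"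
proof -
  let ?B = "ring_of_type_algebra :: 'k poly ring"
  have B: "cring ?B" by (rule cring_from_type_algebra)
  have "domain ?B"
    by (intro domain.intro B domain_axioms.intro) auto
  then have "primeideal {0} ?B"
    using domain.zeroprimeideal[of ?B] by simp
  moreover have "ring_hom_ring coord_ring ?B (line_ev x)"
    by (intro ring_hom_ringI cring.axioms(1)[OF B] cring.axioms(1)[OF coord_ring_cring])
      (auto simp: coord_ring_carrier residue_class_mult residue_class_add residue_class_one
          line_ev_residue_class peval_mult peval_add peval_one)
  ultimately show ?thesis
    unfolding pt_def by (intro ring_hom_ring.primeideal_vimage coord_ring_cring)
qed

text \<open>If f vanishes along the line, its components contribute multiples of distinct powers of
  t, so each of them vanishes there too, and f is a sum of homogeneous elements of the
  ideal.\<close>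

lemma pt_homogeneous: "homogeneous_ideal coord_ring coord_grading (pt x)"
  unfolding homogeneous_ideal_def
proof (intro conjI equalityI)
  interpret R: cring coord_ring by (rule coord_ring_cring)
  interpret P: primeideal "pt x" coord_ring by (rule pt_prime)
  show "ideal (pt x) coord_ring" by (rule P.is_ideal)
  show "Idl\<^bsub>coord_ring\<^esub> (pt x \<inter> homogeneous_elems coord_grading) \<subseteq> pt x"
    by (rule R.genideal_minimal[OF P.is_ideal Int_lower1])
  let ?J = "Idl\<^bsub>coord_ring\<^esub> (pt x \<inter> homogeneous_elems coord_grading)"
  have sub: "pt x \<inter> homogeneous_elems coord_grading \<subseteq> carrier coord_ring" using P.Icarr by blast
  interpret J: ideal ?J coord_ring by (rule R.genideal_ideal[OF sub])
  show "pt x \<subseteq> ?J"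
  proof
    fix C assume C: "C \<in> pt x"
    then have "C \<in> range residue_class" using P.Icarr by (simp only: coord_ring_carrier)
    with C obtain f where f: "C = residue_class f" "eval_poly (\<lambda>v. [:0, x v:]) f = 0"
      using pt_residue_class_iff by blast
    define comp where "comp d = (\<Sum>m\<in>{m\<in>Poly_Mapping.keys f. mdeg m = d}.
        Poly_Mapping.single m (Poly_Mapping.lookup f m))" for d
    define A where "A = mdeg ` Poly_Mapping.keys f"
    have hom: "comp d \<in> homogeneous_polys d" for d
      unfolding comp_def by (intro hp_sum) (use hp_single in blast)
    have f_eq: "f = (\<Sum>d\<in>A. comp d)"
      unfolding comp_def A_def
      by (subst mpoly_sum_monomials[of f]) (rule sum.image_gen, simp)
    have "eval_poly (\<lambda>v. [:0, x v:]) f = (\<Sum>d\<in>A. monom (eval_at x (comp d)) d)"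
      by (subst f_eq) (simp add: peval_sum eval_poly_line[OF hom])
    with f(2) have "0 = coeff (\<Sum>d\<in>A. monom (eval_at x (comp d)) d) e" for e
      by simp
    then have "0 = eval_at x (comp e)" if "e \<in> A" for e
      using that by (simp add: coeff_sum A_def) presburger
    then have comp: "residue_class (comp d) \<in> ?J" if "d \<in> A" for d
      using that hom[of d] R.genideal_self[OF sub] pt_residue_class_homogeneous[OF hom]
      by (force simp: homogeneous_elems_def)
    have "residue_class (sum comp B) \<in> ?J" if "finite B" "B \<subseteq> A" for B
      using that
    proof induction
      case empty
      then show ?case using J.zero_closed by (simp add: residue_class_zero)
    next
      case (insert d B)
      then have "residue_class (comp d) \<oplus>\<^bsub>coord_ring\<^esub> residue_class (sum comp B) \<in> ?J"
        using comp by (intro J.a_closed) auto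
      then show ?case using insert by (simp add: residue_class_add)
    qed
    then show "C \<in> ?J" unfolding f(1) by (subst f_eq) (simp add: A_def)
  qed
qed

lemma eval_point: "graded_cring.eval_point coord_ring coord_grading (pt x) (ev x)"
  unfolding graded_cring.eval_point_def[OF graded]
proof (intro conjI ballI)
  interpret R: cring coord_ring by (rule coord_ring_cring)
  obtain v where v: "x v \<noteq> 0" using x by (auto simp: cone_def)
  \<comment> \<open>A nonzero coordinate of \<open>x\<close> gives a form of positive degree outside
    \<open>pt x\<close>; this is why the vertex of the cone is excluded.\<close>
  have "residue_class (Var v) \<notin> pt x" using v pt_residue_class_homogeneous[OF hp_Var, of v] by (simp
      add: peval_Var)
  moreover have "residue_class (Var v) \<in> irrelevant_ideal coord_ring coord_grading"
    unfolding irrelevant_ideal_def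
    using R.genideal_self[of "\<Union>d\<in>{0<..}. coord_grading d"] hp_Var[of v] by (fastforce simp:
        coord_ring_carrier)
  ultimately show "pt x \<in> Proj_points coord_ring coord_grading"
    using pt_prime pt_homogeneous by (auto simp: Proj_points_def)
  show "ev x \<one>\<^bsub>coord_ring\<^esub> = 1" by (simp add: residue_class_one ev_residue_class peval_one)
  show "ev x (a \<otimes>\<^bsub>coord_ring\<^esub> b) = ev x a * ev x b" "ev x (a \<oplus>\<^bsub>coord_ring\<^esub> b) = ev x a + ev x b"
    if "a \<in> carrier coord_ring" "b \<in> carrier coord_ring" for a b
    using that by (auto simp: coord_ring_carrier residue_class_mult residue_class_add
        ev_residue_class peval_mult peval_add)
  show "u \<in> pt x \<longleftrightarrow> ev x u = 0" if "u \<in> homogeneous_elems coord_grading" for u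
    using that by (auto simp: homogeneous_elems_def pt_residue_class_homogeneous ev_residue_class)
qed

end

text \<open>Here \<open>c m x\<close> is the value at \<open>x\<close> of \<phi>(m), a section of
  O(1). The three properties translate Frobenius linearity, the splitting condition and regularity
  into statements about polynomials and vectors, so that Proj disappears from the rest of the
  argument.\<close>

theorem F_split_trace:
  assumes split: "F_split p (closed_subscheme E)"
  obtains c :: "('v, 'k) mpoly \<Rightarrow> ('v \<Rightarrow> 'k) \<Rightarrow> 'k" where
    "\<And>(J :: nat set) u m x. \<lbrakk>x \<in> cone; \<And>j. j \<in> J \<Longrightarrow> u j \<in> homogeneous_polys 1;
       \<And>j. j \<in> J \<Longrightarrow> m j \<in> homogeneous_polys p; (\<Sum>j\<in>J. u j ^ p * m j) \<in> I\<rbrakk> \<Longrightarrow>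
       (\<Sum>j\<in>J. eval_at x (u j) * c (m j) x) = 0"
    "\<And>w x. \<lbrakk>x \<in> cone; w \<in> homogeneous_polys 1\<rbrakk> \<Longrightarrow> c (w ^ p) x = eval_at x w"
    "\<And>m x. \<lbrakk>x \<in> cone; m \<in> homogeneous_polys p\<rbrakk> \<Longrightarrow>
       \<exists>A B d. A \<in> homogeneous_polys (Suc d) \<and> B \<in> homogeneous_polys d \<and> eval_at x B \<noteq> 0 \<and>
         (\<forall>y\<in>cone. eval_at y B \<noteq> 0 \<longrightarrow> c m y = eval_at y A / eval_at y B)"
proof -
  have sch: "closed_subscheme E = Proj coord_ring coord_grading"
    by (simp add: closed_subscheme_def I_def residue_class_def Let_def)
  from split obtain \<phi> where \<phi>: "split_Proj coord_ring coord_grading p \<phi>"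
    unfolding F_split_def sch split_Proj_def split_Proj_axioms_def using graded by blast
  interpret split_Proj coord_ring coord_grading p \<phi> by (rule \<phi>)
  \<comment> \<open>The chart depends on the point: some coordinate that does not vanish at
    \<open>x\<close>. The fact \<open>c_eq\<close> below allows any other such coordinate.\<close>
  define c where "c m x = ftrace (residue_class (Var (SOME v. x v \<noteq> 0))) (residue_class m) (pt x)
      (ev x)" for m x
  have cG: "residue_class f \<in> coord_grading d" if "f \<in> homogeneous_polys d" for f d using that by
      (rule imageI)
  have VarG: "residue_class (Var v) \<in> coord_grading 1" for v :: 'v by (intro imageI hp_Var)
  have c_eq: "c m x = ftrace (residue_class (Var v)) (residue_class m) (pt x) (ev x)"
    if "x \<in> cone" "x v \<noteq> 0" "m \<in> homogeneous_polys p" for m x v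
    unfolding c_def using that someI[of "\<lambda>v. x v \<noteq> 0", OF that(2)]
    by (intro ftrace_indep[OF eval_point VarG _ VarG _ cG]) (simp_all add: ev_residue_class peval_Var)
  have point: "\<exists>v. x v \<noteq> 0" if "x \<in> cone" for x using that by (auto simp: cone_def)
  show ?thesis
  proof
    fix J :: "nat set" and u m :: "nat \<Rightarrow> ('v, 'k) mpoly" and x assume x: "x \<in> cone"
      and u: "\<And>j. j \<in> J \<Longrightarrow> u j \<in> homogeneous_polys 1"
      and m: "\<And>j. j \<in> J \<Longrightarrow> m j \<in> homogeneous_polys p" and sum: "(\<Sum>j\<in>J. u j ^ p * m j) \<in> I"
    obtain v where v: "x v \<noteq> 0" using point[OF x] by blast
    have "ev x (residue_class (Var v)) \<noteq> 0" using v x by (simp add: ev_residue_class peval_Var)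
    from ftrace_linear[OF eval_point[OF x] VarG this] obtain T where
      T_add: "\<And>a b. \<lbrakk>a \<in> coord_grading (p + p); b \<in> coord_grading (p + p)\<rbrakk> \<Longrightarrow> T (a \<oplus>\<^bsub>coord_ring\<^esub> b) =
          T a + T b" and
      T_mult: "\<And>u m. \<lbrakk>u \<in> coord_grading 1; m \<in> coord_grading p\<rbrakk> \<Longrightarrow> T (u [^]\<^bsub>coord_ring\<^esub> p
          \<otimes>\<^bsub>coord_ring\<^esub> m) =
        ev x u * ftrace (residue_class (Var v)) m (pt x) (ev x)" by blast
    \<comment> \<open>Additivity alone suffices: T(0) = T(0) + T(0).\<close>
    have T0: "T (residue_class 0) = 0"
      using T_add[OF cG[OF hp_zero] cG[OF hp_zero]] unfolding residue_class_add add_0_left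
      by (metis add_cancel_right_left)
    have um: "u j ^ p * m j \<in> homogeneous_polys (p + p)" if "j \<in> J" for j
      using hp_mult[OF hp_power[OF u[OF that], of p] m[OF that]] by simp
    have "T (residue_class (\<Sum>j\<in>K. u j ^ p * m j)) = (\<Sum>j\<in>K. T (residue_class (u j ^ p * m j)))"
      if "K \<subseteq> J" for K
      using that
    proof (induction K rule: infinite_finite_induct)
      case (insert j K)
      then have "T (residue_class (u j ^ p * m j) \<oplus>\<^bsub>coord_ring\<^esub> residue_class (\<Sum>j\<in>K. u j ^ p * m j)) =
          T (residue_class (u j ^ p * m j)) + T (residue_class (\<Sum>j\<in>K. u j ^ p * m j))"
        by (intro T_add cG um hp_sum) auto
      then show ?case using insert by (simp add: residue_class_add)
    qed (simp_all add: T0)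
    then have "T (residue_class (\<Sum>j\<in>J. u j ^ p * m j)) = (\<Sum>j\<in>J. T (residue_class (u j ^ p * m j)))"
        by simp
    also have "residue_class (\<Sum>j\<in>J. u j ^ p * m j) = residue_class 0"
      using sum by (simp add: residue_class_eq_iff)
    also have "(\<Sum>j\<in>J. T (residue_class (u j ^ p * m j))) = (\<Sum>j\<in>J. eval_at x (u j) * c (m j) x)"
    proof (rule sum.cong[OF refl])
      fix j assume "j \<in> J"
      then show "T (residue_class (u j ^ p * m j)) = eval_at x (u j) * c (m j) x"
        using T_mult[OF cG[OF u] cG[OF m], of j j] x
        by (simp add: residue_class_pow residue_class_mult ev_residue_class c_eq[OF x v m])
    qed
    finally show "(\<Sum>j\<in>J. eval_at x (u j) * c (m j) x) = 0" by (simp add: T0)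
  next
    fix w :: "('v, 'k) mpoly" and x assume x: "x \<in> cone" and w: "w \<in> homogeneous_polys 1"
    obtain v where v: "x v \<noteq> 0" using point[OF x] by blast
    then have "ev x (residue_class (Var v)) \<noteq> 0" using x by (simp add: ev_residue_class peval_Var)
    from ftrace_pow[OF eval_point[OF x] VarG this cG[OF w]]
    show "c (w ^ p) x = eval_at x w"
      using hp_power[OF w, of p] x by (simp add: residue_class_pow ev_residue_class c_eq[OF x v])
  next
    fix m :: "('v, 'k) mpoly" and x assume x: "x \<in> cone" and m: "m \<in> homogeneous_polys p"
    obtain v where v: "x v \<noteq> 0" using point[OF x] by blast
    then have "ev x (residue_class (Var v)) \<noteq> 0" using x by (simp add: ev_residue_class peval_Var)
    from ftrace_regular[OF eval_point[OF x] VarG this cG[OF m]]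
    obtain A B d where AB: "A \<in> coord_grading (Suc d)" "B \<in> coord_grading d" "ev x B \<noteq> 0"
      and reg: "\<And>Q ev'. \<lbrakk>eval_point Q ev'; ev' B \<noteq> 0\<rbrakk> \<Longrightarrow>
        ev' (residue_class (Var v)) \<noteq> 0 \<and> ftrace (residue_class (Var v)) (residue_class m) Q ev' =
            ev' A / (ev' B :: 'k)" by metis
    from AB obtain A' B' where A': "A = residue_class A'" "A' \<in> homogeneous_polys (Suc d)"
      and B': "B = residue_class B'" "B' \<in> homogeneous_polys d" by blast
    \<comment> \<open>The coordinate \<open>v\<close> was chosen at \<open>x\<close>, but
      nonvanishing of the denominator keeps it nonzero at \<open>y\<close> as well, so the same
      chart computes \<open>c m y\<close>.\<close>
    have "c m y = eval_at y A' / eval_at y B'" if y: "y \<in> cone" and "eval_at y B' \<noteq> 0" for y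
      using reg[OF eval_point[OF y]] that c_eq[OF y _ m, of v] by (simp add: A' B' ev_residue_class
          peval_Var)
    then show "\<exists>A B d. A \<in> homogeneous_polys (Suc d) \<and> B \<in> homogeneous_polys d \<and>
        eval_at x B \<noteq> 0 \<and> (\<forall>y\<in>cone. eval_at y B \<noteq> 0 \<longrightarrow> c m y = eval_at y A / eval_at y B)"
      using A' B' AB(3) x by (auto simp: ev_residue_class)
  qed
qed

end

section \<open>Sections of O(n) on the projective line\<close>

section \<open>Regular functions on rational curves\<close>

text \<open>If k were finite, 1 plus the product of all X - a would take the value 1 everywhere and
  have no root.\<close>

lemma infinite_alg_closed: "infinite (UNIV :: 'k::alg_closed_field set)"
proof
  assume fin: "finite (UNIV :: 'k set)"
  define P where "P = (\<Prod>a\<in>(UNIV :: 'k set). [:- a, 1:]) + 1"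
  have *: "poly P t = 1" for t
    using fin by (auto simp: P_def poly_prod intro!: prod_zero)
  have "degree (\<Prod>a\<in>(UNIV :: 'k set). [:- a, 1:]) = card (UNIV :: 'k set)"
    by (subst degree_prod_eq_sum_degree) auto
  moreover have "card (UNIV :: 'k set) > 0" using fin by (simp add: card_gt_0_iff)
  ultimately have "degree P > 0" by (simp add: P_def degree_add_eq_left)
  then show False using alg_closed_imp_poly_has_root[of P] * by simp
qed

lemma poly_eq_cofinite:
  fixes p q :: "'k::alg_closed_field poly"
  assumes "finite {t. poly p t \<noteq> poly q t}"
  shows "p = q"
proof (rule ccontr)
  assume "p \<noteq> q"
  then have "finite {t. poly (p - q) t = 0}" by (intro poly_roots_finite) simp
  moreover have "{t. poly (p - q) t = 0} \<union> {t. poly p t \<noteq> poly q t} = UNIV" by auto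
  ultimately show False
    using assms infinite_alg_closed[where ?'k = 'k] by (metis finite_UnI)
qed

lemma cofinite_nonzero: "(p :: 'k::field poly) \<noteq> 0 \<Longrightarrow> finite {t. \<not> poly p t \<noteq> 0}"
  using poly_roots_finite by simp

text \<open>The function \<open>g\<close> is \<open>f\<close>, as a section of \<open>\<O>(n)\<close>, in the chart at infinity.\<close>

lemma locally_rational_imp_poly:
  fixes f g :: "'k::alg_closed_field \<Rightarrow> 'k"
  assumes loc: "\<And>t. \<exists>A B. poly B t \<noteq> 0 \<and> (\<forall>s. poly B s \<noteq> 0 \<longrightarrow> f s = poly A s / poly B s)"
    and inf: "\<exists>A B. poly B 0 \<noteq> 0 \<and> (\<forall>s. poly B s \<noteq> 0 \<longrightarrow> g s = poly A s / poly B s)"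
    and g: "\<And>s. s \<noteq> 0 \<Longrightarrow> g s = s ^ n * f (inverse s)"
  shows "\<exists>P. degree P \<le> n \<and> (\<forall>t. f t = poly P t) \<and> g 0 = coeff P n"
proof -
  \<comment> \<open>Possible denominators of \<open>f\<close>, with finitely many exceptional
    parameters allowed: cancelling a factor X - r below can lose the equation at r. The aim is that
    a denominator of least degree is constant.\<close>
  define S where "S = {B. B \<noteq> 0 \<and> (\<exists>A. finite {s. poly B s * f s \<noteq> poly A s})}"
  have loc': "\<exists>A B. poly B t \<noteq> 0 \<and> (\<forall>s. poly B s \<noteq> 0 \<longrightarrow> poly B s * f s = poly A s)" for t
  proof -
    obtain A B where "poly B t \<noteq> 0" "\<forall>s. poly B s \<noteq> 0 \<longrightarrow> f s = poly A s / poly B s"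
      using loc[of t] by blast
    then show ?thesis by (intro exI[of _ A] exI[of _ B]) simp
  qed
  have S_I: "B \<in> S \<and> finite {s. poly B s * f s \<noteq> poly A s}"
    if "poly B t \<noteq> 0" "\<forall>s. poly B s \<noteq> 0 \<longrightarrow> poly B s * f s = poly A s" for A B t
  proof -
    have "B \<noteq> 0" using that(1) by auto
    moreover have "finite {s. poly B s * f s \<noteq> poly A s}"
      using that(2) by (intro finite_subset[OF _ cofinite_nonzero[OF \<open>B \<noteq> 0\<close>]]) auto
    ultimately show ?thesis by (auto simp: S_def)
  qed
  have "\<exists>B. B \<in> S" using loc'[of 0] S_I by blast
  then obtain B where BS: "B \<in> S" and min: "\<And>B'. B' \<in> S \<Longrightarrow> degree B \<le> degree B'"
    using ex_has_least_nat[of "\<lambda>B. B \<in> S" _ degree] by blast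
  then obtain A where B0: "B \<noteq> 0" and A: "finite {s. poly B s * f s \<noteq> poly A s}"
    by (auto simp: S_def)
  have cross: "A * B1 = A1 * B" if "finite {s. poly B1 s * f s \<noteq> poly A1 s}" for A1 B1
  proof (rule poly_eq_cofinite)
    show "finite {t. poly (A * B1) t \<noteq> poly (A1 * B) t}"
    proof (rule finite_subset[OF _ finite_UnI[OF A that]])
      have "poly A t * poly B1 t = poly A1 t * poly B t"
        if "poly B t * f t = poly A t" "poly B1 t * f t = poly A1 t" for t
        unfolding that[symmetric] by (simp add: mult_ac)
      then show "{t. poly (A * B1) t \<noteq> poly (A1 * B) t}
          \<subseteq> {s. poly B s * f s \<noteq> poly A s} \<union> {s. poly B1 s * f s \<noteq> poly A1 s}"
        by (simp, blast)
    qed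
  qed
  \<comment> \<open>At a root r of the minimal denominator, the fraction valid near r forces the
    numerator to vanish at r too. Cancelling X - r then contradicts minimality. Over an
    algebraically closed field a polynomial without roots has degree 0.\<close>
  have "poly B r \<noteq> 0" for r
  proof
    assume r: "poly B r = 0"
    obtain A1 B1 where 1: "poly B1 r \<noteq> 0" "\<forall>s. poly B1 s \<noteq> 0 \<longrightarrow> poly B1 s * f s = poly A1 s"
      using loc' by blast
    then have "A * B1 = A1 * B" using S_I cross by blast
    then have "poly A r * poly B1 r = poly A1 r * poly B r" by (metis poly_mult)
    with r 1 have "poly A r = 0" by simp
    with r obtain A' B' where A': "A = [:- r, 1:] * A'" and B': "B = [:- r, 1:] * B'"
      by (meson dvdE poly_eq_0_iff_dvd)
    have "B' \<noteq> 0" using B0 B' by auto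
    have "{s. poly B' s * f s \<noteq> poly A' s} \<subseteq> {s. poly B s * f s \<noteq> poly A s} \<union> {r}"
    proof clarify
      fix s assume ne: "poly B' s * f s \<noteq> poly A' s" and "s \<notin> {}" "s \<noteq> r"
        and eq: "poly B s * f s = poly A s"
      then have "(s - r) * (poly B' s * f s) = (s - r) * poly A' s"
        by (simp add: A' B' algebra_simps)
      with \<open>s \<noteq> r\<close> ne show False by simp
    qed
    then have "finite {s. poly B' s * f s \<noteq> poly A' s}" 
      using A by (meson finite_UnI finite_subset finite.emptyI finite.insertI)
    then have "B' \<in> S" using \<open>B' \<noteq> 0\<close> by (auto simp: S_def)
    moreover have "degree B = Suc (degree B')"
      unfolding B' using \<open>B' \<noteq> 0\<close> by (subst degree_mult_eq) auto
    ultimately show False using min by force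
  qed
  then have "degree B = 0" using alg_closed_imp_poly_has_root[of B] by blast
  then obtain b where b: "B = [:b:]" by (rule degree_eq_zeroE)
  with B0 have "b \<noteq> 0" by auto
  define P where "P = smult (inverse b) A"
  have AP: "A = smult b P" using \<open>b \<noteq> 0\<close> by (simp add: P_def)
  have cross': "P * B1 = A1" if "finite {s. poly B1 s * f s \<noteq> poly A1 s}" for A1 B1
    using cross[OF that] \<open>b \<noteq> 0\<close> by (simp add: AP b smult_cancel)
  have fP: "f t = poly P t" for t
  proof -
    obtain A1 B1 where 1: "poly B1 t \<noteq> 0" "\<forall>s. poly B1 s \<noteq> 0 \<longrightarrow> poly B1 s * f s = poly A1 s"
      using loc' by blast
    then have "P * B1 = A1" using S_I cross' by blast
    with 1 have "poly B1 t * f t = poly P t * poly B1 t" by (metis poly_mult)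
    with 1(1) show ?thesis by simp
  qed
  obtain A2 B2 where B2: "poly B2 0 \<noteq> 0"
    and g2: "\<And>s. poly B2 s \<noteq> 0 \<Longrightarrow> g s = poly A2 s / poly B2 s"
    using inf by blast
  have "B2 \<noteq> 0" using B2 by auto
  \<comment> \<open>For nonzero s the chart at infinity gives s^n P(1/s), while s^(degree P) P(1/s)
    is \<open>reflect_poly P\<close>. Clearing denominators turns the comparison into a polynomial
    identity.\<close>
  have "monom 1 (degree P) * A2 = monom 1 n * (reflect_poly P * B2)"
  proof (rule poly_eq_cofinite, rule finite_subset)
    show "finite ({0} \<union> {s. \<not> poly B2 s \<noteq> 0})"
      using cofinite_nonzero[OF \<open>B2 \<noteq> 0\<close>] by simp
    show "{t. poly (monom 1 (degree P) * A2) t \<noteq> poly (monom 1 n * (reflect_poly P * B2)) t}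
        \<subseteq> {0} \<union> {s. \<not> poly B2 s \<noteq> 0}"
    proof clarify
      fix s assume s: "s \<notin> {}" "s \<noteq> 0" "poly B2 s \<noteq> 0"
        and ne: "poly (monom 1 (degree P) * A2) s \<noteq> poly (monom 1 n * (reflect_poly P * B2)) s"
      have "poly A2 s = s ^ n * poly P (inverse s) * poly B2 s"
        using g[OF s(2)] g2[OF s(3)] s(3) by (simp add: fP field_simps)
      then show False using ne s(2) by (simp add: poly_monom poly_reflect_poly_nz)
    qed
  qed
  note key = this
  \<comment> \<open>Otherwise \<open>g\<close> would have a pole at 0: after cancelling s^n the left
    side vanishes at 0, but \<open>reflect_poly P\<close> takes the nonzero leading coefficient of
    \<open>P\<close> there, and \<open>B2\<close> is nonzero as well.\<close>
  have deg: "degree P \<le> n"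
  proof (rule ccontr)
    assume "\<not> degree P \<le> n"
    then have "monom 1 (degree P) = monom (1 :: 'k) n * monom 1 (degree P - n)" and "P \<noteq> 0"
      and gt: "degree P - n > 0" by (auto simp: mult_monom)
    with key have "monom 1 (degree P - n) * A2 = reflect_poly P * B2"
      by (simp add: mult.assoc)
    then have "poly (monom 1 (degree P - n) * A2) 0 = poly (reflect_poly P * B2) 0" by simp
    with gt B2 \<open>P \<noteq> 0\<close> show False by (simp add: poly_monom zero_power)
  qed
  then have "monom 1 n = monom (1 :: 'k) (degree P) * monom 1 (n - degree P)"
    by (simp add: mult_monom)
  with key have "A2 = monom 1 (n - degree P) * (reflect_poly P * B2)"
    by (simp add: mult.assoc)
  then have "g 0 = 0 ^ (n - degree P) * lead_coeff P"
    using g2[OF B2] B2 by (simp add: poly_monom)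
  also have "\<dots> = coeff P n"
    using deg by (cases "degree P = n") (auto simp: coeff_eq_0 zero_power)
  finally show ?thesis using deg fP by blast
qed

lemma eval_at_scale:
  assumes "f \<in> homogeneous_polys d"
  shows "eval_at (\<lambda>v. \<mu> * x v) f = \<mu> ^ d * eval_at x f"
  using poly_eval_poly[of "\<lambda>v. [:0, x v:]" f \<mu>] by (simp add: eval_poly_line[OF assms] poly_monom
      mult.commute)

lemma (in homogeneous_equations) cone_scale:
  assumes "x \<in> cone" "\<mu> \<noteq> 0"
  shows "(\<lambda>v. \<mu> * x v) \<in> cone"
  using assms E_homogeneous eval_at_scale by (fastforce simp: cone_def)

text \<open>The last condition is about the point \<open>t = \<infinity>\<close> of the curve.\<close>

definition (in homogeneous_equations) curve :: "nat \<Rightarrow> ('v \<Rightarrow> 'k poly) \<Rightarrow> bool" where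
  "curve n x \<longleftrightarrow> (\<forall>v. degree (x v) \<le> n) \<and> (\<forall>t. (\<lambda>v. poly (x v) t) \<in> cone) \<and>
     (\<lambda>v. coeff (x v) n) \<in> cone"

text \<open>Pulling back the local fractions A/B along the curve gives local fractions in the
  parameter, both for finite t and in the chart at infinity. Homogeneity of \<open>c\<close> glues
  the two charts with the factor s^n.\<close>

lemma regular_on_curve:
  fixes E :: "('v, 'k::alg_closed_field) mpoly set" and c :: "('v \<Rightarrow> 'k) \<Rightarrow> 'k"
  assumes "homogeneous_equations E"
  defines "CC \<equiv> homogeneous_equations.cone E"
  assumes x: "homogeneous_equations.curve E n x"
    and reg: "\<And>x. x \<in> CC \<Longrightarrow>
       \<exists>A B d. A \<in> homogeneous_polys (Suc d) \<and> B \<in> homogeneous_polys d \<and> eval_at x B \<noteq> 0 \<and>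
         (\<forall>y\<in>CC. eval_at y B \<noteq> 0 \<longrightarrow> c y = eval_at y A / eval_at y B)"
  shows "\<exists>P. degree P \<le> n \<and> (\<forall>t. c (\<lambda>v. poly (x v) t) = poly P t) \<and> c (\<lambda>v. coeff (x v) n) = coeff P n"
proof -
  interpret homogeneous_equations E by fact
  note CC_def [simp]
  have deg: "degree (x v) \<le> n" and pt: "(\<lambda>v. poly (x v) t) \<in> cone"
    and pt_inf: "(\<lambda>v. coeff (x v) n) \<in> cone" for v t
    using x by (auto simp: curve_def)
  \<comment> \<open>The degrees of numerator and denominator differ by one, so \<open>c\<close> is
    homogeneous of degree one, as a section of O(1) on the cone must be.\<close>
  have scale: "c (\<lambda>v. \<mu> * y v) = \<mu> * c y" if y: "y \<in> cone" and \<mu>: "\<mu> \<noteq> 0" for y \<mu>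
  proof -
    obtain A B d where AB: "A \<in> homogeneous_polys (Suc d)" "B \<in> homogeneous_polys d"
      "eval_at y B \<noteq> 0" and r: "\<And>z. \<lbrakk>z \<in> cone; eval_at z B \<noteq> 0\<rbrakk> \<Longrightarrow> c z = eval_at z A / eval_at z B"
      using reg[of y] y by auto
    show ?thesis
      using r[OF y AB(3)] r[OF cone_scale[OF y \<mu>]] AB \<mu> by (simp add: eval_at_scale)
  qed
  have loc: "\<exists>A B. poly B t \<noteq> 0 \<and>
      (\<forall>s. poly B s \<noteq> 0 \<longrightarrow> c (\<lambda>v. poly (y v) s) = poly A s / poly B s)"
    if y: "\<And>s. (\<lambda>v. poly (y v) s) \<in> cone" for y t
  proof -
    obtain A B d where "eval_at (\<lambda>v. poly (y v) t) B \<noteq> 0"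
      and "\<And>z. \<lbrakk>z \<in> cone; eval_at z B \<noteq> 0\<rbrakk> \<Longrightarrow> c z = eval_at z A / eval_at z B"
      using reg[of "\<lambda>v. poly (y v) t"] y by auto
    then show ?thesis
      using y by (intro exI[of _ "eval_poly y A"] exI[of _ "eval_poly y B"])
        (simp add: poly_eval_poly)
  qed
  \<comment> \<open>The curve in the chart at infinity, s^n x(1/s). The monomial pads the reversed
    polynomial, since a coordinate may have degree below n.\<close>
  define y where "y v = monom 1 (n - degree (x v)) * reflect_poly (x v)" for v
  have y0: "poly (y v) 0 = coeff (x v) n" for v
    using deg[of v] by (cases "degree (x v) = n") (auto simp: y_def poly_monom coeff_eq_0 zero_power)
  have y_nz: "poly (y v) s = s ^ n * poly (x v) (inverse s)" if "s \<noteq> 0" for v s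
    using deg[of v] that
    by (simp add: y_def poly_monom poly_reflect_poly_nz mult.assoc[symmetric] flip: power_add)
  have y_cone: "(\<lambda>v. poly (y v) s) \<in> cone" for s
  proof (cases "s = 0")
    case True
    then show ?thesis using pt_inf by (simp add: y0)
  next
    case False
    then show ?thesis using cone_scale[OF pt[of "inverse s"], of "s ^ n"] by (simp add: y_nz)
  qed
  have "c (\<lambda>v. poly (y v) s) = s ^ n * c (\<lambda>v. poly (x v) (inverse s))" if "s \<noteq> 0" for s
    using scale[OF pt[of "inverse s"], of "s ^ n"] that by (simp add: y_nz)
  from locally_rational_imp_poly[OF loc[OF pt] loc[OF y_cone] this]
  show ?thesis by (simp add: y0)
qed

section \<open>Quartic relations of the form sum of u^2 m\<close>

section \<open>Relations between the Pluecker coordinates\<close>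

text \<open>
  In characteristic \<open>2\<close> the linear equations identify five of the coordinates with five others.  The
  Pluecker quadrics in the remaining ten coordinates fall into three orbits under the simultaneous
  rotation of \<open>(w, a, b, c, d)\<close> and \<open>(e, p, q, r, f)\<close>.
\<close>

locale pluecker_relations =
  fixes I :: "'r::comm_ring_1 set" and w a b c d e p q r f :: 'r
  assumes two: "(2 :: 'r) = 0"
    and add: "\<lbrakk>x \<in> I; y \<in> I\<rbrakk> \<Longrightarrow> x + y \<in> I"
    and mult: "y \<in> I \<Longrightarrow> x * y \<in> I"
    and A0: "w * w + a * b + c * e \<in> I"
    and B0: "e * q + d * w + b * p \<in> I"
    and C0: "w * p + a * d + b * e \<in> I"
    and A1: "a * a + b * c + d * p \<in> I"
    and B1: "p * r + w * a + c * q \<in> I"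
    and C1: "a * q + b * w + c * p \<in> I"
    and A2: "b * b + c * d + w * q \<in> I"
    and B2: "q * f + a * b + d * r \<in> I"
    and C2: "b * r + c * a + d * q \<in> I"
    and A3: "c * c + d * w + a * r \<in> I"
    and B3: "r * e + b * c + w * f \<in> I"
    and C3: "c * f + d * b + w * r \<in> I"
    and A4: "d * d + w * a + b * f \<in> I"
    and B4: "f * p + c * d + a * e \<in> I"
    and C4: "d * e + w * c + a * f \<in> I"
begin

text \<open>The second form cancels equal neighbours inside a sorted sum, so that simplification
  decides identities modulo 2.\<close>

lemma char2: "x + x = (0 :: 'r)" "x + (x + y) = (y :: 'r)"
  using two by (metis mult_2 mult_zero_left, metis add.assoc add_0 mult_2 mult_zero_left two)

text \<open>As in the relations after it, the cofactors of the quadrics are chosen so that all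
  squarefree monomials of degree 4 cancel modulo 2. What remains is a sum of terms u^2 m, the shape
  to which the trace applies.\<close>

lemma rel1: "d^2 * (a * c) + e^2 * (a * b) + p^2 * (w * f) + d^2 * (e * p) \<in> I"
proof -
  have "d^2 * (a * c) + e^2 * (a * b) + p^2 * (w * f) + d^2 * (e * p)
     = (c * d) * (w * p + a * d + b * e) + (p * f) * (w * p + a * d + b * e) + (b * e) * (f * p + c
         * d + a * e) + (d * p) * (d * e + w * c + a * f)"
    by (simp add: power2_eq_square algebra_simps char2 two)
  then show ?thesis by (simp only: add mult B4 C0 C4)
qed

lemma rel2: "w^2 * (e * p) + a^2 * (d * p) + p^2 * (w * a) + e^2 * (c * p) \<in> I"
proof -
  have "w^2 * (e * p) + a^2 * (d * p) + p^2 * (w * a) + e^2 * (c * p)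
     = (e * p) * (w * w + a * b + c * e) + (a * p) * (w * p + a * d + b * e)"
    by (simp add: power2_eq_square algebra_simps char2 two)
  then show ?thesis by (simp only: add mult A0 C0)
qed

lemma rel3: "e^2 * (r * f) + w^2 * (b * f) + b^2 * (a * f) + f^2 * (w * e) \<in> I"
proof -
  have "e^2 * (r * f) + w^2 * (b * f) + b^2 * (a * f) + f^2 * (w * e)
     = (b * f) * (w * w + a * b + c * e) + (e * f) * (r * e + b * c + w * f)"
    by (simp add: power2_eq_square algebra_simps char2 two)
  then show ?thesis by (simp only: add mult A0 B3)
qed

lemma rel4: "b^2 * (f^2) + w^2 * (w * f) + e^2 * (d * f) + r^2 * (a * f) + c^2 * (r * f) + f^2 * (p
    * f) \<in> I"
proof -
  have "b^2 * (f^2) + w^2 * (w * f) + e^2 * (d * f) + r^2 * (a * f) + c^2 * (r * f) + f^2 * (p * f)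
     = (w * f) * (w * w + a * b + c * e) + (f * f) * (b * b + c * d + w * q) + (w * f) * (q * f + a
         * b + d * r) + (r * f) * (c * c + d * w + a * r) + (f * f) * (f * p + c * d + a * e) + (e *
         f) * (d * e + w * c + a * f)"
    by (simp add: power2_eq_square algebra_simps char2 two)
  then show ?thesis by (simp only: add mult A0 A2 A3 B2 B4 C4)
qed

text \<open>This relation is used on two curves, a twisted cubic and the quartic.\<close>

lemma rel5: "d^2 * (p * f) + p^2 * (b * e) + e^2 * (p * q) + w^2 * (c * p) + f^2 * (b * p) \<in> I"
proof -
  have "d^2 * (p * f) + p^2 * (b * e) + e^2 * (p * q) + w^2 * (c * p) + f^2 * (b * p)
     = (e * p) * (e * q + d * w + b * p) + (p * f) * (d * d + w * a + b * f) + (w * p) * (d * e + w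
         * c + a * f)"
    by (simp add: power2_eq_square algebra_simps char2 two)
  then show ?thesis by (simp only: add mult A4 B0 C4)
qed

lemma rel6: "e^2 * (d * q) + d^2 * (w * e) + d^2 * (a * p) + p^2 * (w * d) \<in> I"
proof -
  have "e^2 * (d * q) + d^2 * (w * e) + d^2 * (a * p) + p^2 * (w * d)
     = (d * e) * (e * q + d * w + b * p) + (d * p) * (w * p + a * d + b * e)"
    by (simp add: power2_eq_square algebra_simps char2 two)
  then show ?thesis by (simp only: add mult B0 C0)
qed

lemma rel7: "d^2 * (a * p) + a^2 * (b * e) + w^2 * (b^2) + b^2 * (a * b) + p^2 * (w * d) \<in> I"
proof -
  have "d^2 * (a * p) + a^2 * (b * e) + w^2 * (b^2) + b^2 * (a * b) + p^2 * (w * d)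
     = (b * b) * (w * w + a * b + c * e) + (d * p) * (w * p + a * d + b * e) + (b * e) * (a * a + b
         * c + d * p)"
    by (simp add: power2_eq_square algebra_simps char2 two)
  then show ?thesis by (simp only: add mult A0 A1 C0)
qed

lemma rel8: "w^2 * (w * q) + e^2 * (d * q) + d^2 * (b * q) + f^2 * (p * q) + q^2 * (w * f) \<in> I"
proof -
  have "w^2 * (w * q) + e^2 * (d * q) + d^2 * (b * q) + f^2 * (p * q) + q^2 * (w * f)
     = (w * q) * (w * w + a * b + c * e) + (w * q) * (q * f + a * b + d * r) + (d * q) * (c * f + d
         * b + w * r) + (q * f) * (f * p + c * d + a * e) + (e * q) * (d * e + w * c + a * f)"
    by (simp add: power2_eq_square algebra_simps char2 two)
  then show ?thesis by (simp only: add mult A0 B2 B4 C3 C4)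
qed

lemma rel9: "r^2 * (w * d) + a^2 * (w * c) + f^2 * (c * q) + d^2 * (d * q) \<in> I"
proof -
  have "r^2 * (w * d) + a^2 * (w * c) + f^2 * (c * q) + d^2 * (d * q)
     = (w * r) * (q * f + a * b + d * r) + (w * a) * (b * r + c * a + d * q) + (q * f) * (c * f + d
         * b + w * r) + (d * q) * (d * d + w * a + b * f)"
    by (simp add: power2_eq_square algebra_simps char2 two)
  then show ?thesis by (simp only: add mult A4 B2 C2 C3)
qed

lemma rel10: "a^2 * (p * f) + a^2 * (b^2) + c^2 * (b * d) + b^2 * (w * f) + d^2 * (w * b) + p^2 * (d
    * f) \<in> I"
proof -
  have "a^2 * (p * f) + a^2 * (b^2) + c^2 * (b * d) + b^2 * (w * f) + d^2 * (w * b) + p^2 * (d * f)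
     = (a * b) * (w * w + a * b + c * e) + (p * f) * (a * a + b * c + d * p) + (w * b) * (d * d + w
         * a + b * f) + (b * c) * (f * p + c * d + a * e)"
    by (simp add: power2_eq_square algebra_simps char2 two)
  then show ?thesis by (simp only: add mult A0 A1 A4 B4)
qed

lemma rel11: "e^2 * (b * d) + a^2 * (w * e) + a^2 * (d * f) + w^2 * (c * p) \<in> I"
proof -
  have "e^2 * (b * d) + a^2 * (w * e) + a^2 * (d * f) + w^2 * (c * p)
     = (w * c) * (w * p + a * d + b * e) + (a * e) * (d * d + w * a + b * f) + (a * d) * (d * e + w
         * c + a * f) + (b * e) * (d * e + w * c + a * f)"
    by (simp add: power2_eq_square algebra_simps char2 two)
  then show ?thesis by (simp only: add mult A4 C0 C4)
qed

lemma rel12: "d^2 * (b * d) + b^2 * (d * f) + c^2 * (a * b) + a^2 * (b * r) \<in> I"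
proof -
  have "d^2 * (b * d) + b^2 * (d * f) + c^2 * (a * b) + a^2 * (b * r)
     = (a * b) * (c * c + d * w + a * r) + (b * d) * (d * d + w * a + b * f)"
    by (simp add: power2_eq_square algebra_simps char2 two)
  then show ?thesis by (simp only: add mult A3 A4)
qed

lemma rel13: "f^2 * (b * r) + c^2 * (w * f) + w^2 * (d * f) + d^2 * (r * f) \<in> I"
proof -
  have "f^2 * (b * r) + c^2 * (w * f) + w^2 * (d * f) + d^2 * (r * f)
     = (w * f) * (c * c + d * w + a * r) + (r * f) * (d * d + w * a + b * f)"
    by (simp add: power2_eq_square algebra_simps char2 two)
  then show ?thesis by (simp only: add mult A3 A4)
qed

lemma rel14: "d^2 * (c * p) + p^2 * (d * f) + e^2 * (b * p) + p^2 * (w * e) \<in> I"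
proof -
  have "d^2 * (c * p) + p^2 * (d * f) + e^2 * (b * p) + p^2 * (w * e)
     = (e * p) * (w * p + a * d + b * e) + (d * p) * (f * p + c * d + a * e)"
    by (simp add: power2_eq_square algebra_simps char2 two)
  then show ?thesis by (simp only: add mult B4 C0)
qed

lemma rel15: "a^2 * (a * e) + a^2 * (b^2) + w^2 * (a * b) + d^2 * (c * p) + p^2 * (d * f) \<in> I"
proof -
  have "a^2 * (a * e) + a^2 * (b^2) + w^2 * (a * b) + d^2 * (c * p) + p^2 * (d * f)
     = (a * b) * (w * w + a * b + c * e) + (a * e) * (a * a + b * c + d * p) + (d * p) * (f * p + c
         * d + a * e)"
    by (simp add: power2_eq_square algebra_simps char2 two)
  then show ?thesis by (simp only: add mult A0 A1 B4)
qed

lemma rel16: "c^2 * (a * r) + q^2 * (w * r) + b^2 * (q * r) + r^2 * (b * c) \<in> I"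
proof -
  have "c^2 * (a * r) + q^2 * (w * r) + b^2 * (q * r) + r^2 * (b * c)
     = (q * r) * (b * b + c * d + w * q) + (c * r) * (b * r + c * a + d * q)"
    by (simp add: power2_eq_square algebra_simps char2 two)
  then show ?thesis by (simp only: add mult A2 C2)
qed

lemma rel17: "w^2 * (q * r) + b^2 * (w * r) + c^2 * (d * f) + d^2 * (b * c) \<in> I"
proof -
  have "w^2 * (q * r) + b^2 * (w * r) + c^2 * (d * f) + d^2 * (b * c)
     = (w * r) * (b * b + c * d + w * q) + (c * d) * (c * f + d * b + w * r)"
    by (simp add: power2_eq_square algebra_simps char2 two)
  then show ?thesis by (simp only: add mult A2 C3)
qed

text \<open>The source of the contradiction. The factor c^2 is a square with known trace c, so w^2
  c^2 contributes the inhomogeneous term w c.\<close>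

lemma rel18: "w^2 * (w * d) + b^2 * (d * f) + w^2 * (c^2) + f^2 * (b * c) + d^2 * (w * r) \<in> I"
proof -
  have "w^2 * (w * d) + b^2 * (d * f) + w^2 * (c^2) + f^2 * (b * c) + d^2 * (w * r)
     = (w * w) * (c * c + d * w + a * r) + (b * f) * (c * f + d * b + w * r) + (w * r) * (d * d + w
         * a + b * f)"
    by (simp add: power2_eq_square algebra_simps char2 two)
  then show ?thesis by (simp only: add mult A3 A4 C3)
qed

lemma rel19: "b^2 * (a * e) + e^2 * (b * c) + w^2 * (b * e) \<in> I"
proof -
  have "b^2 * (a * e) + e^2 * (b * c) + w^2 * (b * e)
     = (b * e) * (w * w + a * b + c * e)"
    by (simp add: power2_eq_square algebra_simps char2 two)
  then show ?thesis by (simp only: add mult A0)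
qed

lemma rel20: "d^2 * (a * p) + a^2 * (q^2) + p^2 * (a * r) + a^2 * (b * e) + b^2 * (a * b) \<in> I"
proof -
  have "d^2 * (a * p) + a^2 * (q^2) + p^2 * (a * r) + a^2 * (b * e) + b^2 * (a * b)
     = (a * a) * (w * p + a * d + b * e) + (a * d) * (a * a + b * c + d * p) + (a * p) * (p * r + w
         * a + c * q) + (a * q) * (a * q + b * w + c * p) + (a * b) * (b * b + c * d + w * q)"
    by (simp add: power2_eq_square algebra_simps char2 two)
  then show ?thesis by (simp only: add mult A1 A2 B1 C0 C1)
qed

lemma rel21: "a^2 * (q * r) + w^2 * (p * q) + c^2 * (a * q) + b^2 * (w * p) + w^2 * (b * d) \<in> I"
proof -
  have "a^2 * (q * r) + w^2 * (p * q) + c^2 * (a * q) + b^2 * (w * p) + w^2 * (b * d)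
     = (w * d) * (a * q + b * w + c * p) + (w * p) * (b * b + c * d + w * q) + (a * q) * (c * c + d
         * w + a * r)"
    by (simp add: power2_eq_square algebra_simps char2 two)
  then show ?thesis by (simp only: add mult A2 A3 C1)
qed

end

section \<open>Traces along curves, and coordinates on the threefold\<close>

section \<open>The splitting along rational curves\<close>

text \<open>Relations are lists of pairs (u, m), so that a concrete relation can be supplied as an
  explicit list and its sum unfolds by simplification.\<close>

definition (in homogeneous_equations) frobenius_trace ::
    "nat \<Rightarrow> (('v, 'k) mpoly \<Rightarrow> ('v \<Rightarrow> 'k) \<Rightarrow> 'k) \<Rightarrow> bool" where
  "frobenius_trace p c \<longleftrightarrow>
     (\<forall>x\<in>cone. \<forall>L. set L \<subseteq> homogeneous_polys 1 \<times> homogeneous_polys p \<longrightarrow>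
        (\<Sum>(u, m)\<leftarrow>L. u ^ p * m) \<in> I \<longrightarrow> (\<Sum>(u, m)\<leftarrow>L. eval_at x u * c m x) = 0) \<and>
     (\<forall>x\<in>cone. \<forall>u\<in>homogeneous_polys 1. c (u ^ p) x = eval_at x u) \<and>
     (\<forall>x\<in>cone. \<forall>m\<in>homogeneous_polys p.
        \<exists>A B d. A \<in> homogeneous_polys (Suc d) \<and> B \<in> homogeneous_polys d \<and> eval_at x B \<noteq> 0 \<and>
         (\<forall>y\<in>cone. eval_at y B \<noteq> 0 \<longrightarrow> c m y = eval_at y A / eval_at y B))"

lemma (in homogeneous_equations) F_split_frobenius_trace:
  assumes "F_split p (closed_subscheme E)"
  shows "\<exists>c. frobenius_trace p c"
proof -
  from F_split_trace[OF assms] obtain c :: "('v, 'k) mpoly \<Rightarrow> ('v \<Rightarrow> 'k) \<Rightarrow> 'k" where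
    rel: "\<And>(J :: nat set) u m x. \<lbrakk>x \<in> cone; \<And>j. j \<in> J \<Longrightarrow> u j \<in> homogeneous_polys 1;
       \<And>j. j \<in> J \<Longrightarrow> m j \<in> homogeneous_polys p; (\<Sum>j\<in>J. u j ^ p * m j) \<in> I\<rbrakk> \<Longrightarrow>
       (\<Sum>j\<in>J. eval_at x (u j) * c (m j) x) = 0" and
    c: "\<And>w x. \<lbrakk>x \<in> cone; w \<in> homogeneous_polys 1\<rbrakk> \<Longrightarrow> c (w ^ p) x = eval_at x w"
    "\<And>m x. \<lbrakk>x \<in> cone; m \<in> homogeneous_polys p\<rbrakk> \<Longrightarrow>
       \<exists>A B d. A \<in> homogeneous_polys (Suc d) \<and> B \<in> homogeneous_polys d \<and> eval_at x B \<noteq> 0 \<and>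
         (\<forall>y\<in>cone. eval_at y B \<noteq> 0 \<longrightarrow> c m y = eval_at y A / eval_at y B)" by blast
  have "(\<Sum>(u, m)\<leftarrow>L. eval_at x u * c m x) = 0"
    if x: "x \<in> cone" and L: "set L \<subseteq> homogeneous_polys 1 \<times> homogeneous_polys p"
      and I: "(\<Sum>(u, m)\<leftarrow>L. u ^ p * m) \<in> I" for x L
  proof -
    have "L ! j \<in> homogeneous_polys 1 \<times> homogeneous_polys p" if "j < length L" for j
      using L that nth_mem by blast
    then have *: "fst (L ! j) \<in> homogeneous_polys 1 \<and> snd (L ! j) \<in> homogeneous_polys p"
      if "j \<in> {0..<length L}" for j
      using that by (metis atLeastLessThan_iff mem_Times_iff)
    show ?thesis
      using rel[OF x, of "{0..<length L}" "\<lambda>j. fst (L ! j)" "\<lambda>j. snd (L ! j)"] * I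
      by (simp add: sum_list_sum_nth case_prod_unfold)
  qed
  then show ?thesis using c unfolding frobenius_trace_def by blast
qed

text \<open>The coefficients of the polynomials \<open>T m\<close> are the unknowns of the linear
  system. As k is infinite, equations valid at every parameter become polynomial identities, from
  which single coefficients can be extracted.\<close>

lemma trace_on_curve:
  fixes E :: "('v, 'k::alg_closed_field) mpoly set"
  assumes loc: "homogeneous_equations E" and c: "homogeneous_equations.frobenius_trace E p c"
    and x: "homogeneous_equations.curve E n x"
  obtains T :: "('v, 'k) mpoly \<Rightarrow> 'k poly" where
    "\<And>m i. n < i \<Longrightarrow> coeff (T m) i = 0"
    "\<And>m t. m \<in> homogeneous_polys p \<Longrightarrow> c m (\<lambda>v. poly (x v) t) = poly (T m) t"
    "\<And>m. m \<in> homogeneous_polys p \<Longrightarrow> c m (\<lambda>v. coeff (x v) n) = coeff (T m) n"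
    "\<And>L. \<lbrakk>set L \<subseteq> homogeneous_polys 1 \<times> homogeneous_polys p;
       (\<Sum>(u, m)\<leftarrow>L. u ^ p * m) \<in> homogeneous_equations.I E\<rbrakk> \<Longrightarrow>
       (\<Sum>(u, m)\<leftarrow>L. eval_poly x u * T m) = 0"
    "\<And>u. u \<in> homogeneous_polys 1 \<Longrightarrow> T (u ^ p) = eval_poly x u"
proof -
  interpret homogeneous_equations E by (rule loc)
  \<comment> \<open>For \<open>m\<close> outside degree p the default is the zero polynomial, so
    that the degree bound holds for all \<open>m\<close> and can be used freely in
    simplification.\<close>
  have "\<exists>P. degree P \<le> n \<and> (m \<in> homogeneous_polys p \<longrightarrow>
      (\<forall>t. c m (\<lambda>v. poly (x v) t) = poly P t) \<and> c m (\<lambda>v. coeff (x v) n) = coeff P n)" for m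
  proof (cases "m \<in> homogeneous_polys p")
    case True
    then show ?thesis
      using regular_on_curve[OF loc x, of "c m"] c by (simp add: frobenius_trace_def)
  qed (auto intro: exI[of _ 0])
  then obtain T where deg: "\<And>m. degree (T m) \<le> n"
    and T: "\<And>m t. m \<in> homogeneous_polys p \<Longrightarrow> c m (\<lambda>v. poly (x v) t) = poly (T m) t"
    and T_inf: "\<And>m. m \<in> homogeneous_polys p \<Longrightarrow> c m (\<lambda>v. coeff (x v) n) = coeff (T m) n"
    by metis
  have pt: "(\<lambda>v. poly (x v) t) \<in> cone" for t
    using x by (simp add: curve_def)
  have eqI: "P = Q" if "\<And>t. poly P t = poly Q t" for P Q :: "'k poly"
    by (rule poly_eq_cofinite) (simp add: that)
  show ?thesis
  proof
    show "coeff (T m) i = 0" if "n < i" for m i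
      using deg[of m] that by (simp add: coeff_eq_0)
    show "(\<Sum>(u, m)\<leftarrow>L. eval_poly x u * T m) = 0"
      if L: "set L \<subseteq> homogeneous_polys 1 \<times> homogeneous_polys p"
        "(\<Sum>(u, m)\<leftarrow>L. u ^ p * m) \<in> I" for L
    proof (rule eqI)
      fix t
      have "poly (\<Sum>(u, m)\<leftarrow>L. eval_poly x u * T m) t
          = (\<Sum>(u, m)\<leftarrow>L. eval_at (\<lambda>v. poly (x v) t) u * c m (\<lambda>v. poly (x v) t))"
        using L(1) by (induction L) (auto simp: poly_eval_poly T)
      also have "\<dots> = 0"
        using c L pt[of t] unfolding frobenius_trace_def by blast
      finally show "poly (\<Sum>(u, m)\<leftarrow>L. eval_poly x u * T m) t = poly 0 t" by simp
    qed
    show "T (u ^ p) = eval_poly x u" if u: "u \<in> homogeneous_polys 1" for u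
    proof (rule eqI)
      fix t
      have "u ^ p \<in> homogeneous_polys p" using hp_power[OF u, of p] by simp
      then show "poly (T (u ^ p)) t = poly (eval_poly x u) t"
        using c pt[of t] u by (simp add: poly_eval_poly T[symmetric] frobenius_trace_def)
    qed
  qed (fact T T_inf)+
qed

text \<open>The strict upper triangle of an alternating 6 x 6 matrix, row i starting at column i +
  1. The repeated letters solve the five linear equations, whose signs disappear in characteristic
  2.\<close>

definition pvec :: "'a \<Rightarrow> 'a \<Rightarrow> 'a \<Rightarrow> 'a \<Rightarrow> 'a \<Rightarrow> 'a \<Rightarrow> 'a \<Rightarrow> 'a \<Rightarrow> 'a \<Rightarrow> 'a \<Rightarrow> pluecker_index \<Rightarrow> 'a" where
  "pvec w a b c d e p q r f z = (case Rep_pluecker_index z of (i, j) \<Rightarrow>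
     [[w, a, b, c, d], [e, d, b, f], [p, w, c], [q, a], [r]] ! i ! (j - Suc i))"

lemma pvec_Abs:
  "i < j \<Longrightarrow> j \<le> 5 \<Longrightarrow> pvec w a b c d e p q r f (Abs_pluecker_index (i, j)) =
     [[w, a, b, c, d], [e, d, b, f], [p, w, c], [q, a], [r]] ! i ! (j - Suc i)"
  by (simp add: pvec_def Abs_pluecker_index_inverse)

lemma pluecker_pairs:
  "\<lbrakk>i < j; j \<le> (5::nat)\<rbrakk> \<Longrightarrow> (i, j) \<in> {(0,1),(0,2),(0,3),(0,4),(0,5),(1,2),(1,3),(1,4),(1,5),
     (2,3),(2,4),(2,5),(3,4),(3,5),(4,5)}"
  by (simp, presburger)

lemma pvec_hom: "g (pvec w a b c d e p q r f z) =
    pvec (g w) (g a) (g b) (g c) (g d) (g e) (g p) (g q) (g r) (g f) z"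
proof (cases z)
  case (Abs_pluecker_index y)
  then obtain i j where y: "y = (i, j)" "i < j" "j \<le> 5" by auto
  then show ?thesis
    unfolding Abs_pluecker_index y using pluecker_pairs[OF y(2,3)]
    by (simp add: pvec_Abs) (elim disjE, simp_all add: numeral_eq_Suc)
qed

lemma eval_pvec:
  fixes w :: "'r::comm_ring_1"
  assumes h: "h 0 = 0" "h 1 = 1" "\<And>a b. h (a + b) = h a + h b" "\<And>a b. h (a * b) = h a * h b"
    and "i < j" "j \<le> 5"
  shows "peval h (pvec w a b c d e p q r f) (pcoord i j) =
     [[w, a, b, c, d], [e, d, b, f], [p, w, c], [q, a], [r]] ! i ! (j - Suc i)"
  using assms(5,6) by (simp add: pcoord_def peval_Var[OF h] pvec_Abs)

text \<open>The name recalls the anticanonical degree 14 of a prime Fano threefold of genus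
  8.\<close>

definition v14_eqs :: "(pluecker_index, 'k::comm_ring_1) mpoly set" where
  "v14_eqs = {pcoord i j * pcoord k l - pcoord i k * pcoord j l + pcoord i l * pcoord j k | i j k l.
        i < j \<and> j < k \<and> k < l \<and> l \<le> 5} \<union>
     {pcoord 0 3 - pcoord 1 4, pcoord 0 4 - pcoord 2 5, pcoord 1 3 + pcoord 0 5,
      pcoord 0 1 + pcoord 2 4, pcoord 0 2 + pcoord 3 5}"

lemma hp_pcoord: "pcoord i j \<in> homogeneous_polys 1"
  unfolding pcoord_def by (rule hp_Var)

lemma hp_pcoord_mult: "pcoord i j * pcoord k l \<in> homogeneous_polys 2"
  using hp_mult[OF hp_pcoord[of i j] hp_pcoord[of k l]] by (simp add: numeral_2_eq_2)

lemma v14_homogeneous: "homogeneous_equations (v14_eqs :: (pluecker_index, 'k::field) mpoly set)"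
proof
  show "v14_eqs \<subseteq> (\<Union>d. homogeneous_polys d :: (pluecker_index, 'k) mpoly set)"
  proof
    fix g :: "(pluecker_index, 'k) mpoly" assume "g \<in> v14_eqs"
    then have "g \<in> homogeneous_polys 2 \<or> g \<in> homogeneous_polys 1"
      unfolding v14_eqs_def
      by (auto intro!: hp_add hp_diff simp: hp_pcoord_mult simp del: One_nat_def)
        (simp_all only: hp_add hp_diff hp_pcoord simp_thms)
    then show "g \<in> (\<Union>d. homogeneous_polys d)" by blast
  qed
qed

section \<open>The Fano threefold in characteristic 2\<close>

text \<open>Shaped for peeling multiples of the linear equations off a Pluecker quadric one at a
  time.\<close>

lemma (in homogeneous_equations) I_combination:
  "\<lbrakk>f \<in> I; g \<in> I\<rbrakk> \<Longrightarrow> f + h * g \<in> I"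
  by (intro I_add I_mult)

lemma char2_simps:
  fixes x y :: "'r::comm_ring_1"
  assumes "(2 :: 'r) = 0"
  shows "x + x = 0" "x + (x + y) = y" "- x = x" "x - y = x + y"
proof -
  show xx: "x + x = 0" for x :: 'r
    using assms by (simp flip: mult_2)
  then show "x + (x + y) = y" by (simp flip: add.assoc)
  show neg: "- x = x" for x :: 'r by (rule minus_unique[OF xx])
  show "x - y = x + y" by (metis diff_conv_add_uminus neg)
qed

lemma mpoly_two: "(2 :: 'k::comm_ring_1) = 0 \<Longrightarrow> (2 :: ('v, 'k) mpoly) = 0"
  by (metis single_numeral single_zero)

text \<open>Each quadric is one of the fifteen Pluecker quadrics corrected by multiples of the
  linear equations, which replace the five eliminated coordinates by the retained ones.\<close>

lemma v14_relations:
  assumes two: "(2 :: 'k::field) = 0"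
  shows "pluecker_relations (homogeneous_equations.I (v14_eqs :: (pluecker_index, 'k) mpoly set))
    (pcoord 0 1) (pcoord 0 2) (pcoord 0 3) (pcoord 0 4) (pcoord 0 5) (pcoord 1 2) (pcoord 2 3)
        (pcoord 3 4) (pcoord 4 5) (pcoord 1 5)"
proof -
  interpret homogeneous_equations "v14_eqs :: (pluecker_index, 'k) mpoly set" by (rule
      v14_homogeneous)
  note two' = mpoly_two[OF two, where ?'v = pluecker_index]
  note char2 = char2_simps[OF two']
  have pl: "pcoord i j * pcoord k l - pcoord i k * pcoord j l + pcoord i l * pcoord j k \<in> I"
    if "i < j" "j < k" "k < l" "l \<le> 5" for i j k l
    using that by (intro I_self) (auto simp: v14_eqs_def)
  have lin: "pcoord 0 3 - pcoord 1 4 \<in> I" "pcoord 0 4 - pcoord 2 5 \<in> I"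
    "pcoord 1 3 + pcoord 0 5 \<in> I" "pcoord 0 1 + pcoord 2 4 \<in> I" "pcoord 0 2 + pcoord 3 5 \<in> I"
    by (rule I_self, simp add: v14_eqs_def)+
  note comb = I_combination[OF _ lin(1)] I_combination[OF _ lin(2)] I_combination[OF _ lin(3)]
    I_combination[OF _ lin(4)] I_combination[OF _ lin(5)]
  show ?thesis
  proof
    show "(2 :: (pluecker_index, 'k) mpoly) = 0" by (rule two')
    show "x + y \<in> I" if "x \<in> I" "y \<in> I" for x y using that by (rule I_add)
    show "x * y \<in> I" if "y \<in> I" for x y using that by (rule I_mult)
    have "(pcoord 0 1 * pcoord 0 1 + pcoord 0 2 * pcoord 0 3 + pcoord 0 4 * pcoord 1 2 ::
        (pluecker_index, 'k) mpoly)
      = (pcoord 0 1 * pcoord 2 4 - pcoord 0 2 * pcoord 1 4 + pcoord 0 4 * pcoord 1 2) + pcoord 0 1 *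
          (pcoord 0 1 + pcoord 2 4) + pcoord 0 2 * (pcoord 0 3 - pcoord 1 4)" (is "_ = ?r")
      by (simp add: algebra_simps char2 two')
    moreover have "?r \<in> I" by (intro comb pl) simp_all
    ultimately show "pcoord 0 1 * pcoord 0 1 + pcoord 0 2 * pcoord 0 3 + pcoord 0 4 * pcoord 1 2 \<in>
        I" by (simp only:)
    have "(pcoord 1 2 * pcoord 3 4 + pcoord 0 5 * pcoord 0 1 + pcoord 0 3 * pcoord 2 3 ::
        (pluecker_index, 'k) mpoly)
      = (pcoord 1 2 * pcoord 3 4 - pcoord 1 3 * pcoord 2 4 + pcoord 1 4 * pcoord 2 3) + pcoord 2 4 *
          (pcoord 1 3 + pcoord 0 5) + pcoord 0 5 * (pcoord 0 1 + pcoord 2 4) + pcoord 2 3 * (pcoord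
          0 3 - pcoord 1 4)" (is "_ = ?r")
      by (simp add: algebra_simps char2 two')
    moreover have "?r \<in> I" by (intro comb pl) simp_all
    ultimately show "pcoord 1 2 * pcoord 3 4 + pcoord 0 5 * pcoord 0 1 + pcoord 0 3 * pcoord 2 3 \<in>
        I" by (simp only:)
    have "(pcoord 0 1 * pcoord 2 3 + pcoord 0 2 * pcoord 0 5 + pcoord 0 3 * pcoord 1 2 ::
        (pluecker_index, 'k) mpoly)
      = (pcoord 0 1 * pcoord 2 3 - pcoord 0 2 * pcoord 1 3 + pcoord 0 3 * pcoord 1 2) + pcoord 0 2 *
          (pcoord 1 3 + pcoord 0 5)" (is "_ = ?r")
      by (simp add: algebra_simps char2 two')
    moreover have "?r \<in> I" by (intro comb pl) simp_all
    ultimately show "pcoord 0 1 * pcoord 2 3 + pcoord 0 2 * pcoord 0 5 + pcoord 0 3 * pcoord 1 2 \<in>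
        I" by (simp only:)
    have "(pcoord 0 2 * pcoord 0 2 + pcoord 0 3 * pcoord 0 4 + pcoord 0 5 * pcoord 2 3 ::
        (pluecker_index, 'k) mpoly)
      = (pcoord 0 2 * pcoord 3 5 - pcoord 0 3 * pcoord 2 5 + pcoord 0 5 * pcoord 2 3) + pcoord 0 2 *
          (pcoord 0 2 + pcoord 3 5) + pcoord 0 3 * (pcoord 0 4 - pcoord 2 5)" (is "_ = ?r")
      by (simp add: algebra_simps char2 two')
    moreover have "?r \<in> I" by (intro comb pl) simp_all
    ultimately show "pcoord 0 2 * pcoord 0 2 + pcoord 0 3 * pcoord 0 4 + pcoord 0 5 * pcoord 2 3 \<in>
        I" by (simp only:)
    have "(pcoord 2 3 * pcoord 4 5 + pcoord 0 1 * pcoord 0 2 + pcoord 0 4 * pcoord 3 4 ::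
        (pluecker_index, 'k) mpoly)
      = (pcoord 2 3 * pcoord 4 5 - pcoord 2 4 * pcoord 3 5 + pcoord 2 5 * pcoord 3 4) + pcoord 3 5 *
          (pcoord 0 1 + pcoord 2 4) + pcoord 0 1 * (pcoord 0 2 + pcoord 3 5) + pcoord 3 4 * (pcoord
          0 4 - pcoord 2 5)" (is "_ = ?r")
      by (simp add: algebra_simps char2 two')
    moreover have "?r \<in> I" by (intro comb pl) simp_all
    ultimately show "pcoord 2 3 * pcoord 4 5 + pcoord 0 1 * pcoord 0 2 + pcoord 0 4 * pcoord 3 4 \<in>
        I" by (simp only:)
    have "(pcoord 0 2 * pcoord 3 4 + pcoord 0 3 * pcoord 0 1 + pcoord 0 4 * pcoord 2 3 ::
        (pluecker_index, 'k) mpoly)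
      = (pcoord 0 2 * pcoord 3 4 - pcoord 0 3 * pcoord 2 4 + pcoord 0 4 * pcoord 2 3) + pcoord 0 3 *
          (pcoord 0 1 + pcoord 2 4)" (is "_ = ?r")
      by (simp add: algebra_simps char2 two')
    moreover have "?r \<in> I" by (intro comb pl) simp_all
    ultimately show "pcoord 0 2 * pcoord 3 4 + pcoord 0 3 * pcoord 0 1 + pcoord 0 4 * pcoord 2 3 \<in>
        I" by (simp only:)
    have "(pcoord 0 3 * pcoord 0 3 + pcoord 0 4 * pcoord 0 5 + pcoord 0 1 * pcoord 3 4 ::
        (pluecker_index, 'k) mpoly)
      = (pcoord 0 1 * pcoord 3 4 - pcoord 0 3 * pcoord 1 4 + pcoord 0 4 * pcoord 1 3) + pcoord 0 3 *
          (pcoord 0 3 - pcoord 1 4) + pcoord 0 4 * (pcoord 1 3 + pcoord 0 5)" (is "_ = ?r")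
      by (simp add: algebra_simps char2 two')
    moreover have "?r \<in> I" by (intro comb pl) simp_all
    ultimately show "pcoord 0 3 * pcoord 0 3 + pcoord 0 4 * pcoord 0 5 + pcoord 0 1 * pcoord 3 4 \<in>
        I" by (simp only:)
    have "(pcoord 3 4 * pcoord 1 5 + pcoord 0 2 * pcoord 0 3 + pcoord 0 5 * pcoord 4 5 ::
        (pluecker_index, 'k) mpoly)
      = (pcoord 1 3 * pcoord 4 5 - pcoord 1 4 * pcoord 3 5 + pcoord 1 5 * pcoord 3 4) + pcoord 4 5 *
          (pcoord 1 3 + pcoord 0 5) + pcoord 3 5 * (pcoord 0 3 - pcoord 1 4) + pcoord 0 3 * (pcoord
          0 2 + pcoord 3 5)" (is "_ = ?r")
      by (simp add: algebra_simps char2 two')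
    moreover have "?r \<in> I" by (intro comb pl) simp_all
    ultimately show "pcoord 3 4 * pcoord 1 5 + pcoord 0 2 * pcoord 0 3 + pcoord 0 5 * pcoord 4 5 \<in>
        I" by (simp only:)
    have "(pcoord 0 3 * pcoord 4 5 + pcoord 0 4 * pcoord 0 2 + pcoord 0 5 * pcoord 3 4 ::
        (pluecker_index, 'k) mpoly)
      = (pcoord 0 3 * pcoord 4 5 - pcoord 0 4 * pcoord 3 5 + pcoord 0 5 * pcoord 3 4) + pcoord 0 4 *
          (pcoord 0 2 + pcoord 3 5)" (is "_ = ?r")
      by (simp add: algebra_simps char2 two')
    moreover have "?r \<in> I" by (intro comb pl) simp_all
    ultimately show "pcoord 0 3 * pcoord 4 5 + pcoord 0 4 * pcoord 0 2 + pcoord 0 5 * pcoord 3 4 \<in>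
        I" by (simp only:)
    have "(pcoord 0 4 * pcoord 0 4 + pcoord 0 5 * pcoord 0 1 + pcoord 0 2 * pcoord 4 5 ::
        (pluecker_index, 'k) mpoly)
      = (pcoord 0 2 * pcoord 4 5 - pcoord 0 4 * pcoord 2 5 + pcoord 0 5 * pcoord 2 4) + pcoord 0 4 *
          (pcoord 0 4 - pcoord 2 5) + pcoord 0 5 * (pcoord 0 1 + pcoord 2 4)" (is "_ = ?r")
      by (simp add: algebra_simps char2 two')
    moreover have "?r \<in> I" by (intro comb pl) simp_all
    ultimately show "pcoord 0 4 * pcoord 0 4 + pcoord 0 5 * pcoord 0 1 + pcoord 0 2 * pcoord 4 5 \<in>
        I" by (simp only:)
    have "(pcoord 4 5 * pcoord 1 2 + pcoord 0 3 * pcoord 0 4 + pcoord 0 1 * pcoord 1 5 ::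
        (pluecker_index, 'k) mpoly)
      = (pcoord 1 2 * pcoord 4 5 - pcoord 1 4 * pcoord 2 5 + pcoord 1 5 * pcoord 2 4) + pcoord 2 5 *
          (pcoord 0 3 - pcoord 1 4) + pcoord 0 3 * (pcoord 0 4 - pcoord 2 5) + pcoord 1 5 * (pcoord
          0 1 + pcoord 2 4)" (is "_ = ?r")
      by (simp add: algebra_simps char2 two')
    moreover have "?r \<in> I" by (intro comb pl) simp_all
    ultimately show "pcoord 4 5 * pcoord 1 2 + pcoord 0 3 * pcoord 0 4 + pcoord 0 1 * pcoord 1 5 \<in>
        I" by (simp only:)
    have "(pcoord 0 4 * pcoord 1 5 + pcoord 0 5 * pcoord 0 3 + pcoord 0 1 * pcoord 4 5 ::
        (pluecker_index, 'k) mpoly)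
      = (pcoord 0 1 * pcoord 4 5 - pcoord 0 4 * pcoord 1 5 + pcoord 0 5 * pcoord 1 4) + pcoord 0 5 *
          (pcoord 0 3 - pcoord 1 4)" (is "_ = ?r")
      by (simp add: algebra_simps char2 two')
    moreover have "?r \<in> I" by (intro comb pl) simp_all
    ultimately show "pcoord 0 4 * pcoord 1 5 + pcoord 0 5 * pcoord 0 3 + pcoord 0 1 * pcoord 4 5 \<in>
        I" by (simp only:)
    have "(pcoord 0 5 * pcoord 0 5 + pcoord 0 1 * pcoord 0 2 + pcoord 0 3 * pcoord 1 5 ::
        (pluecker_index, 'k) mpoly)
      = (pcoord 0 1 * pcoord 3 5 - pcoord 0 3 * pcoord 1 5 + pcoord 0 5 * pcoord 1 3) + pcoord 0 1 *
          (pcoord 0 2 + pcoord 3 5) + pcoord 0 5 * (pcoord 1 3 + pcoord 0 5)" (is "_ = ?r")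
      by (simp add: algebra_simps char2 two')
    moreover have "?r \<in> I" by (intro comb pl) simp_all
    ultimately show "pcoord 0 5 * pcoord 0 5 + pcoord 0 1 * pcoord 0 2 + pcoord 0 3 * pcoord 1 5 \<in>
        I" by (simp only:)
    have "(pcoord 1 5 * pcoord 2 3 + pcoord 0 4 * pcoord 0 5 + pcoord 0 2 * pcoord 1 2 ::
        (pluecker_index, 'k) mpoly)
      = (pcoord 1 2 * pcoord 3 5 - pcoord 1 3 * pcoord 2 5 + pcoord 1 5 * pcoord 2 3) + pcoord 1 2 *
          (pcoord 0 2 + pcoord 3 5) + pcoord 2 5 * (pcoord 1 3 + pcoord 0 5) + pcoord 0 5 * (pcoord
          0 4 - pcoord 2 5)" (is "_ = ?r")
      by (simp add: algebra_simps char2 two')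
    moreover have "?r \<in> I" by (intro comb pl) simp_all
    ultimately show "pcoord 1 5 * pcoord 2 3 + pcoord 0 4 * pcoord 0 5 + pcoord 0 2 * pcoord 1 2 \<in>
        I" by (simp only:)
    have "(pcoord 0 5 * pcoord 1 2 + pcoord 0 1 * pcoord 0 4 + pcoord 0 2 * pcoord 1 5 ::
        (pluecker_index, 'k) mpoly)
      = (pcoord 0 1 * pcoord 2 5 - pcoord 0 2 * pcoord 1 5 + pcoord 0 5 * pcoord 1 2) + pcoord 0 1 *
          (pcoord 0 4 - pcoord 2 5)" (is "_ = ?r")
      by (simp add: algebra_simps char2 two')
    moreover have "?r \<in> I" by (intro comb pl) simp_all
    ultimately show "pcoord 0 5 * pcoord 1 2 + pcoord 0 1 * pcoord 0 4 + pcoord 0 2 * pcoord 1 5 \<in>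
        I" by (simp only:)
  qed
qed

lemma pluecker_quadruples:
  "\<lbrakk>i < j; j < k; k < l; l \<le> (5::nat)\<rbrakk> \<Longrightarrow> (i, j, k, l) \<in> {(0, 1, 2, 3), (0, 1, 2, 4), (0, 1, 2, 5),
      (0, 1, 3, 4), (0, 1, 3, 5), (0, 1, 4, 5), (0, 2, 3, 4), (0, 2, 3, 5), (0, 2, 4, 5), (0, 3, 4,
      5), (1, 2, 3, 4), (1, 2, 3, 5), (1, 2, 4, 5), (1, 3, 4, 5), (2, 3, 4, 5)}"
  by (simp, presburger)

text \<open>The linear equations hold by the shape of \<open>pvec\<close>, so a parametrised curve
  is checked by fifteen polynomial identities in t modulo 2.\<close>

lemma pvec_cone:
  fixes w :: "'k::field"
  assumes two: "(2 :: 'k) = 0" and nonzero: "(w, a, b, c, d, e, p, q, r, f) \<noteq> (0, 0, 0, 0, 0, 0, 0,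
      0, 0, 0)"
    and eqs: "w * w + a * b + c * e = 0" "e * q + d * w + b * p = 0" "w * p + a * d + b * e = 0" "a
        * a + b * c + d * p = 0" "p * r + w * a + c * q = 0" "a * q + b * w + c * p = 0" "b * b + c
        * d + w * q = 0" "q * f + a * b + d * r = 0" "b * r + c * a + d * q = 0" "c * c + d * w + a
        * r = 0" "r * e + b * c + w * f = 0" "c * f + d * b + w * r = 0" "d * d + w * a + b * f = 0"
        "f * p + c * d + a * e = 0" "d * e + w * c + a * f = 0"
  shows "pvec w a b c d e p q r f \<in> homogeneous_equations.cone (v14_eqs :: (pluecker_index, 'k)
      mpoly set)"
proof -
  interpret homogeneous_equations "v14_eqs :: (pluecker_index, 'k) mpoly set" by (rule
      v14_homogeneous)
  note char2 = char2_simps[OF two]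
  let ?x = "pvec w a b c d e p q r f"
  note ev = eval_pvec[where h = "\<lambda>c. c"]
  have "\<exists>i j. i < j \<and> j \<le> 5 \<and> ?x (Abs_pluecker_index (i, j)) \<noteq> 0"
  proof (rule ccontr)
    assume "\<not> ?thesis"
    then have "?x (Abs_pluecker_index (i, j)) = 0" if "i < j" "j \<le> 5" for i j
      using that by blast
    from this[of 0 1] this[of 0 2] this[of 0 3] this[of 0 4] this[of 0 5] this[of 1 2] this[of 2 3]
        this[of 3 4] this[of 4 5] this[of 1 5] nonzero show False
      by (simp add: pvec_Abs numeral_eq_Suc)
  qed
  then have "\<exists>v. ?x v \<noteq> 0" by blast
  moreover have "eval_at ?x g = 0" if g: "g \<in> v14_eqs" for g
  proof -
    from g consider i j k l where "i < j" "j < k" "k < l" "l \<le> 5"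
        "g = pcoord i j * pcoord k l - pcoord i k * pcoord j l + pcoord i l * pcoord j k"
      | "g \<in> {pcoord 0 3 - pcoord 1 4, pcoord 0 4 - pcoord 2 5, pcoord 1 3 + pcoord 0 5,
          pcoord 0 1 + pcoord 2 4, pcoord 0 2 + pcoord 3 5}"
      unfolding v14_eqs_def by blast
    then show ?thesis
    proof cases
      case 1
      show ?thesis
        using pluecker_quadruples[OF 1(1-4)] eqs unfolding 1(5)
        by simp (elim disjE, simp_all add: eval_at_simps ev numeral_eq_Suc char2 ac_simps)
    next
      case 2
      then show ?thesis
        by (elim insertE emptyE) (simp_all add: eval_at_simps ev numeral_eq_Suc char2)
    qed
  qed
  ultimately show ?thesis by (simp add: cone_def)
qed

section \<open>Five curves and a certificate of inconsistency over F_2\<close>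

section \<open>The inconsistent linear system\<close>

lemma pvec_all:
  assumes "Q w" "Q a" "Q b" "Q c" "Q d" "Q e" "Q p" "Q q" "Q r" "Q f"
  shows "Q (pvec w a b c d e p q r f z)"
proof (cases z)
  case (Abs_pluecker_index y)
  then obtain i j where y: "y = (i, j)" "i < j" "j \<le> 5" by auto
  then show ?thesis
    unfolding Abs_pluecker_index y using pluecker_pairs[OF y(2,3)] assms
    by (simp add: pvec_Abs) (elim disjE, simp_all add: numeral_eq_Suc)
qed

text \<open>A meeting point at parameter 1 thereby gives a linear equation in the coefficients, as
  do the parameters 0 and infinity, which pick out a single one.\<close>

lemma poly_at_1: "(\<And>i. n < i \<Longrightarrow> coeff P i = 0) \<Longrightarrow> poly P 1 = (\<Sum>i\<le>n. coeff P i)"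
  for P :: "'a::comm_ring_1 poly"
  by (subst poly_as_sum_of_monoms'[of P n, symmetric])
    (auto simp: poly_sum poly_monom intro: degree_le)

text \<open>
  The curves \<open>x0\<close> to \<open>x4\<close>, the relations and the linear combination of their coefficients were found
      by
  a computer search; \<open>nk_P\<close> is the value on curve \<open>xk\<close> at the point whose nonzero coordinates are the
  letters of \<open>P\<close>.  In the final sum every coefficient occurs twice, and the only surviving term is
      \<open>1\<close>.
\<close>

theorem v14_not_F_split:
  assumes two: "(2 :: 'k::alg_closed_field) = 0"
  shows "\<not> F_split 2 (closed_subscheme (v14_eqs :: (pluecker_index, 'k) mpoly set))"
proof
  let ?E = "v14_eqs :: (pluecker_index, 'k) mpoly set"
  assume "F_split 2 (closed_subscheme ?E)"
  then obtain tr where tr: "homogeneous_equations.frobenius_trace ?E 2 tr"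
    using homogeneous_equations.F_split_frobenius_trace[OF v14_homogeneous] by blast
  interpret homogeneous_equations ?E by (rule v14_homogeneous)
  note char2 = char2_simps[OF two]
  have zero_plus: "x = 0 \<Longrightarrow> y = 0 \<Longrightarrow> x + y = 0" for x y :: 'k by simp
  \<comment> \<open>Two curves through one point give the same value there; in characteristic 2 this
    reads as a vanishing sum, ready to be added to the other equations.\<close>
  have glue: "x = y \<Longrightarrow> x = z \<Longrightarrow> y + z = 0" for x y z :: 'k
    by (simp add: char2)
  have "(3 :: 'k) = 2 + 1" "(4 :: 'k) = 2 + 2" "(5 :: 'k) = 2 + 2 + 1" by simp_all
  then have num: "(3 :: 'k) = 1" "(4 :: 'k) = 0" "(5 :: 'k) = 1"
    by (simp_all only: two add_0)

  define w :: "(pluecker_index, 'k) mpoly" where "w = pcoord 0 1"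
  define a :: "(pluecker_index, 'k) mpoly" where "a = pcoord 0 2"
  define b :: "(pluecker_index, 'k) mpoly" where "b = pcoord 0 3"
  define c :: "(pluecker_index, 'k) mpoly" where "c = pcoord 0 4"
  define d :: "(pluecker_index, 'k) mpoly" where "d = pcoord 0 5"
  define e :: "(pluecker_index, 'k) mpoly" where "e = pcoord 1 2"
  define p :: "(pluecker_index, 'k) mpoly" where "p = pcoord 2 3"
  define q :: "(pluecker_index, 'k) mpoly" where "q = pcoord 3 4"
  define r :: "(pluecker_index, 'k) mpoly" where "r = pcoord 4 5"
  define f :: "(pluecker_index, 'k) mpoly" where "f = pcoord 1 5"
  note letters = w_def a_def b_def c_def d_def e_def p_def q_def r_def f_def
  interpret pl: pluecker_relations I w a b c d e p q r f
    using v14_relations[OF two] unfolding letters .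
  have hp1: "w \<in> homogeneous_polys 1" "a \<in> homogeneous_polys 1" "b \<in> homogeneous_polys 1" "c \<in>
      homogeneous_polys 1" "d \<in> homogeneous_polys 1" "e \<in> homogeneous_polys 1" "p \<in>
      homogeneous_polys 1" "q \<in> homogeneous_polys 1" "r \<in> homogeneous_polys 1" "f \<in>
      homogeneous_polys 1"
    unfolding letters by (rule hp_pcoord)+
  have hp2: "a * b \<in> homogeneous_polys 2" "a * c \<in> homogeneous_polys 2" "a * e \<in> homogeneous_polys
      2" "a * f \<in> homogeneous_polys 2" "a * p \<in> homogeneous_polys 2" "a * q \<in> homogeneous_polys 2"
      "a * r \<in> homogeneous_polys 2" "b * b \<in> homogeneous_polys 2" "b * c \<in> homogeneous_polys 2" "b *
      d \<in> homogeneous_polys 2" "b * e \<in> homogeneous_polys 2" "b * f \<in> homogeneous_polys 2" "b * p \<in>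
      homogeneous_polys 2" "b * q \<in> homogeneous_polys 2" "b * r \<in> homogeneous_polys 2" "c * c \<in>
      homogeneous_polys 2" "c * p \<in> homogeneous_polys 2" "c * q \<in> homogeneous_polys 2" "d * f \<in>
      homogeneous_polys 2" "d * p \<in> homogeneous_polys 2" "d * q \<in> homogeneous_polys 2" "e * p \<in>
      homogeneous_polys 2" "f * f \<in> homogeneous_polys 2" "p * f \<in> homogeneous_polys 2" "p * q \<in>
      homogeneous_polys 2" "q * q \<in> homogeneous_polys 2" "q * r \<in> homogeneous_polys 2" "r * f \<in>
      homogeneous_polys 2" "w * a \<in> homogeneous_polys 2" "w * b \<in> homogeneous_polys 2" "w * c \<in>
      homogeneous_polys 2" "w * d \<in> homogeneous_polys 2" "w * e \<in> homogeneous_polys 2" "w * f \<in>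
      homogeneous_polys 2" "w * p \<in> homogeneous_polys 2" "w * q \<in> homogeneous_polys 2" "w * r \<in>
      homogeneous_polys 2"
    unfolding letters by (rule hp_pcoord_mult)+
  \<comment> \<open>The line through the coordinate points e and p. It meets \<open>x1\<close> at t
    = 0, \<open>x3\<close> at t = 1, and both \<open>x2\<close> and \<open>x4\<close> at
    infinity.\<close>
  define x0 :: "pluecker_index \<Rightarrow> 'k poly" where "x0 = pvec 0 0 0 0 0 [:1:] [:0, 1:] 0 0 0"
  have "curve 1 x0"
    unfolding curve_def
  proof (intro conjI allI)
    show "degree (x0 v) \<le> 1" for v
      unfolding x0_def by (rule pvec_all) (simp_all add: degree_pCons_eq_if)
    show "(\<lambda>v. poly (x0 v) t) \<in> cone" for t
      unfolding x0_def pvec_hom[of "\<lambda>g. poly g t"]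
      by (rule pvec_cone[OF two]) (auto simp: algebra_simps char2 two)
    show "(\<lambda>v. coeff (x0 v) 1) \<in> cone"
      unfolding x0_def pvec_hom[of "\<lambda>g. coeff g 1"]
      by (rule pvec_cone[OF two]) (simp_all add: numeral_eq_Suc char2 two)
  qed
  from trace_on_curve[OF v14_homogeneous tr this] obtain T0 :: "(pluecker_index, 'k) mpoly \<Rightarrow> 'k
      poly" where
    T0_deg: "\<And>m i. 1 < i \<Longrightarrow> coeff (T0 m) i = 0" and
    T0_val: "\<And>m t. m \<in> homogeneous_polys 2 \<Longrightarrow> tr m (\<lambda>v. poly (x0 v) t) = poly (T0 m) t" and
    T0_inf: "\<And>m. m \<in> homogeneous_polys 2 \<Longrightarrow> tr m (\<lambda>v. coeff (x0 v) 1) = coeff (T0 m) 1" and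
    T0_rel: "\<And>L. \<lbrakk>set L \<subseteq> homogeneous_polys 1 \<times> homogeneous_polys 2;
       (\<Sum>(u, m)\<leftarrow>L. u ^ 2 * m) \<in> I\<rbrakk> \<Longrightarrow> (\<Sum>(u, m)\<leftarrow>L. eval_poly x0 u * T0 m) = 0" and
    T0_sq: "\<And>u. u \<in> homogeneous_polys 1 \<Longrightarrow> T0 (u ^ 2) = eval_poly x0 u"
    by blast
  have ev0: "eval_poly x0 w = 0" "eval_poly x0 a = 0" "eval_poly x0 b = 0" "eval_poly x0 c = 0"
      "eval_poly x0 d = 0" "eval_poly x0 e = [:1:]" "eval_poly x0 p = [:0, 1:]" "eval_poly x0 q = 0"
      "eval_poly x0 r = 0" "eval_poly x0 f = 0"
    unfolding letters x0_def by (simp_all add: eval_pvec[where h = "\<lambda>c. [:c:]"] numeral_eq_Suc)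
  have n0_e: "tr m (pvec 0 0 0 0 0 1 0 0 0 0) = coeff (T0 m) 0" if "m \<in> homogeneous_polys 2" for m
    using T0_val[OF that, of 0] unfolding x0_def pvec_hom[of "\<lambda>g. poly g 0"]
    by (simp add: poly_0_coeff_0)
  have n0_ep: "tr m (pvec 0 0 0 0 0 1 1 0 0 0) = coeff (T0 m) 0 + coeff (T0 m) 1" if "m \<in>
      homogeneous_polys 2" for m
    using T0_val[OF that, of 1] poly_at_1[of 1 "T0 m", OF T0_deg]
    unfolding x0_def pvec_hom[of "\<lambda>g. poly g 1"]
    by (simp add: char2 two num numeral_eq_Suc)
  have n0_p: "tr m (pvec 0 0 0 0 0 0 1 0 0 0) = coeff (T0 m) 1" if "m \<in> homogeneous_polys 2" for m
    using T0_inf[OF that] unfolding x0_def pvec_hom[of "\<lambda>g. coeff g 1"]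
    by (simp add: numeral_eq_Suc)
  \<comment> \<open>The line through the coordinate points e and f, meeting \<open>x0\<close> at t =
    0 and \<open>x3\<close> at infinity.\<close>
  define x1 :: "pluecker_index \<Rightarrow> 'k poly" where "x1 = pvec 0 0 0 0 0 [:1:] 0 0 0 [:0, 1:]"
  have "curve 1 x1"
    unfolding curve_def
  proof (intro conjI allI)
    show "degree (x1 v) \<le> 1" for v
      unfolding x1_def by (rule pvec_all) (simp_all add: degree_pCons_eq_if)
    show "(\<lambda>v. poly (x1 v) t) \<in> cone" for t
      unfolding x1_def pvec_hom[of "\<lambda>g. poly g t"]
      by (rule pvec_cone[OF two]) (auto simp: algebra_simps char2 two)
    show "(\<lambda>v. coeff (x1 v) 1) \<in> cone"
      unfolding x1_def pvec_hom[of "\<lambda>g. coeff g 1"]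
      by (rule pvec_cone[OF two]) (simp_all add: numeral_eq_Suc char2 two)
  qed
  from trace_on_curve[OF v14_homogeneous tr this] obtain T1 :: "(pluecker_index, 'k) mpoly \<Rightarrow> 'k
      poly" where
    T1_deg: "\<And>m i. 1 < i \<Longrightarrow> coeff (T1 m) i = 0" and
    T1_val: "\<And>m t. m \<in> homogeneous_polys 2 \<Longrightarrow> tr m (\<lambda>v. poly (x1 v) t) = poly (T1 m) t" and
    T1_inf: "\<And>m. m \<in> homogeneous_polys 2 \<Longrightarrow> tr m (\<lambda>v. coeff (x1 v) 1) = coeff (T1 m) 1" and
    T1_rel: "\<And>L. \<lbrakk>set L \<subseteq> homogeneous_polys 1 \<times> homogeneous_polys 2;
       (\<Sum>(u, m)\<leftarrow>L. u ^ 2 * m) \<in> I\<rbrakk> \<Longrightarrow> (\<Sum>(u, m)\<leftarrow>L. eval_poly x1 u * T1 m) = 0" and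
    T1_sq: "\<And>u. u \<in> homogeneous_polys 1 \<Longrightarrow> T1 (u ^ 2) = eval_poly x1 u"
    by blast
  have ev1: "eval_poly x1 w = 0" "eval_poly x1 a = 0" "eval_poly x1 b = 0" "eval_poly x1 c = 0"
      "eval_poly x1 d = 0" "eval_poly x1 e = [:1:]" "eval_poly x1 p = 0" "eval_poly x1 q = 0"
      "eval_poly x1 r = 0" "eval_poly x1 f = [:0, 1:]"
    unfolding letters x1_def by (simp_all add: eval_pvec[where h = "\<lambda>c. [:c:]"] numeral_eq_Suc)
  \<comment> \<open>The relation used on this curve contains the square f^2 as a factor
    \<open>m\<close>; its trace is known and introduces no unknowns.\<close>
  have sq1: "T1 (f * f) = [:0, 1:]"
    using T1_sq[OF hp1(10)] 
    by (simp_all add: power2_eq_square ev1)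
  have n1_e: "tr m (pvec 0 0 0 0 0 1 0 0 0 0) = coeff (T1 m) 0" if "m \<in> homogeneous_polys 2" for m
    using T1_val[OF that, of 0] unfolding x1_def pvec_hom[of "\<lambda>g. poly g 0"]
    by (simp add: poly_0_coeff_0)
  have n1_f: "tr m (pvec 0 0 0 0 0 0 0 0 0 1) = coeff (T1 m) 1" if "m \<in> homogeneous_polys 2" for m
    using T1_inf[OF that] unfolding x1_def pvec_hom[of "\<lambda>g. coeff g 1"]
    by (simp add: numeral_eq_Suc)
  \<comment> \<open>A twisted cubic through the point p at t = 0; at t = 1 it meets the quartic
    \<open>x4\<close>, which is there at infinity.\<close>
  define x2 :: "pluecker_index \<Rightarrow> 'k poly" where "x2 = pvec 0 [:0, 1:] [:0, 0, 1:] [:0, 0, 1:] [:0,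
      0, 1:] [:0, 1:] [:1, 0, 1:] [:0, 1, 0, 1:] [:0, 0, 0, 1:] [:0, 0, 1:]"
  have "curve 3 x2"
    unfolding curve_def
  proof (intro conjI allI)
    show "degree (x2 v) \<le> 3" for v
      unfolding x2_def by (rule pvec_all) (simp_all add: degree_pCons_eq_if)
    show "(\<lambda>v. poly (x2 v) t) \<in> cone" for t
      unfolding x2_def pvec_hom[of "\<lambda>g. poly g t"]
      by (rule pvec_cone[OF two]) (auto simp: algebra_simps char2 two)
    show "(\<lambda>v. coeff (x2 v) 3) \<in> cone"
      unfolding x2_def pvec_hom[of "\<lambda>g. coeff g 3"]
      by (rule pvec_cone[OF two]) (simp_all add: numeral_eq_Suc char2 two)
  qed
  from trace_on_curve[OF v14_homogeneous tr this] obtain T2 :: "(pluecker_index, 'k) mpoly \<Rightarrow> 'k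
      poly" where
    T2_deg: "\<And>m i. 3 < i \<Longrightarrow> coeff (T2 m) i = 0" and
    T2_val: "\<And>m t. m \<in> homogeneous_polys 2 \<Longrightarrow> tr m (\<lambda>v. poly (x2 v) t) = poly (T2 m) t" and
    T2_inf: "\<And>m. m \<in> homogeneous_polys 2 \<Longrightarrow> tr m (\<lambda>v. coeff (x2 v) 3) = coeff (T2 m) 3" and
    T2_rel: "\<And>L. \<lbrakk>set L \<subseteq> homogeneous_polys 1 \<times> homogeneous_polys 2;
       (\<Sum>(u, m)\<leftarrow>L. u ^ 2 * m) \<in> I\<rbrakk> \<Longrightarrow> (\<Sum>(u, m)\<leftarrow>L. eval_poly x2 u * T2 m) = 0" and
    T2_sq: "\<And>u. u \<in> homogeneous_polys 1 \<Longrightarrow> T2 (u ^ 2) = eval_poly x2 u"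
    by blast
  have ev2: "eval_poly x2 w = 0" "eval_poly x2 a = [:0, 1:]" "eval_poly x2 b = [:0, 0, 1:]"
      "eval_poly x2 c = [:0, 0, 1:]" "eval_poly x2 d = [:0, 0, 1:]" "eval_poly x2 e = [:0, 1:]"
      "eval_poly x2 p = [:1, 0, 1:]" "eval_poly x2 q = [:0, 1, 0, 1:]" "eval_poly x2 r = [:0, 0, 0,
      1:]" "eval_poly x2 f = [:0, 0, 1:]"
    unfolding letters x2_def by (simp_all add: eval_pvec[where h = "\<lambda>c. [:c:]"] numeral_eq_Suc)
  have sq2: "T2 (b * b) = [:0, 0, 1:]"
    using T2_sq[OF hp1(3)] 
    by (simp_all add: power2_eq_square ev2)
  have n2_abcderf: "tr m (pvec 0 1 1 1 1 1 0 0 1 1) = coeff (T2 m) 0 + coeff (T2 m) 1 + coeff (T2 m)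
      2 + coeff (T2 m) 3" if "m \<in> homogeneous_polys 2" for m
    using T2_val[OF that, of 1] poly_at_1[of 3 "T2 m", OF T2_deg]
    unfolding x2_def pvec_hom[of "\<lambda>g. poly g 1"]
    by (simp add: char2 two num numeral_eq_Suc)
  have n2_p: "tr m (pvec 0 0 0 0 0 0 1 0 0 0) = coeff (T2 m) 0" if "m \<in> homogeneous_polys 2" for m
    using T2_val[OF that, of 0] unfolding x2_def pvec_hom[of "\<lambda>g. poly g 0"]
    by (simp add: poly_0_coeff_0)
  \<comment> \<open>A twisted cubic meeting \<open>x0\<close> at t = 0, \<open>x1\<close> at
    infinity and the quartic \<open>x4\<close> at t = 1.\<close>
  define x3 :: "pluecker_index \<Rightarrow> 'k poly" where "x3 = pvec [:0, 1:] [:0, 1:] [:0, 1:] 0 [:0, 0, 1:]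
      [:1, 0, 1:] [:1:] [:0, 1:] [:0, 0, 1:] [:0, 1, 0, 1:]"
  have "curve 3 x3"
    unfolding curve_def
  proof (intro conjI allI)
    show "degree (x3 v) \<le> 3" for v
      unfolding x3_def by (rule pvec_all) (simp_all add: degree_pCons_eq_if)
    show "(\<lambda>v. poly (x3 v) t) \<in> cone" for t
      unfolding x3_def pvec_hom[of "\<lambda>g. poly g t"]
      by (rule pvec_cone[OF two]) (auto simp: algebra_simps char2 two)
    show "(\<lambda>v. coeff (x3 v) 3) \<in> cone"
      unfolding x3_def pvec_hom[of "\<lambda>g. coeff g 3"]
      by (rule pvec_cone[OF two]) (simp_all add: numeral_eq_Suc char2 two)
  qed
  from trace_on_curve[OF v14_homogeneous tr this] obtain T3 :: "(pluecker_index, 'k) mpoly \<Rightarrow> 'k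
      poly" where
    T3_deg: "\<And>m i. 3 < i \<Longrightarrow> coeff (T3 m) i = 0" and
    T3_val: "\<And>m t. m \<in> homogeneous_polys 2 \<Longrightarrow> tr m (\<lambda>v. poly (x3 v) t) = poly (T3 m) t" and
    T3_inf: "\<And>m. m \<in> homogeneous_polys 2 \<Longrightarrow> tr m (\<lambda>v. coeff (x3 v) 3) = coeff (T3 m) 3" and
    T3_rel: "\<And>L. \<lbrakk>set L \<subseteq> homogeneous_polys 1 \<times> homogeneous_polys 2;
       (\<Sum>(u, m)\<leftarrow>L. u ^ 2 * m) \<in> I\<rbrakk> \<Longrightarrow> (\<Sum>(u, m)\<leftarrow>L. eval_poly x3 u * T3 m) = 0" and
    T3_sq: "\<And>u. u \<in> homogeneous_polys 1 \<Longrightarrow> T3 (u ^ 2) = eval_poly x3 u"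
    by blast
  have ev3: "eval_poly x3 w = [:0, 1:]" "eval_poly x3 a = [:0, 1:]" "eval_poly x3 b = [:0, 1:]"
      "eval_poly x3 c = 0" "eval_poly x3 d = [:0, 0, 1:]" "eval_poly x3 e = [:1, 0, 1:]" "eval_poly
      x3 p = [:1:]" "eval_poly x3 q = [:0, 1:]" "eval_poly x3 r = [:0, 0, 1:]" "eval_poly x3 f =
      [:0, 1, 0, 1:]"
    unfolding letters x3_def by (simp_all add: eval_pvec[where h = "\<lambda>c. [:c:]"] numeral_eq_Suc)
  have sq3: "T3 (b * b) = [:0, 1:]"
    using T3_sq[OF hp1(3)] 
    by (simp_all add: power2_eq_square ev3)
  have n3_ep: "tr m (pvec 0 0 0 0 0 1 1 0 0 0) = coeff (T3 m) 0" if "m \<in> homogeneous_polys 2" for m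
    using T3_val[OF that, of 0] unfolding x3_def pvec_hom[of "\<lambda>g. poly g 0"]
    by (simp add: poly_0_coeff_0)
  have n3_f: "tr m (pvec 0 0 0 0 0 0 0 0 0 1) = coeff (T3 m) 3" if "m \<in> homogeneous_polys 2" for m
    using T3_inf[OF that] unfolding x3_def pvec_hom[of "\<lambda>g. coeff g 3"]
    by (simp add: numeral_eq_Suc)
  have n3_wabdpqr: "tr m (pvec 1 1 1 0 1 0 1 1 1 0) = coeff (T3 m) 0 + coeff (T3 m) 1 + coeff (T3 m)
      2 + coeff (T3 m) 3" if "m \<in> homogeneous_polys 2" for m
    using T3_val[OF that, of 1] poly_at_1[of 3 "T3 m", OF T3_deg]
    unfolding x3_def pvec_hom[of "\<lambda>g. poly g 1"]
    by (simp add: char2 two num numeral_eq_Suc)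
  \<comment> \<open>The quartic. It meets \<open>x0\<close> and \<open>x2\<close> at t = 0,
    \<open>x3\<close> at t = 1, and \<open>x2\<close> again at infinity.\<close>
  define x4 :: "pluecker_index \<Rightarrow> 'k poly" where "x4 = pvec [:0, 0, 0, 1:] [:0, 1, 0, 1, 1:] [:0, 0,
      0, 0, 1:] [:0, 0, 0, 1, 1:] [:0, 0, 1, 1, 1:] [:0, 0, 1, 0, 1:] [:1, 1, 0, 1:] [:0, 0, 1:]
      [:0, 0, 0, 0, 1:] [:0, 0, 0, 1, 1:]"
  have "curve 4 x4"
    unfolding curve_def
  proof (intro conjI allI)
    show "degree (x4 v) \<le> 4" for v
      unfolding x4_def by (rule pvec_all) (simp_all add: degree_pCons_eq_if)
    show "(\<lambda>v. poly (x4 v) t) \<in> cone" for t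
      unfolding x4_def pvec_hom[of "\<lambda>g. poly g t"]
      by (rule pvec_cone[OF two]) (auto simp: algebra_simps char2 two)
    show "(\<lambda>v. coeff (x4 v) 4) \<in> cone"
      unfolding x4_def pvec_hom[of "\<lambda>g. coeff g 4"]
      by (rule pvec_cone[OF two]) (simp_all add: numeral_eq_Suc char2 two)
  qed
  from trace_on_curve[OF v14_homogeneous tr this] obtain T4 :: "(pluecker_index, 'k) mpoly \<Rightarrow> 'k
      poly" where
    T4_deg: "\<And>m i. 4 < i \<Longrightarrow> coeff (T4 m) i = 0" and
    T4_val: "\<And>m t. m \<in> homogeneous_polys 2 \<Longrightarrow> tr m (\<lambda>v. poly (x4 v) t) = poly (T4 m) t" and
    T4_inf: "\<And>m. m \<in> homogeneous_polys 2 \<Longrightarrow> tr m (\<lambda>v. coeff (x4 v) 4) = coeff (T4 m) 4" and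
    T4_rel: "\<And>L. \<lbrakk>set L \<subseteq> homogeneous_polys 1 \<times> homogeneous_polys 2;
       (\<Sum>(u, m)\<leftarrow>L. u ^ 2 * m) \<in> I\<rbrakk> \<Longrightarrow> (\<Sum>(u, m)\<leftarrow>L. eval_poly x4 u * T4 m) = 0" and
    T4_sq: "\<And>u. u \<in> homogeneous_polys 1 \<Longrightarrow> T4 (u ^ 2) = eval_poly x4 u"
    by blast
  have ev4: "eval_poly x4 w = [:0, 0, 0, 1:]" "eval_poly x4 a = [:0, 1, 0, 1, 1:]" "eval_poly x4 b =
      [:0, 0, 0, 0, 1:]" "eval_poly x4 c = [:0, 0, 0, 1, 1:]" "eval_poly x4 d = [:0, 0, 1, 1, 1:]"
      "eval_poly x4 e = [:0, 0, 1, 0, 1:]" "eval_poly x4 p = [:1, 1, 0, 1:]" "eval_poly x4 q = [:0,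
      0, 1:]" "eval_poly x4 r = [:0, 0, 0, 0, 1:]" "eval_poly x4 f = [:0, 0, 0, 1, 1:]"
    unfolding letters x4_def by (simp_all add: eval_pvec[where h = "\<lambda>c. [:c:]"] numeral_eq_Suc)
  have sq4: "T4 (b * b) = [:0, 0, 0, 0, 1:]" "T4 (c * c) = [:0, 0, 0, 1, 1:]" "T4 (q * q) = [:0, 0,
      1:]"
    using T4_sq[OF hp1(3)] T4_sq[OF hp1(4)] T4_sq[OF hp1(8)]
    by (simp_all add: power2_eq_square ev4)
  have n4_abcderf: "tr m (pvec 0 1 1 1 1 1 0 0 1 1) = coeff (T4 m) 4" if "m \<in> homogeneous_polys 2"
      for m
    using T4_inf[OF that] unfolding x4_def pvec_hom[of "\<lambda>g. coeff g 4"]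
    by (simp add: numeral_eq_Suc)
  have n4_p: "tr m (pvec 0 0 0 0 0 0 1 0 0 0) = coeff (T4 m) 0" if "m \<in> homogeneous_polys 2" for m
    using T4_val[OF that, of 0] unfolding x4_def pvec_hom[of "\<lambda>g. poly g 0"]
    by (simp add: poly_0_coeff_0)
  have n4_wabdpqr: "tr m (pvec 1 1 1 0 1 0 1 1 1 0) = coeff (T4 m) 0 + coeff (T4 m) 1 + coeff (T4 m)
      2 + coeff (T4 m) 3 + coeff (T4 m) 4" if "m \<in> homogeneous_polys 2" for m
    using T4_val[OF that, of 1] poly_at_1[of 4 "T4 m", OF T4_deg]
    unfolding x4_def pvec_hom[of "\<lambda>g. poly g 1"]
    by (simp add: char2 two num numeral_eq_Suc)
  \<comment> \<open>Each relation restricted to a curve is an identity in k[t]; the one coefficient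
    that enters the certificate is extracted from it.\<close>
  have "eval_poly x0 d * T0 (a * c) + eval_poly x0 e * T0 (a * b) + eval_poly x0 p * T0 (w * f) +
      eval_poly x0 d * T0 (e * p) = 0"
    using T0_rel[of "[(d, a * c), (e, a * b), (p, w * f), (d, e * p)]"] pl.rel1 by (simp add:
        hp1[simplified] hp2 power2_eq_square add.assoc)
  from arg_cong[OF this, of "\<lambda>g. coeff g 1"]
  have r0: "coeff (T0 (a * b)) 1 + coeff (T0 (w * f)) 0 = 0"
    by (simp add: ev0  T0_deg coeff_pCons numeral_eq_Suc char2 ac_simps)
  have "eval_poly x0 w * T0 (e * p) + eval_poly x0 a * T0 (d * p) + eval_poly x0 p * T0 (w * a) +
      eval_poly x0 e * T0 (c * p) = 0"
    using T0_rel[of "[(w, e * p), (a, d * p), (p, w * a), (e, c * p)]"] pl.rel2 by (simp add: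
        hp1[simplified] hp2 power2_eq_square add.assoc)
  from arg_cong[OF this, of "\<lambda>g. coeff g 0"]
  have r1: "coeff (T0 (c * p)) 0 = 0"
    by (simp add: ev0  T0_deg coeff_pCons numeral_eq_Suc char2 ac_simps)
  have "eval_poly x1 e * T1 (r * f) + eval_poly x1 w * T1 (b * f) + eval_poly x1 b * T1 (a * f) +
      eval_poly x1 f * T1 (w * e) = 0"
    using T1_rel[of "[(e, r * f), (w, b * f), (b, a * f), (f, w * e)]"] pl.rel3 by (simp add:
        hp1[simplified] hp2 power2_eq_square add.assoc)
  from arg_cong[OF this, of "\<lambda>g. coeff g 1"]
  have r2: "coeff (T1 (r * f)) 1 + coeff (T1 (w * e)) 0 = 0"
    by (simp add: ev1  T1_deg coeff_pCons numeral_eq_Suc char2 ac_simps)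
  have "eval_poly x1 b * T1 (f * f) + eval_poly x1 w * T1 (w * f) + eval_poly x1 e * T1 (d * f) +
      eval_poly x1 r * T1 (a * f) + eval_poly x1 c * T1 (r * f) + eval_poly x1 f * T1 (p * f) = 0"
    using T1_rel[of "[(b, f * f), (w, w * f), (e, d * f), (r, a * f), (c, r * f), (f, p * f)]"]
        pl.rel4 by (simp add: hp1[simplified] hp2 power2_eq_square add.assoc)
  from arg_cong[OF this, of "\<lambda>g. coeff g 1"]
  have r3: "coeff (T1 (p * f)) 0 + coeff (T1 (d * f)) 1 = 0"
    by (simp add: ev1 sq1 T1_deg coeff_pCons numeral_eq_Suc char2 ac_simps)
  have "eval_poly x2 d * T2 (p * f) + eval_poly x2 p * T2 (b * e) + eval_poly x2 e * T2 (p * q) +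
      eval_poly x2 w * T2 (c * p) + eval_poly x2 f * T2 (b * p) = 0"
    using T2_rel[of "[(d, p * f), (p, b * e), (e, p * q), (w, c * p), (f, b * p)]"] pl.rel5 by (simp
        add: hp1[simplified] hp2 power2_eq_square add.assoc)
  from arg_cong[OF this, of "\<lambda>g. coeff g 1"]
  have r4: "coeff (T2 (b * e)) 1 + coeff (T2 (p * q)) 0 = 0"
    by (simp add: ev2  T2_deg coeff_pCons numeral_eq_Suc char2 ac_simps)
  have "eval_poly x2 e * T2 (d * q) + eval_poly x2 d * T2 (w * e) + eval_poly x2 d * T2 (a * p) +
      eval_poly x2 p * T2 (w * d) = 0"
    using T2_rel[of "[(e, d * q), (d, w * e), (d, a * p), (p, w * d)]"] pl.rel6 by (simp add:
        hp1[simplified] hp2 power2_eq_square add.assoc)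
  from arg_cong[OF this, of "\<lambda>g. coeff g 1"]
  have r5: "coeff (T2 (w * d)) 1 + coeff (T2 (d * q)) 0 = 0"
    by (simp add: ev2  T2_deg coeff_pCons numeral_eq_Suc char2 ac_simps)
  have "eval_poly x2 d * T2 (a * p) + eval_poly x2 a * T2 (b * e) + eval_poly x2 w * T2 (b * b) +
      eval_poly x2 b * T2 (a * b) + eval_poly x2 p * T2 (w * d) = 0"
    using T2_rel[of "[(d, a * p), (a, b * e), (w, b * b), (b, a * b), (p, w * d)]"] pl.rel7 by (simp
        add: hp1[simplified] hp2 power2_eq_square add.assoc)
  from arg_cong[OF this, of "\<lambda>g. coeff g 2"]
  have r6: "coeff (T2 (a * b)) 0 + coeff (T2 (w * d)) 0 + coeff (T2 (w * d)) 2 + coeff (T2 (b * e))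
      1 + coeff (T2 (a * p)) 0 = 0"
    by (simp add: ev2 sq2 T2_deg coeff_pCons numeral_eq_Suc char2 ac_simps)
  have "eval_poly x2 w * T2 (w * q) + eval_poly x2 e * T2 (d * q) + eval_poly x2 d * T2 (b * q) +
      eval_poly x2 f * T2 (p * q) + eval_poly x2 q * T2 (w * f) = 0"
    using T2_rel[of "[(w, w * q), (e, d * q), (d, b * q), (f, p * q), (q, w * f)]"] pl.rel8 by (simp
        add: hp1[simplified] hp2 power2_eq_square add.assoc)
  from arg_cong[OF this, of "\<lambda>g. coeff g 1"]
  have r7: "coeff (T2 (d * q)) 0 + coeff (T2 (w * f)) 0 = 0"
    by (simp add: ev2  T2_deg coeff_pCons numeral_eq_Suc char2 ac_simps)
  have "eval_poly x2 r * T2 (w * d) + eval_poly x2 a * T2 (w * c) + eval_poly x2 f * T2 (c * q) +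
      eval_poly x2 d * T2 (d * q) = 0"
    using T2_rel[of "[(r, w * d), (a, w * c), (f, c * q), (d, d * q)]"] pl.rel9 by (simp add:
        hp1[simplified] hp2 power2_eq_square add.assoc)
  \<comment> \<open>The exponent 6 is the largest possible. Only \<open>r\<close>, of degree 3 on
    this cubic, can reach it, which isolates one top coefficient by means of the degree
    bound.\<close>
  from arg_cong[OF this, of "\<lambda>g. coeff g 6"]
  have r8: "coeff (T2 (w * d)) 3 = 0"
    by (simp add: ev2  T2_deg coeff_pCons numeral_eq_Suc char2 ac_simps)
  have "eval_poly x3 a * T3 (p * f) + eval_poly x3 a * T3 (b * b) + eval_poly x3 c * T3 (b * d) +
      eval_poly x3 b * T3 (w * f) + eval_poly x3 d * T3 (w * b) + eval_poly x3 p * T3 (d * f) = 0"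
    using T3_rel[of "[(a, p * f), (a, b * b), (c, b * d), (b, w * f), (d, w * b), (p, d * f)]"]
        pl.rel10 by (simp add: hp1[simplified] hp2 power2_eq_square add.assoc)
  from arg_cong[OF this, of "\<lambda>g. coeff g 1"]
  have r9: "coeff (T3 (w * f)) 0 + coeff (T3 (p * f)) 0 + coeff (T3 (d * f)) 1 = 0"
    by (simp add: ev3 sq3 T3_deg coeff_pCons numeral_eq_Suc char2 ac_simps)
  have "eval_poly x3 e * T3 (b * d) + eval_poly x3 a * T3 (w * e) + eval_poly x3 a * T3 (d * f) +
      eval_poly x3 w * T3 (c * p) = 0"
    using T3_rel[of "[(e, b * d), (a, w * e), (a, d * f), (w, c * p)]"] pl.rel11 by (simp add:
        hp1[simplified] hp2 power2_eq_square add.assoc)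
  from arg_cong[OF this, of "\<lambda>g. coeff g 1"]
  have r10: "coeff (T3 (c * p)) 0 + coeff (T3 (b * d)) 1 + coeff (T3 (d * f)) 0 + coeff (T3 (w * e))
      0 = 0"
    by (simp add: ev3  T3_deg coeff_pCons numeral_eq_Suc char2 ac_simps)
  have "eval_poly x3 d * T3 (b * d) + eval_poly x3 b * T3 (d * f) + eval_poly x3 c * T3 (a * b) +
      eval_poly x3 a * T3 (b * r) = 0"
    using T3_rel[of "[(d, b * d), (b, d * f), (c, a * b), (a, b * r)]"] pl.rel12 by (simp add:
        hp1[simplified] hp2 power2_eq_square add.assoc)
  from arg_cong[OF this, of "\<lambda>g. coeff g 3"]
  have r11: "coeff (T3 (b * r)) 2 + coeff (T3 (b * d)) 1 + coeff (T3 (d * f)) 2 = 0"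
    by (simp add: ev3  T3_deg coeff_pCons numeral_eq_Suc char2 ac_simps)
  have "eval_poly x3 f * T3 (b * r) + eval_poly x3 c * T3 (w * f) + eval_poly x3 w * T3 (d * f) +
      eval_poly x3 d * T3 (r * f) = 0"
    using T3_rel[of "[(f, b * r), (c, w * f), (w, d * f), (d, r * f)]"] pl.rel13 by (simp add:
        hp1[simplified] hp2 power2_eq_square add.assoc)
  from arg_cong[OF this, of "\<lambda>g. coeff g 5"]
  have r12: "coeff (T3 (b * r)) 2 + coeff (T3 (r * f)) 3 = 0"
    by (simp add: ev3  T3_deg coeff_pCons numeral_eq_Suc char2 ac_simps)
  have "eval_poly x4 d * T4 (c * p) + eval_poly x4 p * T4 (d * f) + eval_poly x4 e * T4 (b * p) +
      eval_poly x4 p * T4 (w * e) = 0"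
    using T4_rel[of "[(d, c * p), (p, d * f), (e, b * p), (p, w * e)]"] pl.rel14 by (simp add:
        hp1[simplified] hp2 power2_eq_square add.assoc)
  from arg_cong[OF this, of "\<lambda>g. coeff g 0"]
  have r13: "coeff (T4 (d * f)) 0 + coeff (T4 (w * e)) 0 = 0"
    by (simp add: ev4  T4_deg coeff_pCons numeral_eq_Suc char2 ac_simps)
  have "eval_poly x4 a * T4 (a * e) + eval_poly x4 a * T4 (b * b) + eval_poly x4 w * T4 (a * b) +
      eval_poly x4 d * T4 (c * p) + eval_poly x4 p * T4 (d * f) = 0"
    using T4_rel[of "[(a, a * e), (a, b * b), (w, a * b), (d, c * p), (p, d * f)]"] pl.rel15 by
        (simp add: hp1[simplified] hp2 power2_eq_square add.assoc)
  from arg_cong[OF this, of "\<lambda>g. coeff g 2"]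
  have r14: "coeff (T4 (c * p)) 0 + coeff (T4 (a * e)) 1 + coeff (T4 (d * f)) 1 + coeff (T4 (d * f))
      2 = 0"
    by (simp add: ev4 sq4 T4_deg coeff_pCons numeral_eq_Suc char2 ac_simps)
  have "eval_poly x4 c * T4 (a * r) + eval_poly x4 q * T4 (w * r) + eval_poly x4 b * T4 (q * r) +
      eval_poly x4 r * T4 (b * c) = 0"
    using T4_rel[of "[(c, a * r), (q, w * r), (b, q * r), (r, b * c)]"] pl.rel16 by (simp add:
        hp1[simplified] hp2 power2_eq_square add.assoc)
  from arg_cong[OF this, of "\<lambda>g. coeff g 5"]
  have r15: "coeff (T4 (b * c)) 1 + coeff (T4 (a * r)) 1 + coeff (T4 (a * r)) 2 + coeff (T4 (w * r))
      3 + coeff (T4 (q * r)) 1 = 0"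
    by (simp add: ev4  T4_deg coeff_pCons numeral_eq_Suc char2 ac_simps)
  have "eval_poly x4 d * T4 (p * f) + eval_poly x4 p * T4 (b * e) + eval_poly x4 e * T4 (p * q) +
      eval_poly x4 w * T4 (c * p) + eval_poly x4 f * T4 (b * p) = 0"
    using T4_rel[of "[(d, p * f), (p, b * e), (e, p * q), (w, c * p), (f, b * p)]"] pl.rel5 by (simp
        add: hp1[simplified] hp2 power2_eq_square add.assoc)
  from arg_cong[OF this, of "\<lambda>g. coeff g 2"]
  have r16: "coeff (T4 (b * e)) 1 + coeff (T4 (b * e)) 2 + coeff (T4 (p * f)) 0 + coeff (T4 (p * q))
      0 = 0"
    by (simp add: ev4  T4_deg coeff_pCons numeral_eq_Suc char2 ac_simps)
  have "eval_poly x4 w * T4 (q * r) + eval_poly x4 b * T4 (w * r) + eval_poly x4 c * T4 (d * f) +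
      eval_poly x4 d * T4 (b * c) = 0"
    using T4_rel[of "[(w, q * r), (b, w * r), (c, d * f), (d, b * c)]"] pl.rel17 by (simp add:
        hp1[simplified] hp2 power2_eq_square add.assoc)
  \<comment> \<open>Again the extreme exponent: \<open>w\<close> has degree 3 on the quartic, so its
    term drops out and the other three contribute their top coefficients.\<close>
  from arg_cong[OF this, of "\<lambda>g. coeff g 8"]
  have r17: "coeff (T4 (b * c)) 4 + coeff (T4 (w * r)) 4 + coeff (T4 (d * f)) 4 = 0"
    by (simp add: ev4  T4_deg coeff_pCons numeral_eq_Suc char2 ac_simps)
  have "eval_poly x4 w * T4 (w * d) + eval_poly x4 b * T4 (d * f) + eval_poly x4 w * T4 (c * c) +
      eval_poly x4 f * T4 (b * c) + eval_poly x4 d * T4 (w * r) = 0"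
    using T4_rel[of "[(w, w * d), (b, d * f), (w, c * c), (f, b * c), (d, w * r)]"] pl.rel18 by
        (simp add: hp1[simplified] hp2 power2_eq_square add.assoc)
  \<comment> \<open>On the quartic w c = t^3 (t^3 + t^4), so the coefficient of t^7 contains the
    constant 1. The known squares in the other relations contribute 0 to the extracted
    coefficients.\<close>
  from arg_cong[OF this, of "\<lambda>g. coeff g 7"]
  have r18: "1 + coeff (T4 (w * d)) 4 + coeff (T4 (b * c)) 3 + coeff (T4 (b * c)) 4 + coeff (T4 (w *
      r)) 3 + coeff (T4 (w * r)) 4 + coeff (T4 (d * f)) 3 = 0"
    by (simp add: ev4 sq4 T4_deg coeff_pCons numeral_eq_Suc char2 ac_simps)
  have "eval_poly x4 b * T4 (a * e) + eval_poly x4 e * T4 (b * c) + eval_poly x4 w * T4 (b * e) = 0"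
    using T4_rel[of "[(b, a * e), (e, b * c), (w, b * e)]"] pl.rel19 by (simp add: hp1[simplified]
        hp2 power2_eq_square add.assoc)
  from arg_cong[OF this, of "\<lambda>g. coeff g 5"]
  have r19: "coeff (T4 (b * e)) 2 + coeff (T4 (b * c)) 1 + coeff (T4 (b * c)) 3 + coeff (T4 (a * e))
      1 = 0"
    by (simp add: ev4  T4_deg coeff_pCons numeral_eq_Suc char2 ac_simps)
  have "eval_poly x4 d * T4 (a * p) + eval_poly x4 a * T4 (q * q) + eval_poly x4 p * T4 (a * r) +
      eval_poly x4 a * T4 (b * e) + eval_poly x4 b * T4 (a * b) = 0"
    using T4_rel[of "[(d, a * p), (a, q * q), (p, a * r), (a, b * e), (b, a * b)]"] pl.rel20 by
        (simp add: hp1[simplified] hp2 power2_eq_square add.assoc)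
  from arg_cong[OF this, of "\<lambda>g. coeff g 2"]
  have r20: "coeff (T4 (b * e)) 1 + coeff (T4 (a * r)) 1 + coeff (T4 (a * r)) 2 + coeff (T4 (a * p))
      0 = 0"
    by (simp add: ev4 sq4 T4_deg coeff_pCons numeral_eq_Suc char2 ac_simps)
  have "eval_poly x4 a * T4 (q * r) + eval_poly x4 w * T4 (p * q) + eval_poly x4 c * T4 (a * q) +
      eval_poly x4 b * T4 (w * p) + eval_poly x4 w * T4 (b * d) = 0"
    using T4_rel[of "[(a, q * r), (w, p * q), (c, a * q), (b, w * p), (w, b * d)]"] pl.rel21 by
        (simp add: hp1[simplified] hp2 power2_eq_square add.assoc)
  from arg_cong[OF this, of "\<lambda>g. coeff g 2"]
  have r21: "coeff (T4 (q * r)) 1 = 0"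
    by (simp add: ev4  T4_deg coeff_pCons numeral_eq_Suc char2 ac_simps)
  \<comment> \<open>The gluing equations, two for a point on three curves when the certificate calls
    for them. The first is at the point e, common to both lines.\<close>
  have r22: "coeff (T0 (w * e)) 0 + coeff (T1 (w * e)) 0 = 0"
    by (rule glue[OF n0_e[OF hp2(33)] n1_e[OF hp2(33)]])
  have r23: "coeff (T0 (p * f)) 0 + coeff (T1 (p * f)) 0 = 0"
    by (rule glue[OF n0_e[OF hp2(24)] n1_e[OF hp2(24)]])
  have r24: "coeff (T0 (w * f)) 1 + coeff (T2 (w * f)) 0 = 0"
    by (rule glue[OF n0_p[OF hp2(34)] n2_p[OF hp2(34)]])
  have r25: "coeff (T0 (a * b)) 1 + coeff (T2 (a * b)) 0 = 0"
    by (rule glue[OF n0_p[OF hp2(1)] n2_p[OF hp2(1)]])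
  have r26: "coeff (T0 (a * p)) 1 + coeff (T2 (a * p)) 0 = 0"
    by (rule glue[OF n0_p[OF hp2(5)] n2_p[OF hp2(5)]])
  have r27: "coeff (T0 (p * q)) 1 + coeff (T2 (p * q)) 0 = 0"
    by (rule glue[OF n0_p[OF hp2(25)] n2_p[OF hp2(25)]])
  have r28: "coeff (T0 (w * e)) 1 + coeff (T4 (w * e)) 0 = 0"
    by (rule glue[OF n0_p[OF hp2(33)] n4_p[OF hp2(33)]])
  have r29: "coeff (T0 (a * p)) 1 + coeff (T4 (a * p)) 0 = 0"
    by (rule glue[OF n0_p[OF hp2(5)] n4_p[OF hp2(5)]])
  have r30: "coeff (T0 (c * p)) 1 + coeff (T4 (c * p)) 0 = 0"
    by (rule glue[OF n0_p[OF hp2(17)] n4_p[OF hp2(17)]])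
  have r31: "coeff (T0 (p * q)) 1 + coeff (T4 (p * q)) 0 = 0"
    by (rule glue[OF n0_p[OF hp2(25)] n4_p[OF hp2(25)]])
  have r32: "coeff (T0 (p * f)) 1 + coeff (T4 (p * f)) 0 = 0"
    by (rule glue[OF n0_p[OF hp2(24)] n4_p[OF hp2(24)]])
  have r33: "coeff (T0 (w * e)) 0 + coeff (T0 (w * e)) 1 + coeff (T3 (w * e)) 0 = 0"
    by (rule glue[OF n0_ep[OF hp2(33)] n3_ep[OF hp2(33)]])
  have r34: "coeff (T0 (w * f)) 0 + coeff (T0 (w * f)) 1 + coeff (T3 (w * f)) 0 = 0"
    by (rule glue[OF n0_ep[OF hp2(34)] n3_ep[OF hp2(34)]])
  have r35: "coeff (T0 (c * p)) 0 + coeff (T0 (c * p)) 1 + coeff (T3 (c * p)) 0 = 0"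
    by (rule glue[OF n0_ep[OF hp2(17)] n3_ep[OF hp2(17)]])
  have r36: "coeff (T0 (p * f)) 0 + coeff (T0 (p * f)) 1 + coeff (T3 (p * f)) 0 = 0"
    by (rule glue[OF n0_ep[OF hp2(24)] n3_ep[OF hp2(24)]])
  have r37: "coeff (T1 (d * f)) 1 + coeff (T3 (d * f)) 3 = 0"
    by (rule glue[OF n1_f[OF hp2(19)] n3_f[OF hp2(19)]])
  have r38: "coeff (T1 (r * f)) 1 + coeff (T3 (r * f)) 3 = 0"
    by (rule glue[OF n1_f[OF hp2(28)] n3_f[OF hp2(28)]])
  have r39: "coeff (T2 (w * d)) 0 + coeff (T2 (w * d)) 1 + coeff (T2 (w * d)) 2 + coeff (T2 (w * d))
      3 + coeff (T4 (w * d)) 4 = 0"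
    by (rule glue[OF n2_abcderf[OF hp2(32)] n4_abcderf[OF hp2(32)]])
  have r40: "coeff (T3 (d * f)) 0 + coeff (T3 (d * f)) 1 + coeff (T3 (d * f)) 2 + coeff (T3 (d * f))
      3 + (coeff (T4 (d * f)) 0 + coeff (T4 (d * f)) 1 + coeff (T4 (d * f)) 2 + coeff (T4 (d * f)) 3
      + coeff (T4 (d * f)) 4) = 0"
    by (rule glue[OF n3_wabdpqr[OF hp2(19)] n4_wabdpqr[OF hp2(19)]])
  have "1 = (coeff (T0 (a * b)) 1 + coeff (T0 (w * f)) 0) + (coeff (T0 (c * p)) 0) + (coeff (T1 (r *
      f)) 1 + coeff (T1 (w * e)) 0) + (coeff (T1 (p * f)) 0 + coeff (T1 (d * f)) 1) + (coeff (T2 (b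
      * e)) 1 + coeff (T2 (p * q)) 0) + (coeff (T2 (w * d)) 1 + coeff (T2 (d * q)) 0) + (coeff (T2
      (a * b)) 0 + coeff (T2 (w * d)) 0 + coeff (T2 (w * d)) 2 + coeff (T2 (b * e)) 1 + coeff (T2 (a
      * p)) 0) + (coeff (T2 (d * q)) 0 + coeff (T2 (w * f)) 0) + (coeff (T2 (w * d)) 3) + (coeff (T3
      (w * f)) 0 + coeff (T3 (p * f)) 0 + coeff (T3 (d * f)) 1) + (coeff (T3 (c * p)) 0 + coeff (T3
      (b * d)) 1 + coeff (T3 (d * f)) 0 + coeff (T3 (w * e)) 0) + (coeff (T3 (b * r)) 2 + coeff (T3
      (b * d)) 1 + coeff (T3 (d * f)) 2) + (coeff (T3 (b * r)) 2 + coeff (T3 (r * f)) 3) + (coeff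
      (T4 (d * f)) 0 + coeff (T4 (w * e)) 0) + (coeff (T4 (c * p)) 0 + coeff (T4 (a * e)) 1 + coeff
      (T4 (d * f)) 1 + coeff (T4 (d * f)) 2) + (coeff (T4 (b * c)) 1 + coeff (T4 (a * r)) 1 + coeff
      (T4 (a * r)) 2 + coeff (T4 (w * r)) 3 + coeff (T4 (q * r)) 1) + (coeff (T4 (b * e)) 1 + coeff
      (T4 (b * e)) 2 + coeff (T4 (p * f)) 0 + coeff (T4 (p * q)) 0) + (coeff (T4 (b * c)) 4 + coeff
      (T4 (w * r)) 4 + coeff (T4 (d * f)) 4) + (1 + coeff (T4 (w * d)) 4 + coeff (T4 (b * c)) 3 +
      coeff (T4 (b * c)) 4 + coeff (T4 (w * r)) 3 + coeff (T4 (w * r)) 4 + coeff (T4 (d * f)) 3) +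
      (coeff (T4 (b * e)) 2 + coeff (T4 (b * c)) 1 + coeff (T4 (b * c)) 3 + coeff (T4 (a * e)) 1) +
      (coeff (T4 (b * e)) 1 + coeff (T4 (a * r)) 1 + coeff (T4 (a * r)) 2 + coeff (T4 (a * p)) 0) +
      (coeff (T4 (q * r)) 1) + (coeff (T0 (w * e)) 0 + coeff (T1 (w * e)) 0) + (coeff (T0 (p * f)) 0
      + coeff (T1 (p * f)) 0) + (coeff (T0 (w * f)) 1 + coeff (T2 (w * f)) 0) + (coeff (T0 (a * b))
      1 + coeff (T2 (a * b)) 0) + (coeff (T0 (a * p)) 1 + coeff (T2 (a * p)) 0) + (coeff (T0 (p *
      q)) 1 + coeff (T2 (p * q)) 0) + (coeff (T0 (w * e)) 1 + coeff (T4 (w * e)) 0) + (coeff (T0 (a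
      * p)) 1 + coeff (T4 (a * p)) 0) + (coeff (T0 (c * p)) 1 + coeff (T4 (c * p)) 0) + (coeff (T0
      (p * q)) 1 + coeff (T4 (p * q)) 0) + (coeff (T0 (p * f)) 1 + coeff (T4 (p * f)) 0) + (coeff
      (T0 (w * e)) 0 + coeff (T0 (w * e)) 1 + coeff (T3 (w * e)) 0) + (coeff (T0 (w * f)) 0 + coeff
      (T0 (w * f)) 1 + coeff (T3 (w * f)) 0) + (coeff (T0 (c * p)) 0 + coeff (T0 (c * p)) 1 + coeff
      (T3 (c * p)) 0) + (coeff (T0 (p * f)) 0 + coeff (T0 (p * f)) 1 + coeff (T3 (p * f)) 0) +
      (coeff (T1 (d * f)) 1 + coeff (T3 (d * f)) 3) + (coeff (T1 (r * f)) 1 + coeff (T3 (r * f)) 3)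
      + (coeff (T2 (w * d)) 0 + coeff (T2 (w * d)) 1 + coeff (T2 (w * d)) 2 + coeff (T2 (w * d)) 3 +
      coeff (T4 (w * d)) 4) + (coeff (T3 (d * f)) 0 + coeff (T3 (d * f)) 1 + coeff (T3 (d * f)) 2 +
      coeff (T3 (d * f)) 3 + (coeff (T4 (d * f)) 0 + coeff (T4 (d * f)) 1 + coeff (T4 (d * f)) 2 +
      coeff (T4 (d * f)) 3 + coeff (T4 (d * f)) 4))"
    by (simp only: char2 add_0_right ac_simps)
  also have "\<dots> = 0" 
    by (rule r0 r1 r2 r3 r4 r5 r6 r7 r8 r9 r10 r11 r12 r13 r14 r15 r16 r17 r18 r19 r20 r21 r22 r23
        r24 r25 r26 r27 r28 r29 r30 r31 r32 r33 r34 r35 r36 r37 r38 r39 r40 | rule zero_plus)+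
  finally show False by simp
qed

theorem proposition8p14:
  assumes "CHAR('k::alg_closed_field) = 2"
  shows "\<not> F_split CHAR('k) (closed_subscheme
    ({pcoord i j * pcoord k l - pcoord i k * pcoord j l + pcoord i l * pcoord j k | i j k l.
        i < j \<and> j < k \<and> k < l \<and> l \<le> 5} \<union>
     {pcoord 0 3 - pcoord 1 4, pcoord 0 4 - pcoord 2 5, pcoord 1 3 + pcoord 0 5,
      pcoord 0 1 + pcoord 2 4, pcoord 0 2 + pcoord 3 5} :: (pluecker_index, 'k) mpoly set))"
proof -
  have "(2 :: 'k) = of_nat CHAR('k)" using assms by simp
  then have "(2 :: 'k) = 0" by simp
  from v14_not_F_split[OF this] show ?thesis
    unfolding assms v14_eqs_def .
qed

end
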